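(* Let $1<p\le n$. Suppose $\mu$ is a nonnegative nonzero finite measure supported on $K\subset\Omega$ with $\dim_{box}(K)<n-p$, and $E>0$ is a solution of $\mathcal L_{A,p}(E)=\mu$ in $\Omega$ (it is not assumed that $E=\infty$ on $K$). (i) Then $$\int_\Omega|\nabla u|_A^p\,dx\ \ge\ \left(\frac{p-1}{p}\right)^p\int_\Omega\frac{|\nabla E|_A^p}{E^p}|u|^p\,dx\qquad\text{for all }u\in W_0^{1,p}(\Omega).$$ (ii) Suppose $E=\infty$ on $K$ and $E=\gamma$ on $\partial\Omega$, where $\gamma$ is a non-negative constant. Then the constant $\left(\frac{p-1}{p}\right)^p$ in (i) is optimal (it cannot be replaced by a larger one).
   Context: $\Omega\subset\mathbb{R}^n$ is a bounded connected domain with smooth boundary. $A(x)=(a^{i,j}(x))$ is an $n\times n$ symmetric, uniformly positive definite matrix with $a^{i,j}\in C^\infty(\overline\Omega)$. For $\xi\in\mathbb{R}^n$, $|\xi|_A^2:=A(x)\xi\cdot\xi$. For $1<p\le n$, $\mathcal L_{A,p}(E):=-\mathrm{div}(|\nabla E|_A^{p-2}A\nabla E)$ (in the distributional sense). For compact $K\subset\mathbb{R}^n$, $\dim_{box}(K):=n-\lim_{r\searrow0}\frac{\log(\mathcal H^n(K_r))}{\log r}$ provided the limit exists, where $K_r:=\{x\in\Omega:\mathrm{dist}(x,K)<r\}$ and $\mathcal H^n$ is $n$-dimensional Hausdorff measure; the set $K$ in the claim is compact. *)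

theory Defs
  imports "HOL-Analysis.Analysis"
begin

section \<open>Smooth functions and smooth domains\<close>

definition partial :: "'n \<Rightarrow> (real^'n::finite \<Rightarrow> real) \<Rightarrow> real^'n \<Rightarrow> real" where
  "partial i f x = frechet_derivative f (at x) (axis i 1)"

definition grad :: "(real^'n::finite \<Rightarrow> real) \<Rightarrow> real^'n \<Rightarrow> real^'n" where
  "grad f x = (\<chi> i. partial i f x)"

primrec partials :: "'n list \<Rightarrow> (real^'n::finite \<Rightarrow> real) \<Rightarrow> real^'n \<Rightarrow> real" where
  "partials [] f = f"
| "partials (i # is) f = partial i (partials is f)"

definition smooth_on :: "(real^'n::finite) set \<Rightarrow> (real^'n \<Rightarrow> real) \<Rightarrow> bool" where
  "smooth_on U f \<longleftrightarrow> open U \<and> (\<forall>is. partials is f differentiable_on U)"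

text \<open>The class \<open>C\<^sup>\<infinity>\<close> on the closure of an open set \<open>U\<close>: the function and all of its partial
  derivatives in \<open>U\<close> extend continuously to \<open>closure U\<close>. The values of \<open>f\<close> outside \<open>U\<close> play no role.\<close>

definition smooth_up_to_boundary :: "(real^'n::finite) set \<Rightarrow> (real^'n \<Rightarrow> real) \<Rightarrow> bool" where
  "smooth_up_to_boundary U f \<longleftrightarrow> smooth_on U f \<and>
     (\<forall>is. \<exists>g. continuous_on (closure U) g \<and> (\<forall>x\<in>U. g x = partials is f x))"

text \<open>Near each boundary point \<open>\<Omega>\<close> is a sublevel set of a smooth function without critical points;
  by the implicit function theorem \<open>\<Omega>\<close> then lies locally on one side of a smooth graph.\<close>

definition smooth_boundary :: "(real^'n::finite) set \<Rightarrow> bool" where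
  "smooth_boundary \<Omega> \<longleftrightarrow>
     (\<forall>z\<in>frontier \<Omega>. \<exists>U g. z \<in> U \<and> smooth_on U g \<and> (\<forall>x\<in>U. grad g x \<noteq> 0) \<and>
        \<Omega> \<inter> U = {x \<in> U. g x < 0})"

definition smooth_bounded_domain :: "(real^'n::finite) set \<Rightarrow> bool" where
  "smooth_bounded_domain \<Omega> \<longleftrightarrow>
     open \<Omega> \<and> connected \<Omega> \<and> \<Omega> \<noteq> {} \<and> bounded \<Omega> \<and> smooth_boundary \<Omega>"

definition test_function :: "(real^'n::finite) set \<Rightarrow> (real^'n \<Rightarrow> real) \<Rightarrow> bool" where
  "test_function U \<phi> \<longleftrightarrow> smooth_on UNIV \<phi> \<and>
     compact (closure {x. \<phi> x \<noteq> 0}) \<and> closure {x. \<phi> x \<noteq> 0} \<subseteq> U"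

section \<open>Sobolev spaces\<close>

definition in_Lp :: "real \<Rightarrow> (real^'n::finite) set \<Rightarrow> (real^'n \<Rightarrow> 'b::euclidean_space) \<Rightarrow> bool" where
  "in_Lp p U f \<longleftrightarrow> set_borel_measurable lebesgue U f \<and>
     (\<integral>\<^sup>+x\<in>U. ennreal (norm (f x) powr p) \<partial>lebesgue) < \<infinity>"

definition in_Lp_loc :: "real \<Rightarrow> (real^'n::finite) set \<Rightarrow> (real^'n \<Rightarrow> 'b::euclidean_space) \<Rightarrow> bool" where
  "in_Lp_loc p U f \<longleftrightarrow> (\<forall>C. compact C \<and> C \<subseteq> U \<longrightarrow> in_Lp p C f)"

text \<open>Weak gradients are determined only up to null sets, so Sobolev functions are treated together
  with a version \<open>G\<close> of their gradient.\<close>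

definition has_weak_gradient ::
    "(real^'n::finite) set \<Rightarrow> (real^'n \<Rightarrow> real) \<Rightarrow> (real^'n \<Rightarrow> real^'n) \<Rightarrow> bool" where
  "has_weak_gradient U u G \<longleftrightarrow> in_Lp_loc 1 U u \<and> in_Lp_loc 1 U G \<and>
     (\<forall>\<phi>. test_function U \<phi> \<longrightarrow>
        set_lebesgue_integral lebesgue U (\<lambda>x. u x *\<^sub>R grad \<phi> x) =
        - set_lebesgue_integral lebesgue U (\<lambda>x. \<phi> x *\<^sub>R G x))"

definition in_W1p ::
    "real \<Rightarrow> (real^'n::finite) set \<Rightarrow> (real^'n \<Rightarrow> real) \<Rightarrow> (real^'n \<Rightarrow> real^'n) \<Rightarrow> bool" where
  "in_W1p p U u G \<longleftrightarrow> has_weak_gradient U u G \<and> in_Lp p U u \<and> in_Lp p U G"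

definition in_W1p_loc ::
    "real \<Rightarrow> (real^'n::finite) set \<Rightarrow> (real^'n \<Rightarrow> real) \<Rightarrow> (real^'n \<Rightarrow> real^'n) \<Rightarrow> bool" where
  "in_W1p_loc p U u G \<longleftrightarrow> has_weak_gradient U u G \<and> in_Lp_loc p U u \<and> in_Lp_loc p U G"

definition in_W1p_0 ::
    "real \<Rightarrow> (real^'n::finite) set \<Rightarrow> (real^'n \<Rightarrow> real) \<Rightarrow> (real^'n \<Rightarrow> real^'n) \<Rightarrow> bool" where
  "in_W1p_0 p U u G \<longleftrightarrow> in_W1p p U u G \<and>
     (\<exists>\<phi>. (\<forall>k::nat. test_function U (\<phi> k)) \<and>
        (\<lambda>k. \<integral>\<^sup>+x\<in>U. ennreal (\<bar>\<phi> k x - u x\<bar> powr p + norm (grad (\<phi> k) x - G x) powr p) \<partial>lebesgue)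
          \<longlonglongrightarrow> 0)"

section \<open>Hausdorff measure and box dimension\<close>

text \<open>For \<open>s > 0\<close> only (since \<open>0 powr 0 = 0\<close>). The factor \<open>unit_ball_vol s\<close> is the usual
  normalisation, which makes \<open>hausdorff_measure n\<close> Lebesgue measure on n-dimensional space.\<close>

definition hausdorff_premeasure :: "real \<Rightarrow> real \<Rightarrow> 'a::metric_space set \<Rightarrow> ennreal" where
  "hausdorff_premeasure s \<delta> S =
     (INF C\<in>{C :: nat \<Rightarrow> 'a set. S \<subseteq> (\<Union>i. C i) \<and> (\<forall>i. bounded (C i) \<and> diameter (C i) \<le> \<delta>)}.
        \<Sum>i. ennreal (unit_ball_vol s * (diameter (C i) / 2) powr s))"

definition hausdorff_measure :: "real \<Rightarrow> 'a::metric_space set \<Rightarrow> ennreal" where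
  "hausdorff_measure s S = (SUP \<delta>\<in>{0<..}. hausdorff_premeasure s \<delta> S)"

text \<open>The limit need not exist, so box dimension is a relation. The set \<open>K\<close> is meant to be nonempty
  (\<open>infdist x {} = 0\<close> by convention).\<close>

definition has_box_dim :: "(real^'n::finite) set \<Rightarrow> (real^'n) set \<Rightarrow> real \<Rightarrow> bool" where
  "has_box_dim \<Omega> K d \<longleftrightarrow>
     (\<exists>l. ((\<lambda>r. ln (enn2real (hausdorff_measure (real CARD('n)) {x\<in>\<Omega>. infdist x K < r})) / ln r)
            \<longlongrightarrow> l) (at_right 0) \<and>
          d = real CARD('n) - l)"

section \<open>The operator\<close>

definition norm_A :: "real^'n^'n \<Rightarrow> real^'n::finite \<Rightarrow> real" where
  "norm_A M \<xi> = sqrt ((M *v \<xi>) \<bullet> \<xi>)"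

definition admissible_matrix :: "(real^'n::finite) set \<Rightarrow> (real^'n \<Rightarrow> real^'n^'n) \<Rightarrow> bool" where
  "admissible_matrix \<Omega> A \<longleftrightarrow>
     (\<forall>i j. smooth_up_to_boundary \<Omega> (\<lambda>x. A x $ i $ j)) \<and>
     (\<forall>x\<in>\<Omega>. transpose (A x) = A x) \<and>
     (\<exists>\<theta>>0. \<forall>x\<in>\<Omega>. \<forall>\<xi>. (A x *v \<xi>) \<bullet> \<xi> \<ge> \<theta> * (norm \<xi>)\<^sup>2)"

definition flux :: "real \<Rightarrow> (real^'n::finite \<Rightarrow> real^'n^'n) \<Rightarrow> (real^'n \<Rightarrow> real^'n) \<Rightarrow> real^'n \<Rightarrow> real^'n" where
  "flux p A G x = (norm_A (A x) (G x) powr (p - 2)) *\<^sub>R (A x *v G x)"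

text \<open>\<open>E\<close>, with gradient \<open>G\<close>, solves \<open>- div (|\<nabla>E|\<^sub>A\<^sup>p\<^sup>-\<^sup>2 A \<nabla>E) = \<mu>\<close> in \<open>\<Omega>\<close> in the sense of distributions, where
  the measure \<open>\<mu>\<close> lives on a Lebesgue null set \<open>K\<close>. Away from \<open>K\<close>, \<open>E\<close> is in the energy class. Across \<open>K\<close>
  only the flux has to be locally integrable: already for the fundamental solution of the p-Laplacian with
  \<open>p \<le> 2 - 1/n\<close>, \<open>\<nabla>E\<close> is not locally integrable near the pole, hence is not a weak gradient in \<open>\<Omega>\<close>.\<close>

definition solves_measure_equation ::
    "real \<Rightarrow> (real^'n::finite \<Rightarrow> real^'n^'n) \<Rightarrow> (real^'n) set \<Rightarrow> (real^'n) set \<Rightarrow> (real^'n) measure \<Rightarrow>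
     (real^'n \<Rightarrow> real) \<Rightarrow> (real^'n \<Rightarrow> real^'n) \<Rightarrow> bool" where
  "solves_measure_equation p A \<Omega> K \<mu> E G \<longleftrightarrow>
     in_W1p_loc p (\<Omega> - K) E G \<and>
     in_Lp_loc 1 \<Omega> (flux p A G) \<and>
     (\<forall>\<phi>. test_function \<Omega> \<phi> \<longrightarrow>
        set_lebesgue_integral lebesgue \<Omega> (\<lambda>x. flux p A G x \<bullet> grad \<phi> x) = (\<integral>x. \<phi> x \<partial>\<mu>))"

section \<open>The Hardy inequality\<close>

text \<open>Both sides are integrals with values in \<open>[0,\<infinity>]\<close>, so no integrability of the weighted term is presupposed.\<close>

definition hardy_inequality ::
    "real \<Rightarrow> (real^'n::finite \<Rightarrow> real^'n^'n) \<Rightarrow> (real^'n) set \<Rightarrow> (real^'n \<Rightarrow> real) \<Rightarrow> (real^'n \<Rightarrow> real^'n) \<Rightarrow>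
     real \<Rightarrow> bool" where
  "hardy_inequality p A \<Omega> E G c \<longleftrightarrow>
     (\<forall>u Du. in_W1p_0 p \<Omega> u Du \<longrightarrow>
        (\<integral>\<^sup>+x\<in>\<Omega>. ennreal (norm_A (A x) (Du x) powr p) \<partial>lebesgue) \<ge>
        ennreal c *
        (\<integral>\<^sup>+x\<in>\<Omega>. ennreal (norm_A (A x) (G x) powr p / E x powr p * \<bar>u x\<bar> powr p) \<partial>lebesgue))"

end

theory Submission
  imports Defs
begin

text \<open>
  (i) Away from \<open>K\<close>, test the equation with \<open>|\<psi>|\<^sup>p (E + \<delta>)\<^bsup>1-p\<^esup>\<close>: Young's inequality absorbs the mixed term,
  and letting \<open>\<delta> \<rightarrow> 0\<close> gives the inequality for \<open>\<psi>\<close> supported in \<open>\<Omega> - K\<close>. The box dimension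
  bounds the volume of the \<open>r\<close>-neighbourhood of \<open>K\<close> by \<open>o(r\<^sup>p)\<close>, so cutting off at distance \<open>r\<close> from \<open>K\<close>
  costs nothing in the limit; Fatou's lemma then reaches all of \<open>W\<^sub>0\<close>.

  (ii) Testing with \<open>F(E)\<close>, where \<open>F\<close> vanishes below a level above \<open>\<gamma>\<close> and is constant for large
  values, shows that \<open>E\<close> pushes \<open>|\<nabla>E|\<^sub>A\<^sup>p dx\<close> forward to \<open>\<mu>(K) dt\<close> on \<open>(\<gamma>, \<infinity>)\<close>. Hence for \<open>u = f(E)\<close> both
  sides of the inequality become one-dimensional integrals, and \<open>f(t) = t\<^bsup>(p-1)/p\<^esup> g(\<tau> ln t)\<close> with a
  bump \<open>g\<close> and small \<open>\<tau>\<close> comes arbitrarily close to the Hardy constant.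

  Chain rules for the Sobolev function \<open>E\<close> are avoided by applying them to its mollifications only.
\<close>

section \<open>Convergence in Lp\<close>

text \<open>The obstacle is how little is available about \<open>E\<close>. It is positive at each
  point of \<Omega> - K, but without a positive lower bound on compact sets, so
  \<open>E powr (1 - p)\<close> need not be a bounded multiplier; hence the shift by \<delta>. Its
  gradient \<open>G\<close> is locally p-integrable only away from \<open>K\<close>, so the limits
  in the equation are taken on a compact \<open>C\<close> inside \<Omega> - K, where the flux lies
  in the dual class. Part (ii) needs F(E) as a test function although it does not vanish near
  \<open>K\<close>; as it is constant there, its gradient still lives on such a \<open>C\<close>,
  and the measure sees only the constant.

  The constant: put \<beta> = (p - 1)/p. Young's inequality with weight w leaves the factor (p -
  1)(1 - w) w^(p - 1) after absorption, which is largest at w = \<beta>, with value \<beta>^p. The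
  same \<beta> is the critical exponent in (ii): the p-th powers of the derivative of t^\<beta> and
  of t^\<beta> / t are both multiples of 1/t, with ratio \<beta>^p, and the logarithmic bump makes
  the divergent integrals finite at a cost that vanishes with \<tau>.\<close>

lemma tangent_powr_le:
  fixes p s t :: real
  assumes "1 < p" "0 \<le> s" "0 \<le> t"
  shows "p * s powr (p - 1) * t \<le> (p - 1) * s powr p + t powr p"
proof -
  have "t * s powr (p - 1) \<le> t powr p / p + (s powr (p - 1)) powr (p / (p - 1)) / (p / (p - 1))"
    by (rule Youngs_inequality) (use assms in \<open>auto simp: field_simps\<close>)
  also have "(s powr (p - 1)) powr (p / (p - 1)) = s powr p"
    using assms by (simp add: powr_powr)
  finally show ?thesis
    using assms by (simp add: field_simps)
qed

text \<open>Convexity of \<open>powr p\<close> at the combination of \<open>x / (1 - t)\<close> and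
  \<open>y / t\<close>. The first coefficient tends to 1 as \<open>t\<close> tends to 0, so a limit
  in which \<open>y\<close> becomes negligible loses no constant; \<open>hardy_W1p_0\<close> depends
  on this.\<close>

lemma powr_add_le:
  fixes p x y t :: real
  assumes "1 < p" "0 \<le> x" "0 \<le> y" "0 < t" "t < 1"
  shows "(x + y) powr p \<le> (1 - t) powr (1 - p) * x powr p + t powr (1 - p) * y powr p"
proof -
  let ?s = "x + y"
  \<comment> \<open>Both tangent inequalities are taken at the same point \<open>?s = x + y\<close>;
    in their weighted sum all multiples of \<open>?s powr p\<close> combine and one copy
    remains.\<close>
  have "(1 - t) * (p * ?s powr (p - 1) * (x / (1 - t))) \<le> (1 - t) * ((p - 1) * ?s powr p + (x / (1 - t)) powr p)"
    using assms by (intro mult_left_mono tangent_powr_le) auto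
  moreover have "t * (p * ?s powr (p - 1) * (y / t)) \<le> t * ((p - 1) * ?s powr p + (y / t) powr p)"
    using assms by (intro mult_left_mono tangent_powr_le) auto
  moreover have "(1 - t) * (x / (1 - t)) powr p = (1 - t) powr (1 - p) * x powr p"
    using assms by (simp add: powr_divide powr_diff)
  moreover have "t * (y / t) powr p = t powr (1 - p) * y powr p"
    using assms by (simp add: powr_divide powr_diff)
  moreover have "?s powr (p - 1) * ?s = ?s powr p"
    using assms by (cases "?s = 0") (auto simp: powr_diff)
  moreover have "(1 - t) * (p * ?s powr (p - 1) * (x / (1 - t))) + t * (p * ?s powr (p - 1) * (y / t))
     = p * (?s powr (p - 1) * ?s)"
  proof -
    have "(1 - t) * (p * ?s powr (p - 1) * (x / (1 - t))) = p * ?s powr (p - 1) * x"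
      "t * (p * ?s powr (p - 1) * (y / t)) = p * ?s powr (p - 1) * y"
      using assms by auto
    then show ?thesis by (simp only: distrib_left mult.assoc)
  qed
  ultimately show ?thesis
    by (simp add: algebra_simps)
qed

text \<open>A lossy bound, for estimates in which constants do not matter.\<close>

lemma powr_add_le_two:
  fixes p x y :: real
  assumes "0 \<le> p" "0 \<le> x" "0 \<le> y"
  shows "(x + y) powr p \<le> 2 powr p * (x powr p + y powr p)"
proof -
  have "(x + y) powr p \<le> (2 * max x y) powr p"
    using assms by (intro powr_mono2) auto
  also have "\<dots> = 2 powr p * max x y powr p"
    using assms by (simp add: powr_mult)
  also have "\<dots> \<le> 2 powr p * (x powr p + y powr p)"
    by (intro mult_left_mono) (auto simp: max_def)
  finally show ?thesis .
qed

text \<open>Young's inequality with a free weight and without the best constants, by comparing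
  \<open>y\<close> with \<open>t * x\<close>. A small \<open>t\<close> tames a factor that is merely
  bounded while the other one tends to 0; this takes the place of Hoelder's inequality.\<close>

lemma powr_mult_le_weighted:
  fixes p x y t :: real
  assumes "1 < p" "0 \<le> x" "0 \<le> y" "0 < t"
  shows "x powr (p - 1) * y \<le> t * x powr p + t powr (1 - p) * y powr p"
proof (cases "y \<le> t * x")
  case True
  have "x powr (p - 1) * y \<le> x powr (p - 1) * (t * x)"
    using True by (intro mult_left_mono) auto
  also have "\<dots> = t * x powr p"
    using assms by (cases "x = 0") (auto simp: powr_diff)
  finally show ?thesis
    using assms by (smt (verit) mult_nonneg_nonneg powr_ge_zero)
next
  case False
  have "x powr (p - 1) * y \<le> (y / t) powr (p - 1) * y"
    using False assms by (intro mult_right_mono powr_mono2) (auto simp: field_simps)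
  also have "\<dots> = t powr (1 - p) * y powr p"
    using assms by (cases "y = 0") (auto simp: powr_diff powr_divide field_simps)
  finally show ?thesis
    using assms by (smt (verit) mult_nonneg_nonneg powr_ge_zero)
qed

section \<open>Null sequences and Fatou's lemma with values in the extended half-line\<close>

lemma ennreal_tendsto_0I:
  fixes f :: "'a \<Rightarrow> ennreal"
  assumes "\<And>e::real. 0 < e \<Longrightarrow> eventually (\<lambda>k. f k \<le> ennreal e) F"
  shows "(f \<longlongrightarrow> 0) F"
proof (rule order_tendstoI)
  fix a :: ennreal assume "0 < a"
  then obtain e where e: "0 < e" "ennreal e < a"
    by (metis ennreal_0 ennreal_less_iff ennreal_rat_dense ennreal_neg le_numeral_extra(3) leI less_eq_real_def not_less_zero)
  show "eventually (\<lambda>k. f k < a) F"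
    using assms[OF e(1)] by eventually_elim (use e in order)
qed auto

lemma ennreal_tendsto_0D:
  fixes f :: "'a \<Rightarrow> ennreal"
  assumes "(f \<longlongrightarrow> 0) F" "0 < (e::real)"
  shows "eventually (\<lambda>k. f k < ennreal e) F"
  using order_tendstoD(2)[OF assms(1), of "ennreal e"] assms(2) by simp

lemma ennreal_tendsto_0_le:
  fixes f g :: "'a \<Rightarrow> ennreal"
  assumes "(g \<longlongrightarrow> 0) F" "\<And>k. f k \<le> g k"
  shows "(f \<longlongrightarrow> 0) F"
  using tendsto_sandwich[OF always_eventually always_eventually tendsto_const assms(1), of f] assms(2)
  by simp

text \<open>Fatou's lemma with converging upper bounds. The weighted side of the Hardy inequality
  passes to the limit through it three times, so that no convergence of that side has to be known in
  advance.\<close>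

lemma nn_integral_le_limit:
  fixes f :: "nat \<Rightarrow> 'a \<Rightarrow> ennreal"
  assumes "\<And>k. f k \<in> borel_measurable M"
    and "AE x in M. (\<lambda>k. f k x) \<longlonglongrightarrow> g x"
    and "\<And>k. (\<integral>\<^sup>+x. f k x \<partial>M) \<le> B k" "B \<longlonglongrightarrow> b"
  shows "(\<integral>\<^sup>+x. g x \<partial>M) \<le> b"
proof -
  have "(\<integral>\<^sup>+x. g x \<partial>M) = (\<integral>\<^sup>+x. liminf (\<lambda>k. f k x) \<partial>M)"
    using assms(2) by (intro nn_integral_cong_AE) (auto elim!: eventually_mono dest: lim_imp_Liminf[rotated])
  also have "\<dots> \<le> liminf (\<lambda>k. \<integral>\<^sup>+x. f k x \<partial>M)"
    by (intro nn_integral_liminf assms)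
  also have "\<dots> \<le> liminf B"
    by (intro Liminf_mono always_eventually allI assms)
  also have "\<dots> = b"
    using assms(4) by (simp add: lim_imp_Liminf)
  finally show ?thesis .
qed

abbreviation Lp_int :: "'a measure \<Rightarrow> real \<Rightarrow> ('a \<Rightarrow> 'b::real_normed_vector) \<Rightarrow> ennreal" where
  "Lp_int M p f \<equiv> \<integral>\<^sup>+x. ennreal (norm (f x) powr p) \<partial>M"

text \<open>The p-th power of the distance is used without the root. Finite norms are not part of
  the notion; they are separate hypotheses where they matter.\<close>

definition Lp_tendsto :: "'a measure \<Rightarrow> real \<Rightarrow> (nat \<Rightarrow> 'a \<Rightarrow> 'b::euclidean_space) \<Rightarrow> ('a \<Rightarrow> 'b) \<Rightarrow> bool" where
  "Lp_tendsto M p V W \<longleftrightarrow> (\<forall>k. V k \<in> borel_measurable M) \<and> W \<in> borel_measurable M \<and>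
     (\<lambda>k. \<integral>\<^sup>+x. ennreal (norm (V k x - W x) powr p) \<partial>M) \<longlonglongrightarrow> 0"

text \<open>Split \<open>c V - d W = c (V - W) + (c - d) W\<close>: the first part is small since
  \<open>c\<close> is bounded, the second by dominated convergence. Applied to gradients of
  functions of mollifications, it takes the place of a chain rule for \<open>E\<close>.\<close>

lemma Lp_tendsto_scaleR:
  fixes V :: "nat \<Rightarrow> 'a \<Rightarrow> 'b::euclidean_space"
  assumes V: "Lp_tendsto M p V W" and p: "1 < p"
    and W: "Lp_int M p W < \<infinity>"
    and c[measurable]: "\<And>k. c k \<in> borel_measurable M" "d \<in> borel_measurable M"
    and B: "\<And>k x. x \<in> space M \<Longrightarrow> \<bar>c k x\<bar> \<le> B" "\<And>x. x \<in> space M \<Longrightarrow> \<bar>d x\<bar> \<le> B"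
    and lim: "AE x in M. (\<lambda>k. c k x) \<longlonglongrightarrow> d x"
  shows "Lp_tendsto M p (\<lambda>k x. c k x *\<^sub>R V k x) (\<lambda>x. d x *\<^sub>R W x)"
\<comment> \<open>Over an empty space the bounds do not give \<open>0 \<le> B\<close>.\<close>
proof (cases "space M = {}")
  case True
  then show ?thesis
    unfolding Lp_tendsto_def by (simp add: nn_integral_empty) (simp add: measurable_def)
next
  case False
  then have B0: "0 \<le> B" using B(2) by (metis abs_ge_zero all_not_in_conv order_trans)
  have [measurable]: "\<And>k. V k \<in> borel_measurable M" "W \<in> borel_measurable M"
    using V by (auto simp: Lp_tendsto_def)
  have VW: "(\<lambda>k. \<integral>\<^sup>+x. ennreal (norm (V k x - W x) powr p) \<partial>M) \<longlonglongrightarrow> 0"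
    using V by (auto simp: Lp_tendsto_def)
  define R where "R k = (\<integral>\<^sup>+x. ennreal (\<bar>c k x - d x\<bar> powr p * norm (W x) powr p) \<partial>M)" for k
  have "R \<longlonglongrightarrow> (\<integral>\<^sup>+x. 0 \<partial>M)"
    unfolding R_def
  proof (rule nn_integral_dominated_convergence[where w="\<lambda>x. ennreal ((2 * B) powr p * norm (W x) powr p)"])
    show "AE x in M. ennreal (\<bar>c k x - d x\<bar> powr p * norm (W x) powr p) \<le> ennreal ((2 * B) powr p * norm (W x) powr p)" for k
    proof (rule AE_I2)
      fix x assume "x \<in> space M"
      then have "\<bar>c k x - d x\<bar> \<le> 2 * B" using B(1)[of x k] B(2)[of x] by linarith
      then show "ennreal (\<bar>c k x - d x\<bar> powr p * norm (W x) powr p) \<le> ennreal ((2 * B) powr p * norm (W x) powr p)"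
        using p by (intro ennreal_leI mult_right_mono powr_mono2) auto
    qed
    show "(\<integral>\<^sup>+ x. ennreal ((2 * B) powr p * norm (W x) powr p) \<partial>M) < \<infinity>"
      using W by (subst ennreal_mult) (auto simp: nn_integral_cmult ennreal_mult_less_top)
    show "AE x in M. (\<lambda>k. ennreal (\<bar>c k x - d x\<bar> powr p * norm (W x) powr p)) \<longlonglongrightarrow> 0"
      using lim
    proof eventually_elim
      fix x assume "(\<lambda>k. c k x) \<longlonglongrightarrow> d x"
      then have "(\<lambda>k. \<bar>c k x - d x\<bar>) \<longlonglongrightarrow> 0"
        using tendsto_rabs_zero LIM_zero by blast
      then have "(\<lambda>k. \<bar>c k x - d x\<bar> powr p) \<longlonglongrightarrow> 0"
        using p by (intro tendsto_zero_powrI[where b=p]) (auto intro: tendsto_const)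
      then have "(\<lambda>k. \<bar>c k x - d x\<bar> powr p * norm (W x) powr p) \<longlonglongrightarrow> 0"
        by (rule tendsto_mult_left_zero)
      then show "(\<lambda>k. ennreal (\<bar>c k x - d x\<bar> powr p * norm (W x) powr p)) \<longlonglongrightarrow> 0"
        by (metis ennreal_0 tendsto_ennrealI)
    qed
  qed auto
  then have R0: "R \<longlonglongrightarrow> 0" by simp
  have bd: "Lp_int M p (\<lambda>x. c k x *\<^sub>R V k x - d x *\<^sub>R W x) \<le>
      ennreal (2 powr p) * (ennreal (B powr p) * Lp_int M p (\<lambda>x. V k x - W x) + R k)" for k
  proof -
    have "Lp_int M p (\<lambda>x. c k x *\<^sub>R V k x - d x *\<^sub>R W x) \<le>
       (\<integral>\<^sup>+x. ennreal (2 powr p) * (ennreal (B powr p) * ennreal (norm (V k x - W x) powr p) +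
          ennreal (\<bar>c k x - d x\<bar> powr p * norm (W x) powr p)) \<partial>M)"
    proof (rule nn_integral_mono)
      fix x assume x: "x \<in> space M"
      have "c k x *\<^sub>R V k x - d x *\<^sub>R W x = c k x *\<^sub>R (V k x - W x) + (c k x - d x) *\<^sub>R W x"
        by (simp add: algebra_simps)
      then have "norm (c k x *\<^sub>R V k x - d x *\<^sub>R W x) \<le> norm (c k x *\<^sub>R (V k x - W x)) + norm ((c k x - d x) *\<^sub>R W x)"
        by (metis norm_triangle_ineq)
      also have "\<dots> \<le> B * norm (V k x - W x) + \<bar>c k x - d x\<bar> * norm (W x)"
        using B(1)[OF x] by (auto intro!: mult_right_mono)
      finally have "norm (c k x *\<^sub>R V k x - d x *\<^sub>R W x) powr p \<le> (B * norm (V k x - W x) + \<bar>c k x - d x\<bar> * norm (W x)) powr p"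
        using p by (intro powr_mono2) auto
      also have "\<dots> \<le> 2 powr p * ((B * norm (V k x - W x)) powr p + (\<bar>c k x - d x\<bar> * norm (W x)) powr p)"
        using p B0 by (intro powr_add_le_two) auto
      also have "\<dots> = 2 powr p * (B powr p * norm (V k x - W x) powr p + \<bar>c k x - d x\<bar> powr p * norm (W x) powr p)"
        using B0 by (simp add: powr_mult)
      finally show "ennreal (norm (c k x *\<^sub>R V k x - d x *\<^sub>R W x) powr p) \<le> ennreal (2 powr p) * (ennreal (B powr p) * ennreal (norm (V k x - W x) powr p) +
          ennreal (\<bar>c k x - d x\<bar> powr p * norm (W x) powr p))"
        by (simp flip: ennreal_mult ennreal_plus)
    qed
    also have "\<dots> = ennreal (2 powr p) * (ennreal (B powr p) * Lp_int M p (\<lambda>x. V k x - W x) + R k)"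
      unfolding R_def by (simp add: nn_integral_cmult nn_integral_add)
    finally show ?thesis .
  qed
  have "(\<lambda>k. ennreal (2 powr p) * (ennreal (B powr p) * Lp_int M p (\<lambda>x. V k x - W x) + R k))
      \<longlonglongrightarrow> ennreal (2 powr p) * (ennreal (B powr p) * 0 + 0)"
    by (intro ennreal_tendsto_cmult tendsto_add VW R0) auto
  then have "(\<lambda>k. ennreal (2 powr p) * (ennreal (B powr p) * Lp_int M p (\<lambda>x. V k x - W x) + R k)) \<longlonglongrightarrow> 0"
    by simp
  then have "(\<lambda>k. \<integral>\<^sup>+x. ennreal (norm (c k x *\<^sub>R V k x - d x *\<^sub>R W x) powr p) \<partial>M) \<longlonglongrightarrow> 0"
    by (rule ennreal_tendsto_0_le) (rule bd)
  then show ?thesis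
    by (simp add: Lp_tendsto_def)
qed

text \<open>The growth condition puts \<open>w\<close> into the class dual to Lp. The flux satisfies
  it with \<open>X\<close> the A-norm of the gradient.\<close>

lemma integrable_inner_Lp:
  fixes w V :: "'a \<Rightarrow> 'b::euclidean_space"
  assumes p: "1 < p" and w: "w \<in> borel_measurable M" "V \<in> borel_measurable M" "X \<in> borel_measurable M"
    and X: "\<And>x. x \<in> space M \<Longrightarrow> 0 \<le> X x" "\<And>x. x \<in> space M \<Longrightarrow> norm (w x) \<le> C * X x powr (p - 1)"
    and fin: "(\<integral>\<^sup>+x. ennreal (X x powr p) \<partial>M) < \<infinity>" "Lp_int M p V < \<infinity>"
    and C: "0 \<le> C"
  shows "integrable M (\<lambda>x. w x \<bullet> V x)"
proof (rule Bochner_Integration.integrable_bound)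
  show "integrable M (\<lambda>x. C * (X x powr p + norm (V x) powr p))"
    using fin w by (intro integrable_mult_right Bochner_Integration.integrable_add)
      (auto simp: integrable_iff_bounded)
  show "AE x in M. norm (w x \<bullet> V x) \<le> norm (C * (X x powr p + norm (V x) powr p))"
  proof (rule AE_I2)
    fix x assume x: "x \<in> space M"
    have "norm (w x \<bullet> V x) \<le> norm (w x) * norm (V x)"
      by (simp add: Cauchy_Schwarz_ineq2)
    also have "\<dots> \<le> C * X x powr (p - 1) * norm (V x)"
      by (intro mult_right_mono X x) auto
    also have "\<dots> \<le> C * (1 * X x powr p + 1 powr (1 - p) * norm (V x) powr p)"
      using powr_mult_le_weighted[OF p X(1)[OF x], of "norm (V x)" 1] C
      by (simp add: mult.assoc mult_left_mono)
    finally show "norm (w x \<bullet> V x) \<le> norm (C * (X x powr p + norm (V x) powr p))"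
      using C by simp
  qed
qed (use w in measurable)

lemma nn_integral_norm_diff_powr_triangle:
  fixes f g h :: "'a \<Rightarrow> 'b::euclidean_space"
  assumes [measurable]: "f \<in> borel_measurable M" "g \<in> borel_measurable M" "h \<in> borel_measurable M" and p: "0 \<le> p"
  shows "Lp_int M p (\<lambda>x. f x - h x) \<le>
    ennreal (2 powr p) * (Lp_int M p (\<lambda>x. f x - g x) + Lp_int M p (\<lambda>x. g x - h x))"
proof -
  have "Lp_int M p (\<lambda>x. f x - h x) \<le>
     (\<integral>\<^sup>+x. ennreal (2 powr p) * (ennreal (norm (f x - g x) powr p) + ennreal (norm (g x - h x) powr p)) \<partial>M)"
  proof (rule nn_integral_mono)
    fix x
    have "norm (f x - h x) powr p \<le> (norm (f x - g x) + norm (g x - h x)) powr p"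
      using norm_triangle_ineq[of "f x - g x" "g x - h x"] by (intro powr_mono2 p) auto
    also have "\<dots> \<le> 2 powr p * (norm (f x - g x) powr p + norm (g x - h x) powr p)"
      by (intro powr_add_le_two p) auto
    finally show "ennreal (norm (f x - h x) powr p) \<le> ennreal (2 powr p) * (ennreal (norm (f x - g x) powr p) + ennreal (norm (g x - h x) powr p))"
      by (simp flip: ennreal_mult ennreal_plus)
  qed
  also have "\<dots> = ennreal (2 powr p) * (Lp_int M p (\<lambda>x. f x - g x) + Lp_int M p (\<lambda>x. g x - h x))"
    by (simp add: nn_integral_cmult nn_integral_add)
  finally show ?thesis .
qed

lemma Lp_tendsto_finite:
  assumes V: "Lp_tendsto M p V W" and p: "0 \<le> p" and W: "Lp_int M p W < \<infinity>"
  shows "eventually (\<lambda>k. Lp_int M p (V k) < \<infinity>) sequentially"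
proof -
  have [measurable]: "\<And>k. V k \<in> borel_measurable M" "W \<in> borel_measurable M"
    using V by (auto simp: Lp_tendsto_def)
  have "eventually (\<lambda>k. Lp_int M p (\<lambda>x. V k x - W x) < ennreal 1) sequentially"
    using V by (intro ennreal_tendsto_0D) (auto simp: Lp_tendsto_def)
  then show ?thesis
  proof eventually_elim
    fix k assume k: "Lp_int M p (\<lambda>x. V k x - W x) < ennreal 1"
    have "Lp_int M p (V k) \<le> ennreal (2 powr p) * (Lp_int M p (\<lambda>x. V k x - W x) + Lp_int M p W)"
      using nn_integral_norm_diff_powr_triangle[of "V k" M W "\<lambda>_. 0" p] p by simp
    also have "\<dots> < \<infinity>"
      using order.strict_trans[OF k ennreal_less_top] W by (simp add: ennreal_mult_less_top)
    finally show "Lp_int M p (V k) < \<infinity>" .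
  qed
qed

text \<open>With \<open>w\<close> fixed in the dual class, \<open>powr_mult_le_weighted\<close>
  bounds the difference of the integrals by a small multiple of the fixed integral of
  \<open>X powr p\<close> plus a large multiple of a quantity that tends to 0.\<close>

lemma Lp_tendsto_integral_inner:
  fixes w :: "'a \<Rightarrow> 'b::euclidean_space"
  assumes p: "1 < p" and V: "Lp_tendsto M p V W"
    and w: "w \<in> borel_measurable M" "X \<in> borel_measurable M"
    and X: "\<And>x. x \<in> space M \<Longrightarrow> 0 \<le> X x" "\<And>x. x \<in> space M \<Longrightarrow> norm (w x) \<le> C * X x powr (p - 1)"
    and fin: "(\<integral>\<^sup>+x. ennreal (X x powr p) \<partial>M) < \<infinity>" "Lp_int M p W < \<infinity>"
  shows "(\<lambda>k. \<integral>x. w x \<bullet> V k x \<partial>M) \<longlonglongrightarrow> (\<integral>x. w x \<bullet> W x \<partial>M)"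
proof -
  \<comment> \<open>\<open>C\<close> may be negative here; \<open>D\<close> is a positive
    substitute.\<close>
  define D where "D = \<bar>C\<bar> + 1"
  have D: "0 < D" unfolding D_def by linarith
  have XD: "norm (w x) \<le> D * X x powr (p - 1)" if "x \<in> space M" for x
  proof -
    have "C * X x powr (p - 1) \<le> D * X x powr (p - 1)"
      by (intro mult_right_mono) (auto simp: D_def)
    then show ?thesis using X(2)[OF that] by linarith
  qed
  have [measurable]: "\<And>k. V k \<in> borel_measurable M" "W \<in> borel_measurable M" "w \<in> borel_measurable M" "X \<in> borel_measurable M"
    using V w by (auto simp: Lp_tendsto_def)
  have V0: "(\<lambda>k. \<integral>\<^sup>+x. ennreal (norm (V k x - W x) powr p) \<partial>M) \<longlonglongrightarrow> 0"
    using V by (simp add: Lp_tendsto_def)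
  have iW: "integrable M (\<lambda>x. w x \<bullet> W x)"
    using D by (intro integrable_inner_Lp[OF p _ _ _ X(1) XD]) (use fin in auto)
  obtain N where N: "\<And>k. k \<ge> N \<Longrightarrow> (Lp_int M p (V k)) < \<infinity>"
    using Lp_tendsto_finite[OF V _ fin(2)] p by (auto simp: eventually_sequentially)
  have iV: "integrable M (\<lambda>x. w x \<bullet> V k x)" if "k \<ge> N" for k
    using D N[OF that] by (intro integrable_inner_Lp[OF p _ _ _ X(1) XD]) (use fin in auto)
  obtain I where I: "0 \<le> I" "(\<integral>\<^sup>+x. ennreal (X x powr p) \<partial>M) = ennreal I"
    using fin(1) by (metis ennreal_cases infinity_ennreal_def less_irrefl)
  have "(\<lambda>k. \<integral>\<^sup>+x. ennreal (norm (w x \<bullet> V k x - w x \<bullet> W x)) \<partial>M) \<longlonglongrightarrow> 0"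
  proof (rule ennreal_tendsto_0I)
    fix e :: real assume e: "0 < e"
    \<comment> \<open>This keeps the part with \<open>X\<close> below \<open>e / 2\<close>;
      \<open>I + 1\<close> avoids a division by 0. The threshold \<open>d\<close> then makes the
      other part \<open>e / 2\<close>.\<close>
    define t where "t = e / (2 * D * (I + 1))"
    have t: "0 < t" using e D I by (simp add: t_def)
    have "D * t * I = e / 2 * (I / (I + 1))" using D by (simp add: t_def)
    also have "\<dots> \<le> e / 2 * 1" using e I by (intro mult_left_mono) auto
    finally have tI: "D * t * I \<le> e / 2" by simp
    define d where "d = e / (2 * D * t powr (1 - p))"
    have d: "0 < d" "D * t powr (1 - p) * d = e / 2" using e D t by (auto simp: d_def field_simps)
    show "\<forall>\<^sub>F k in sequentially. (\<integral>\<^sup>+x. ennreal (norm (w x \<bullet> V k x - w x \<bullet> W x)) \<partial>M) \<le> ennreal e"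
      using ennreal_tendsto_0D[OF V0 d(1)]
    proof eventually_elim
      fix k assume k: "Lp_int M p (\<lambda>x. V k x - W x) < ennreal d"
      have "(\<integral>\<^sup>+x. ennreal (norm (w x \<bullet> V k x - w x \<bullet> W x)) \<partial>M) \<le>
         (\<integral>\<^sup>+x. ennreal (D * t) * ennreal (X x powr p) + ennreal (D * t powr (1 - p)) * ennreal (norm (V k x - W x) powr p) \<partial>M)"
      proof (rule nn_integral_mono)
        fix x assume x: "x \<in> space M"
        have "norm (w x \<bullet> V k x - w x \<bullet> W x) = norm (w x \<bullet> (V k x - W x))"
          by (simp add: inner_diff_right)
        also have "\<dots> \<le> norm (w x) * norm (V k x - W x)"
          by (simp add: Cauchy_Schwarz_ineq2)
        also have "\<dots> \<le> D * X x powr (p - 1) * norm (V k x - W x)"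
          by (intro mult_right_mono XD x) auto
        also have "\<dots> \<le> D * (t * X x powr p + t powr (1 - p) * norm (V k x - W x) powr p)"
          using powr_mult_le_weighted[OF p X(1)[OF x], of "norm (V k x - W x)" t] D t
          by (simp add: mult.assoc mult_left_mono)
        finally show "ennreal (norm (w x \<bullet> V k x - w x \<bullet> W x)) \<le> ennreal (D * t) * ennreal (X x powr p) + ennreal (D * t powr (1 - p)) * ennreal (norm (V k x - W x) powr p)"
          using D t by (simp add: algebra_simps flip: ennreal_mult ennreal_plus)
      qed
      also have "\<dots> = ennreal (D * t) * ennreal I + ennreal (D * t powr (1 - p)) * Lp_int M p (\<lambda>x. V k x - W x)"
        by (simp add: nn_integral_cmult nn_integral_add I)
      also have "\<dots> \<le> ennreal (D * t) * ennreal I + ennreal (D * t powr (1 - p)) * ennreal d"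
        using k by (intro add_left_mono mult_left_mono) auto
      also have "\<dots> = ennreal (D * t * I + D * t powr (1 - p) * d)"
        using D t I d by (simp flip: ennreal_mult ennreal_plus)
      also have "\<dots> \<le> ennreal e"
        using tI d by (intro ennreal_leI) auto
      finally show "(\<integral>\<^sup>+x. ennreal (norm (w x \<bullet> V k x - w x \<bullet> W x)) \<partial>M) \<le> ennreal e" .
    qed
  qed
  \<comment> \<open>The members of the sequence are known to be integrable only from the index
    \<open>N\<close> on.\<close>
  then have "(\<lambda>k. \<integral>\<^sup>+x. ennreal (norm (w x \<bullet> V (k + N) x - w x \<bullet> W x)) \<partial>M) \<longlonglongrightarrow> 0"
    by (rule LIMSEQ_ignore_initial_segment)
  then have "(\<lambda>k. \<integral>x. w x \<bullet> V (k + N) x \<partial>M) \<longlonglongrightarrow> (\<integral>x. w x \<bullet> W x \<partial>M)"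
    using iV iW by (intro tendsto_L1_int) auto
  then show ?thesis
    by (rule LIMSEQ_offset)
qed

section \<open>Smooth functions\<close>

lemma partial_eqI:
  assumes "(f has_derivative f') (at x)"
  shows "partial i f x = f' (axis i 1)"
  using frechet_derivative_at[OF assms] by (simp add: partial_def)

lemma grad_eqI:
  assumes "(f has_derivative (\<lambda>h. D \<bullet> h)) (at x)"
  shows "grad f x = D"
  by (simp add: grad_def vec_eq_iff partial_eqI[OF assms] inner_axis)

lemma has_derivative_grad:
  fixes f :: "real^'n::finite \<Rightarrow> real"
  assumes "f differentiable (at x)"
  shows "(f has_derivative (\<lambda>h. grad f x \<bullet> h)) (at x)"
proof -
  obtain f' where f': "(f has_derivative f') (at x)"
    using assms by (auto simp: differentiable_def)
  have "f' h = grad f x \<bullet> h" for h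
  proof -
    have "f' h = f' (\<Sum>i\<in>UNIV. h $ i *\<^sub>R axis i 1)"
      by (simp add: basis_expansion[of h] flip: scalar_mult_eq_scaleR)
    also have "\<dots> = (\<Sum>i\<in>UNIV. h $ i * f' (axis i 1))"
      using has_derivative_linear[OF f'] by (simp add: linear_sum linear_scale)
    finally show ?thesis
      by (simp add: inner_vec_def grad_def partial_eqI[OF f'] mult.commute)
  qed
  then have "f' = (\<lambda>h. grad f x \<bullet> h)" by (rule ext)
  with f' show ?thesis by simp
qed

text \<open>All iterated partial derivatives stay in \<open>S\<close>, so a class of differentiable
  functions that is closed under differentiation consists of smooth functions. The smoothness proofs
  below exhibit such a class.\<close>

lemma smooth_on_UNIV_coinduct:
  assumes "f \<in> S" "\<And>g x. g \<in> S \<Longrightarrow> g differentiable (at x)" "\<And>g i. g \<in> S \<Longrightarrow> partial i g \<in> S"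
  shows "smooth_on UNIV f"
proof -
  have "partials is f \<in> S" for "is"
    by (induction "is") (use assms in auto)
  then show ?thesis
    using assms(2) by (auto simp: smooth_on_def differentiable_on_def)
qed

lemma smooth_on_partial:
  assumes "smooth_on UNIV f"
  shows "smooth_on UNIV (partial i f)"
proof -
  have "partials is (partial i f) = partials (is @ [i]) f" for "is"
    by (induction "is") auto
  then show ?thesis
    using assms by (auto simp: smooth_on_def)
qed

lemma smooth_on_differentiable:
  assumes "smooth_on U f" "x \<in> U"
  shows "f differentiable (at x)"
proof -
  have "partials [] f differentiable_on U" "open U"
    using assms(1) unfolding smooth_on_def by blast+
  then show ?thesis
    using assms(2) by (simp add: differentiable_on_eq_differentiable_at)
qed

lemma smooth_has_derivative:
  "smooth_on U f \<Longrightarrow> x \<in> U \<Longrightarrow> (f has_derivative (\<lambda>h. grad f x \<bullet> h)) (at x)"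
  by (intro has_derivative_grad smooth_on_differentiable)

lemma smooth_continuous_on:
  "smooth_on U f \<Longrightarrow> continuous_on U f"
  by (meson continuous_at_imp_continuous_on differentiable_imp_continuous_within smooth_on_differentiable)

lemma smooth_continuous_grad:
  assumes "smooth_on UNIV f"
  shows "continuous_on UNIV (grad f)"
  unfolding grad_def
  by (intro continuous_on_vec_lambda smooth_continuous_on smooth_on_partial assms)

text \<open>The prefactor \<open>c\<close> absorbs the factor \<open>a\<close> that each
  differentiation produces, which closes the class.\<close>

lemma smooth_affine:
  fixes f :: "real^'n::finite \<Rightarrow> real"
  assumes "smooth_on UNIV f"
  shows "smooth_on UNIV (\<lambda>y. c * f (b + a *\<^sub>R y))"
proof (rule smooth_on_UNIV_coinduct[where S="{\<lambda>y. c * f (b + a *\<^sub>R y) | c f. smooth_on UNIV f}"])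
  have D: "((\<lambda>y. c * f (b + a *\<^sub>R y)) has_derivative (\<lambda>h. c * (grad f (b + a *\<^sub>R x) \<bullet> (a *\<^sub>R h)))) (at x)"
    if "smooth_on UNIV f" for c and f :: "real^'n \<Rightarrow> real" and x
    by (rule derivative_eq_intros smooth_has_derivative[OF that, THEN has_derivative_compose[rotated]] refl | simp)+
  show "g differentiable at x" if "g \<in> {\<lambda>y. c * f (b + a *\<^sub>R y) | c f. smooth_on UNIV f}" for g x
    using that D by (auto simp: differentiable_def)
  show "partial i g \<in> {\<lambda>y. c * f (b + a *\<^sub>R y) | c f. smooth_on UNIV f}"
    if "g \<in> {\<lambda>y. c * f (b + a *\<^sub>R y) | c f. smooth_on UNIV f}" for g i
  proof -
    obtain c f where g: "g = (\<lambda>y. c * f (b + a *\<^sub>R y))" and f: "smooth_on UNIV f"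
      using \<open>g \<in> _\<close> by auto
    have "partial i g = (\<lambda>y. (c * a) * partial i f (b + a *\<^sub>R y))"
      by (rule ext) (simp add: g partial_eqI[OF D[OF f]] grad_def inner_axis)
    with smooth_on_partial[OF f] show ?thesis by blast
  qed
qed (use assms in blast)

section \<open>A mollifier\<close>

text \<open>The polynomial factor and the power make the family closed under differentiation.\<close>

definition bump1 :: "real poly \<Rightarrow> nat \<Rightarrow> real \<Rightarrow> real" where
  "bump1 P m t = (if \<bar>t\<bar> < 1 then poly P t * inverse (1 - t\<^sup>2) ^ m * exp (- inverse (1 - t\<^sup>2)) else 0)"

lemma power_le_fact_exp:
  fixes v :: real
  assumes "0 \<le> v"
  shows "v ^ n \<le> fact n * exp v"
proof -
  have "(\<Sum>k\<in>{n}. v ^ k /\<^sub>R fact k) \<le> (\<Sum>k. v ^ k /\<^sub>R fact k)"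
    using assms by (intro sum_le_suminf sums_summable[OF exp_converges]) auto
  then have "v ^ n / fact n \<le> exp v"
    using exp_converges[of v] by (simp add: sums_iff divide_inverse mult.commute)
  then show ?thesis
    by (simp add: field_simps)
qed

text \<open>With \<open>v = 1 / (1 - t^2)\<close>, \<open>exp v\<close> dominates
  \<open>v ^ (m + 2)\<close>, two powers more than occur, and each spare power is a factor
  \<open>1 - t^2\<close>. The quadratic decay makes the derivative at both endpoints exist and
  vanish.\<close>

lemma bump1_bound: "\<exists>C. \<forall>t. \<bar>t\<bar> < 1 \<longrightarrow> \<bar>bump1 P m t\<bar> \<le> C * (1 - t\<^sup>2)\<^sup>2"
proof -
  have "compact (poly P ` {-1..1})"
    by (intro compact_continuous_image continuous_intros) auto
  then obtain B where B: "\<And>t. t \<in> {-1..1} \<Longrightarrow> \<bar>poly P t\<bar> \<le> B"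
    by (force dest: compact_imp_bounded simp: bounded_iff)
  have "\<bar>bump1 P m t\<bar> \<le> B * fact (m + 2) * (1 - t\<^sup>2)\<^sup>2" if t: "\<bar>t\<bar> < 1" for t
  proof -
    define v where "v = inverse (1 - t\<^sup>2)"
    have "t\<^sup>2 < 1" using t by (simp add: abs_square_less_1)
    then have v: "v > 0" "1 - t\<^sup>2 = inverse v" by (auto simp: v_def)
    have "v ^ (m + 2) * exp (- v) \<le> fact (m + 2) * exp v * exp (- v)"
      using v by (intro mult_right_mono power_le_fact_exp) auto
    then have "v ^ (m + 2) * exp (- v) \<le> fact (m + 2)"
      by (simp add: mult.assoc exp_minus)
    moreover have "v ^ m * exp (- v) = (v ^ (m + 2) * exp (- v)) * (inverse v)\<^sup>2"
      using v by (simp add: power_add field_simps power2_eq_square)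
    ultimately have "v ^ m * exp (- v) \<le> fact (m + 2) * (inverse v)\<^sup>2"
      by (metis mult_right_mono zero_le_power2)
    moreover have "\<bar>poly P t\<bar> \<le> B" using t by (intro B) auto
    ultimately have "\<bar>poly P t\<bar> * (v ^ m * exp (- v)) \<le> B * (fact (m + 2) * (inverse v)\<^sup>2)"
      using v by (intro mult_mono[of _ B "v ^ m * exp (- v)"]) (auto simp del: fact_Suc)
    then show ?thesis
      using t v by (simp add: bump1_def abs_mult mult.assoc flip: v_def)
  qed
  then show ?thesis by blast
qed

text \<open>For \<open>v = 1 / (1 - t^2)\<close> one has \<open>v' = 2 * t * v^2\<close>, so
  \<open>P * v^m * exp (- v)\<close> has the derivative \<open>(P' * v^m + 2 * m * t * P * v^(m+1) -
  2 * t * P * v^(m+2)) * exp (- v)\<close>. Taking out \<open>v^(m+2)\<close> leaves this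
  polynomial.\<close>

definition bump1_deriv :: "real poly \<Rightarrow> nat \<Rightarrow> real poly" where
  "bump1_deriv P m = pderiv P * [:1, 0, -1:]\<^sup>2 + smult (2 * real m) ([:0, 1:] * P * [:1, 0, -1:]) - smult 2 ([:0, 1:] * P)"

lemma bump1_has_derivative: "(bump1 P m has_real_derivative bump1 (bump1_deriv P m) (m + 2) t) (at t)"
proof -
  consider "\<bar>t\<bar> < 1" | "\<bar>t\<bar> > 1" | "\<bar>t\<bar> = 1" by linarith
  then show ?thesis
  proof cases
    case 1
    define v where "v = inverse (1 - t\<^sup>2)"
    have "t\<^sup>2 < 1" using 1 by (simp add: abs_square_less_1)
    then have v: "1 - t\<^sup>2 \<noteq> 0" "(1 - t\<^sup>2) * v = 1" by (auto simp: v_def)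
    have ev: "eventually (\<lambda>s. bump1 P m s = poly P s * inverse (1 - s\<^sup>2) ^ m * exp (- inverse (1 - s\<^sup>2))) (nhds t)"
      by (rule eventually_mono[OF eventually_nhds_in_open[of "{-1<..<1}" t]]) (use 1 in \<open>auto simp: bump1_def\<close>)
    have inv: "((\<lambda>s. inverse (1 - s\<^sup>2)) has_real_derivative 2 * t * v\<^sup>2) (at t)"
      by (rule derivative_eq_intros refl v | simp add: v_def power2_eq_square)+
    have "((\<lambda>s. poly P s * inverse (1 - s\<^sup>2) ^ m * exp (- inverse (1 - s\<^sup>2))) has_real_derivative
       (poly (pderiv P) t * v ^ m + poly P t * (real m * (v ^ (m - Suc 0) * (2 * t * v\<^sup>2)))) * exp (- v)
         + poly P t * v ^ m * (exp (- v) * - (2 * t * v\<^sup>2))) (at t)"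
      by (rule derivative_eq_intros poly_DERIV inv refl | simp add: v_def)+
    \<comment> \<open>For \<open>m = 0\<close> the truncated exponent is harmless, because the
      factor \<open>real m\<close> vanishes.\<close>
    moreover have "real m * (v ^ (m - Suc 0) * (2 * t * v\<^sup>2)) = real m * (2 * t * v ^ (m + 1))"
      by (cases m) (auto simp: power2_eq_square)
    moreover have "(poly (pderiv P) t * v ^ m + poly P t * (real m * (2 * t * v ^ (m + 1)))) * exp (- v)
         + poly P t * v ^ m * (exp (- v) * - (2 * t * v\<^sup>2)) = bump1 (bump1_deriv P m) (m + 2) t"
    proof -
      have a: "v ^ m = (1 - t\<^sup>2)\<^sup>2 * v ^ (m + 2)" "v ^ (m + 1) = (1 - t\<^sup>2) * v ^ (m + 2)"
        using v(2) by (simp_all add: power_add power2_eq_square) algebra+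
      have "bump1 (bump1_deriv P m) (m + 2) t =
        (poly (pderiv P) t * ((1 - t\<^sup>2)\<^sup>2 * v ^ (m + 2)) + poly P t * (real m * (2 * t * ((1 - t\<^sup>2) * v ^ (m + 2))))
           - poly P t * (2 * t * v ^ (m + 2))) * exp (- v)"
        using 1 by (simp add: bump1_def bump1_deriv_def v_def[symmetric]) (simp add: algebra_simps power2_eq_square)
      then show ?thesis
        unfolding a[symmetric] by (simp add: algebra_simps power_add power2_eq_square)
    qed
    ultimately have "((\<lambda>s. poly P s * inverse (1 - s\<^sup>2) ^ m * exp (- inverse (1 - s\<^sup>2))) has_real_derivative
       bump1 (bump1_deriv P m) (m + 2) t) (at t)"
      by simp
    then show ?thesis
      using DERIV_cong_ev[OF refl ev refl] by blast
  next
    case 2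
    have "open {s::real. 1 < \<bar>s\<bar>}"
      by (intro open_Collect_less continuous_intros)
    then have "eventually (\<lambda>s. bump1 P m s = 0) (nhds t)"
      using eventually_nhds_in_open[of "{s. 1 < \<bar>s\<bar>}" t] 2 by (auto elim!: eventually_mono simp: bump1_def)
    then have "(bump1 P m has_real_derivative 0) (at t)"
      using DERIV_cong_ev[OF refl _ refl, of "bump1 P m" "\<lambda>_. 0" t 0] by simp
    then show ?thesis
      using 2 by (simp add: bump1_def)
  next
    case 3
    \<comment> \<open>Since \<bar>t\<bar> = 1, \<open>1 - s^2 = (t - s) * (t + s)\<close>; the bound
      becomes quadratic in \<open>s - t\<close>, and the difference quotient tends to 0.\<close>
    obtain C where C: "\<And>s. \<bar>s\<bar> < 1 \<Longrightarrow> \<bar>bump1 P m s\<bar> \<le> C * (1 - s\<^sup>2)\<^sup>2"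
      using bump1_bound by blast
    have C0: "0 \<le> C" using C[of 0] by simp
    have bd: "\<bar>bump1 P m s\<bar> \<le> 4 * C * (s - t)\<^sup>2" for s
    proof (cases "\<bar>s\<bar> < 1")
      case True
      have "1 - s\<^sup>2 = (t - s) * (t + s)" using 3 by (metis abs_power2 power2_abs one_power2 power2_eq_square square_diff_square_factored mult.commute)
      then have "(1 - s\<^sup>2)\<^sup>2 = (s - t)\<^sup>2 * (t + s)\<^sup>2" by algebra
      also have "\<dots> \<le> (s - t)\<^sup>2 * 4"
        using True 3 abs_le_square_iff[of "t + s" 2] by (intro mult_left_mono) auto
      finally have "C * (1 - s\<^sup>2)\<^sup>2 \<le> C * ((s - t)\<^sup>2 * 4)"
        using C0 by (intro mult_left_mono)
      with C[OF True] show ?thesis by (simp add: mult_ac)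
    qed (use C0 in \<open>auto simp: bump1_def\<close>)
    have z: "bump1 P m t = 0" "bump1 (bump1_deriv P m) (m + 2) t = 0" using 3 by (auto simp: bump1_def)
    have "((\<lambda>s. (bump1 P m s - bump1 P m t) / (s - t)) \<longlongrightarrow> 0) (at t)"
    proof (rule Lim_null_comparison)
      show "\<forall>\<^sub>F s in at t. norm ((bump1 P m s - bump1 P m t) / (s - t)) \<le> 4 * C * \<bar>s - t\<bar>"
      proof (rule always_eventually, rule allI)
        fix s
        show "norm ((bump1 P m s - bump1 P m t) / (s - t)) \<le> 4 * C * \<bar>s - t\<bar>"
        proof (cases "s = t")
          case False
          then have "\<bar>bump1 P m s\<bar> / \<bar>s - t\<bar> \<le> 4 * C * \<bar>s - t\<bar>"
            using bd[of s] power2_abs[of "s - t"] by (simp add: pos_divide_le_eq mult.assoc power2_eq_square del: abs_mult_self_eq)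
          then show ?thesis by (simp add: z)
        qed simp
      qed
      show "((\<lambda>s. 4 * C * \<bar>s - t\<bar>) \<longlongrightarrow> 0) (at t)"
        by (rule tendsto_eq_intros refl | simp)+
    qed
    then show ?thesis unfolding has_field_derivative_iff z(2) .
  qed
qed

text \<open>Differentiation in direction \<open>j\<close> changes only the \<open>j\<close>-th
  polynomial and exponent, so the family is closed. A product over the coordinates, unlike a radial
  bump, stays within one-variable calculus.\<close>

lemma smooth_prod_bump1:
  "smooth_on UNIV (\<lambda>x::real^'n::finite. \<Prod>i\<in>UNIV. bump1 (P i) (m i) (x $ i))"
proof (rule smooth_on_UNIV_coinduct[where S="{\<lambda>x. \<Prod>i\<in>UNIV. bump1 (P i) (m i) (x $ i) | P m. True}"])
  have D: "((\<lambda>x. \<Prod>i\<in>UNIV. bump1 (P i) (m i) (x $ i)) has_derivative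
     (\<lambda>y. \<Sum>i\<in>UNIV. (bump1 (bump1_deriv (P i) (m i)) (m i + 2) (x $ i) * y $ i) * (\<Prod>j\<in>UNIV - {i}. bump1 (P j) (m j) (x $ j)))) (at x)"
    for P m and x :: "real^'n"
  proof (rule has_derivative_prod)
    fix i
    have "((\<lambda>x. x $ i) has_derivative (\<lambda>y. y $ i)) (at x)"
      by (intro bounded_linear_imp_has_derivative bounded_linear_vec_nth)
    then show "((\<lambda>x. bump1 (P i) (m i) (x $ i)) has_derivative
      (\<lambda>y. bump1 (bump1_deriv (P i) (m i)) (m i + 2) (x $ i) * y $ i)) (at x)"
      using has_derivative_compose[OF _ bump1_has_derivative[unfolded has_field_derivative_def]] by blast
  qed
  show "g differentiable at x" if "g \<in> {\<lambda>x. \<Prod>i\<in>UNIV. bump1 (P i) (m i) (x $ i) | P m. True}" for g and x :: "real^'n"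
    using that D by (auto simp: differentiable_def)
  show "partial j g \<in> {\<lambda>x. \<Prod>i\<in>UNIV. bump1 (P i) (m i) (x $ i) | P m. True}"
    if g: "g \<in> {\<lambda>x. \<Prod>i\<in>UNIV. bump1 (P i) (m i) (x $ i) | P m. True}" for g and j :: 'n
  proof -
    obtain P m where g: "g = (\<lambda>x. \<Prod>i\<in>UNIV. bump1 (P i) (m i) (x $ i))" using g by auto
    define P' where "P' = P(j := bump1_deriv (P j) (m j))"
    define m' where "m' = m(j := m j + 2)"
    have "partial j g x = (\<Prod>i\<in>UNIV. bump1 (P' i) (m' i) (x $ i))" for x
    proof -
      have "partial j g x = (\<Sum>i\<in>UNIV. (bump1 (bump1_deriv (P i) (m i)) (m i + 2) (x $ i) * axis j 1 $ i) * (\<Prod>k\<in>UNIV - {i}. bump1 (P k) (m k) (x $ k)))"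
        unfolding g by (rule partial_eqI[OF D])
      also have "\<dots> = (\<Sum>i\<in>UNIV. if i = j then bump1 (bump1_deriv (P i) (m i)) (m i + 2) (x $ i) * (\<Prod>k\<in>UNIV - {i}. bump1 (P k) (m k) (x $ k)) else 0)"
        by (intro sum.cong) (auto simp: axis_def)
      also have "\<dots> = bump1 (P' j) (m' j) (x $ j) * (\<Prod>k\<in>UNIV - {j}. bump1 (P' k) (m' k) (x $ k))"
        by (simp add: P'_def m'_def)
      also have "\<dots> = (\<Prod>i\<in>UNIV. bump1 (P' i) (m' i) (x $ i))"
        by (rule prod.remove[symmetric]) auto
      finally show ?thesis .
    qed
    then show ?thesis by blast
  qed
qed blast

section \<open>Mollification\<close>

text \<open>Two points at distance below 1 lie either both in the ball of radius
  \<open>R + 1\<close>, where compactness applies, or both outside the support.\<close>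

lemma compact_support_uniformly_continuous:
  fixes f :: "'a::euclidean_space \<Rightarrow> 'b::real_normed_vector"
  assumes "continuous_on UNIV f" "compact C" "\<And>x. x \<notin> C \<Longrightarrow> f x = 0"
  shows "uniformly_continuous_on UNIV f"
proof -
  obtain R where "C \<subseteq> ball 0 R"
    using bounded_subset_ballD[OF compact_imp_bounded[OF assms(2)]] by blast
  then have R: "C \<subseteq> cball 0 R"
    using ball_subset_cball by blast
  have uc: "uniformly_continuous_on (cball 0 (R + 1)) f"
    by (intro compact_uniformly_continuous) (use assms(1) continuous_on_subset in auto)
  show ?thesis
    unfolding uniformly_continuous_on_def
  proof (intro allI impI)
    fix e :: real assume e: "0 < e"
    obtain d where d: "0 < d" "\<And>x y. x \<in> cball 0 (R + 1) \<Longrightarrow> y \<in> cball 0 (R + 1) \<Longrightarrow> dist y x < d \<Longrightarrow> dist (f y) (f x) < e"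
      using uc e unfolding uniformly_continuous_on_def by metis
    have "dist (f y) (f x) < e" if "dist y x < min d 1" for x y
    proof (cases "x \<in> cball 0 (R + 1) \<and> y \<in> cball 0 (R + 1)")
      case False
      then have "x \<notin> cball 0 R" "y \<notin> cball 0 R"
        using that norm_triangle_ineq2[of x y] norm_triangle_ineq2[of y x] by (auto simp: dist_norm norm_minus_commute)
      then have "f x = 0" "f y = 0" using R assms(3) by blast+
      then show ?thesis using e by simp
    qed (use that d in auto)
    then show "\<exists>d>0. \<forall>x\<in>UNIV. \<forall>x'\<in>UNIV. dist x' x < d \<longrightarrow> dist (f x') (f x) < e"
      using d(1) by (intro exI[of _ "min d 1"]) auto
  qed
qed

lemma compact_support_bounded:
  fixes f :: "'a::euclidean_space \<Rightarrow> 'b::real_normed_vector"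
  assumes "continuous_on UNIV f" "compact C" "\<And>x. x \<notin> C \<Longrightarrow> f x = 0"
  shows "\<exists>B>0. \<forall>x. norm (f x) \<le> B"
proof -
  have "compact (f ` C)"
    by (intro compact_continuous_image continuous_on_subset[OF assms(1)] assms(2)) auto
  then obtain B where B: "0 < B" "\<And>x. x \<in> C \<Longrightarrow> norm (f x) \<le> B"
    by (force dest: compact_imp_bounded simp: bounded_pos)
  then have "norm (f x) \<le> B" for x
    by (cases "x \<in> C") (use assms(3) in auto)
  with B(1) show ?thesis by blast
qed

section \<open>Integrals of continuous functions under reflection and dilation\<close>

lemma lebesgue_measurable_continuous:
  fixes f :: "'a::euclidean_space \<Rightarrow> 'b::euclidean_space"
  shows "continuous_on UNIV f \<Longrightarrow> f \<in> borel_measurable lebesgue"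
  by (intro measurable_completion) (simp add: borel_measurable_continuous_onI)

lemma compact_support_integrable:
  fixes f :: "'a::euclidean_space \<Rightarrow> 'b::euclidean_space"
  assumes "continuous_on UNIV f" "compact C" "\<And>x. x \<notin> C \<Longrightarrow> f x = 0"
  shows "integrable lebesgue f"
proof -
  have "integrable lborel (\<lambda>x. indicator C x *\<^sub>R f x)"
    by (intro borel_integrable_compact assms) (use continuous_on_subset[OF assms(1)] in auto)
  also have "(\<lambda>x. indicator C x *\<^sub>R f x) = f"
    using assms(3) by (auto simp: indicator_def)
  finally show ?thesis
    using assms(1) by (subst integrable_completion) (auto intro: borel_measurable_continuous_onI)
qed

lemma distr_lebesgue_reflect:
  fixes x :: "'a::euclidean_space"
  shows "distr lebesgue lebesgue (\<lambda>y. x - y) = lebesgue" and "(\<lambda>y. x - y) \<in> lebesgue \<rightarrow>\<^sub>M lebesgue"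
proof -
  have "(\<lambda>y. x + (\<Sum>j\<in>Basis. (- 1 * (y \<bullet> j)) *\<^sub>R j)) = (\<lambda>y. x - y)"
    by (simp add: sum_negf euclidean_representation)
  then show "distr lebesgue lebesgue (\<lambda>y. x - y) = lebesgue" and "(\<lambda>y. x - y) \<in> lebesgue \<rightarrow>\<^sub>M lebesgue"
    using lebesgue_affine_euclidean[of "\<lambda>_. - 1" x] lebesgue_affine_measurable[of "\<lambda>_. - 1" x]
    by (simp_all add: density_1)
qed

lemma lebesgue_integral_reflect:
  fixes f :: "'a::euclidean_space \<Rightarrow> 'b::euclidean_space"
  assumes "f \<in> borel_measurable lebesgue"
  shows "(\<integral>y. f (x - y) \<partial>lebesgue) = (\<integral>y. f y \<partial>lebesgue)"
  using integral_distr[OF distr_lebesgue_reflect(2) assms, of x] by (simp add: distr_lebesgue_reflect)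

lemma lebesgue_integral_scale:
  fixes f :: "'a::euclidean_space \<Rightarrow> 'b::euclidean_space"
  assumes f: "continuous_on UNIV f" and a: "0 < a"
  shows "(\<integral>x. f (a *\<^sub>R x) \<partial>lebesgue) = (\<integral>x. f x \<partial>lebesgue) /\<^sub>R a ^ DIM('a)"
proof -
  have [measurable]: "f \<in> borel_measurable borel"
    using f by (simp add: borel_measurable_continuous_onI)
  have "(\<integral>x. f x \<partial>lborel) = (\<integral>x. f x \<partial>density (distr lborel borel (\<lambda>x. 0 + a *\<^sub>R x)) (\<lambda>_. ennreal (\<bar>a\<bar> ^ DIM('a))))"
    using lborel_affine[of a "0::'a"] a by simp
  also have "\<dots> = a ^ DIM('a) *\<^sub>R (\<integral>x. f (a *\<^sub>R x) \<partial>lborel)"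
    using a by (simp add: integral_density integral_distr)
  finally show ?thesis
    using a by (simp add: integral_completion)
qed

text \<open>The test functions built from mollifications of \<open>E\<close> are only C1, because
  \<open>\<bar>s\<bar> powr p\<close> and the level profiles are no smoother. This class contains
  them together with the smooth test functions and carries the gradient \<open>D\<close> as an
  explicit argument.\<close>

definition C1c :: "(real^'n::finite) set \<Rightarrow> (real^'n \<Rightarrow> real) \<Rightarrow> (real^'n \<Rightarrow> real^'n) \<Rightarrow> bool" where
  "C1c U \<psi> D \<longleftrightarrow> (\<forall>x. (\<psi> has_derivative (\<lambda>h. D x \<bullet> h)) (at x)) \<and> continuous_on UNIV D \<and>
     (\<exists>C. compact C \<and> C \<subseteq> U \<and> (\<forall>x. x \<notin> C \<longrightarrow> \<psi> x = 0 \<and> D x = 0))"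

lemma inner_eq_zeroI:
  assumes "(\<lambda>h. a \<bullet> h) = (\<lambda>h. 0)"
  shows "a = 0"
  using fun_cong[OF assms, of a] by simp

text \<open>Off \<open>C\<close> the function vanishes on an open set, so the condition on the
  gradient follows from the one on the values.\<close>

lemma C1cI:
  assumes "\<And>x. (\<psi> has_derivative (\<lambda>h. D x \<bullet> h)) (at x)" "continuous_on UNIV D"
    "compact C" "C \<subseteq> U" "\<And>x. x \<notin> C \<Longrightarrow> \<psi> x = 0"
  shows "C1c U \<psi> D"
proof -
  have "D x = 0" if "x \<notin> C" for x
  proof -
    have "(\<psi> has_derivative (\<lambda>h. 0)) (at x)"
      by (rule has_derivative_transform_within_open[where s="- C" and f="\<lambda>_. 0"])
        (use assms that in \<open>auto simp: compact_imp_closed\<close>)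
    then have "(\<lambda>h. D x \<bullet> h) = (\<lambda>h. 0)"
      using assms(1) has_derivative_unique by blast
    then show ?thesis by (rule inner_eq_zeroI)
  qed
  with assms show ?thesis unfolding C1c_def by blast
qed

lemma C1cD:
  assumes "C1c U \<psi> D"
  shows "(\<psi> has_derivative (\<lambda>h. D x \<bullet> h)) (at x)" "continuous_on UNIV D" "continuous_on UNIV \<psi>"
  using assms unfolding C1c_def
  by (auto intro!: continuous_at_imp_continuous_on has_derivative_continuous)

lemma C1c_support:
  assumes "C1c U \<psi> D"
  obtains C where "compact C" "C \<subseteq> U" "\<And>x. x \<notin> C \<Longrightarrow> \<psi> x = 0" "\<And>x. x \<notin> C \<Longrightarrow> D x = 0"
  using assms unfolding C1c_def by blast

lemma C1c_mono: "C1c U \<psi> D \<Longrightarrow> U \<subseteq> V \<Longrightarrow> C1c V \<psi> D"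
  unfolding C1c_def by blast

lemma test_function_C1c:
  assumes "test_function U \<phi>"
  shows "C1c U \<phi> (grad \<phi>)"
proof (rule C1cI[where C="closure {x. \<phi> x \<noteq> 0}"])
  show "\<phi> x = 0" if "x \<notin> closure {x. \<phi> x \<noteq> 0}" for x
    using that closure_subset[of "{x. \<phi> x \<noteq> 0}"] by auto
qed (use assms in \<open>auto simp: test_function_def smooth_continuous_grad intro: smooth_has_derivative\<close>)

lemma test_functionI:
  assumes "smooth_on UNIV \<phi>" "compact C" "C \<subseteq> U" "\<And>x. x \<notin> C \<Longrightarrow> \<phi> x = 0"
  shows "test_function U \<phi>"
proof -
  have "closure {x. \<phi> x \<noteq> 0} \<subseteq> C"
    using assms by (intro closure_minimal) (auto simp: compact_imp_closed)
  moreover have "bounded {x. \<phi> x \<noteq> 0}"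
    by (rule bounded_subset[OF compact_imp_bounded[OF assms(2)]]) (use assms(4) in blast)
  ultimately show ?thesis
    using assms by (auto simp: test_function_def)
qed

lemma test_function_partial:
  assumes "test_function U \<phi>"
  shows "test_function U (partial i \<phi>)"
proof -
  obtain C where C: "compact C" "C \<subseteq> U" "\<And>x. x \<notin> C \<Longrightarrow> grad \<phi> x = 0"
    using test_function_C1c[OF assms] by (rule C1c_support) blast
  have "partial i \<phi> x = grad \<phi> x $ i" for x by (simp add: grad_def)
  then show ?thesis
    using assms C by (intro test_functionI[of _ C]) (auto simp: test_function_def intro: smooth_on_partial)
qed

definition mollify :: "('a::euclidean_space \<Rightarrow> real) \<Rightarrow> ('a \<Rightarrow> 'b::euclidean_space) \<Rightarrow> 'a \<Rightarrow> 'b" where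
  "mollify \<phi> f x = (\<integral>y. \<phi> (x - y) *\<^sub>R f y \<partial>lebesgue)"

lemma integrable_bounded_scaleR:
  fixes f :: "'a::euclidean_space \<Rightarrow> 'b::euclidean_space"
  assumes "integrable lebesgue f" "continuous_on UNIV g" "\<And>x. \<bar>g x\<bar> \<le> B"
  shows "integrable lebesgue (\<lambda>y. g (x - y) *\<^sub>R f y)"
proof (rule Bochner_Integration.integrable_bound)
  show "integrable lebesgue (\<lambda>y. B * norm (f y))"
    using assms(1) by auto
  have "continuous_on UNIV (\<lambda>y. g (x - y))"
    by (intro continuous_on_compose2[OF assms(2)] continuous_intros) auto
  then have [measurable]: "(\<lambda>y. g (x - y)) \<in> borel_measurable lebesgue"
    by (rule lebesgue_measurable_continuous)
  have [measurable]: "f \<in> borel_measurable lebesgue" using assms(1) by auto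
  show "(\<lambda>y. g (x - y) *\<^sub>R f y) \<in> borel_measurable lebesgue" by measurable
  have "\<bar>g x\<bar> \<le> \<bar>B\<bar>" for x
    using assms(3)[of x] by linarith
  then show "AE y in lebesgue. norm (g (x - y) *\<^sub>R f y) \<le> norm (B * norm (f y))"
    by (intro AE_I2) (simp add: abs_mult mult_right_mono)
qed

lemma integrable_scaleR_bounded:
  fixes f :: "'a::euclidean_space \<Rightarrow> real" and g :: "'a \<Rightarrow> 'b::euclidean_space"
  assumes "integrable lebesgue f" "continuous_on UNIV g" "\<And>x. norm (g x) \<le> B"
  shows "integrable lebesgue (\<lambda>y. f y *\<^sub>R g (x - y))"
proof (rule Bochner_Integration.integrable_bound)
  show "integrable lebesgue (\<lambda>y. B * norm (f y))"
    using assms(1) by auto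
  have "continuous_on UNIV (\<lambda>y. g (x - y))"
    by (intro continuous_on_compose2[OF assms(2)] continuous_intros) auto
  then have [measurable]: "(\<lambda>y. g (x - y)) \<in> borel_measurable lebesgue"
    by (rule lebesgue_measurable_continuous)
  have [measurable]: "f \<in> borel_measurable lebesgue" using assms(1) by auto
  show "(\<lambda>y. f y *\<^sub>R g (x - y)) \<in> borel_measurable lebesgue" by measurable
  have "norm (g x) \<le> \<bar>B\<bar>" for x
    using assms(3)[of x] by linarith
  then show "AE y in lebesgue. norm (f y *\<^sub>R g (x - y)) \<le> norm (B * norm (f y))"
    by (intro AE_I2) (simp add: abs_mult mult.commute[of "\<bar>B\<bar>"] mult_left_mono)
qed

lemma C1c_mollify_integrable:
  fixes f :: "real^'n::finite \<Rightarrow> 'b::euclidean_space"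
  assumes "C1c U \<phi> D" "integrable lebesgue f"
  shows "integrable lebesgue (\<lambda>y. \<phi> (x - y) *\<^sub>R f y)"
proof -
  obtain C where C: "compact C" "\<And>x. x \<notin> C \<Longrightarrow> \<phi> x = 0"
    using assms(1) by (rule C1c_support) blast
  obtain B where "\<And>x. norm (\<phi> x) \<le> B"
    using compact_support_bounded[OF C1cD(3)[OF assms(1)] C] by blast
  then show ?thesis
    using assms(2) C1cD(3)[OF assms(1)] by (intro integrable_bounded_scaleR[where B=B]) auto
qed

lemma C1c_grad_integrable:
  fixes f :: "real^'n::finite \<Rightarrow> real"
  assumes "C1c U \<phi> D" "integrable lebesgue f"
  shows "integrable lebesgue (\<lambda>y. f y *\<^sub>R D (x - y))"
proof -
  obtain C where C: "compact C" "\<And>x. x \<notin> C \<Longrightarrow> D x = 0"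
    using assms(1) by (rule C1c_support) blast
  obtain B where "\<And>x. norm (D x) \<le> B"
    using compact_support_bounded[OF C1cD(2)[OF assms(1)] C] by blast
  then show ?thesis
    using assms(2) C1cD(2)[OF assms(1)] by (intro integrable_scaleR_bounded[where B=B]) auto
qed

text \<open>The derivative falls on the kernel. Uniform continuity of \<open>D\<close> bounds the
  linearization error of \<phi> by \<open>norm h * (e / I)\<close> uniformly in the base point, and
  integrating against \<open>f\<close> keeps it below \<open>e * norm h\<close>.\<close>

lemma mollify_has_derivative:
  fixes f :: "real^'n::finite \<Rightarrow> real"
  assumes \<phi>: "C1c U \<phi> D" and f: "integrable lebesgue f"
  shows "(mollify \<phi> f has_derivative (\<lambda>h. (\<integral>y. f y *\<^sub>R D (x - y) \<partial>lebesgue) \<bullet> h)) (at x)"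
  unfolding has_derivative_at_alt
proof (intro conjI allI impI)
  show "bounded_linear ((\<bullet>) (LINT y|lebesgue. f y *\<^sub>R D (x - y)))"
    by (rule bounded_linear_inner_right)
  fix e :: real assume e: "0 < e"
  \<comment> \<open>The added 1 keeps \<open>I\<close> positive even if \<open>f\<close> vanishes
    almost everywhere.\<close>
  define I where "I = (\<integral>y. \<bar>f y\<bar> \<partial>lebesgue) + 1"
  have I: "0 < I" unfolding I_def by (smt (verit) Bochner_Integration.integral_nonneg abs_ge_zero)
  obtain C where C: "compact C" "\<And>x. x \<notin> C \<Longrightarrow> D x = 0"
    using \<phi> by (rule C1c_support) blast
  have "uniformly_continuous_on UNIV D"
    by (rule compact_support_uniformly_continuous[OF C1cD(2)[OF \<phi>] C])
  then obtain d where d: "0 < d" "\<And>z z'. dist z' z < d \<Longrightarrow> dist (D z') (D z) < e / I"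
    using e I unfolding uniformly_continuous_on_def by (metis UNIV_I divide_pos_pos)
  have lin: "\<bar>\<phi> (z + h) - \<phi> z - D z \<bullet> h\<bar> \<le> norm h * (e / I)" if "norm h < d" for z h
  proof -
    have "norm (\<phi> (z + h) - \<phi> z - D z \<bullet> ((z + h) - z)) \<le> norm ((z + h) - z) * (e / I)"
    proof (rule differentiable_bound_linearization[where S="ball z d" and f'="\<lambda>x h. D x \<bullet> h" and ?x0.0=z])
      show "z + t *\<^sub>R (z + h - z) \<in> ball z d" if "t \<in> {0..1}" for t
        using that \<open>norm h < d\<close> by (auto simp: dist_norm intro: le_less_trans[OF mult_left_le_one_le])
      show "(\<phi> has_derivative (\<bullet>) (D x)) (at x within ball z d)" for x
        by (rule has_derivative_at_withinI[OF C1cD(1)[OF \<phi>]])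
      show "onorm ((\<bullet>) (D x) - (\<bullet>) (D z)) \<le> e / I" if "x \<in> ball z d" for x
      proof (rule onorm_le)
        fix h
        have "norm (((\<bullet>) (D x) - (\<bullet>) (D z)) h) = \<bar>(D x - D z) \<bullet> h\<bar>"
          by (simp add: inner_diff_left)
        also have "\<dots> \<le> norm (D x - D z) * norm h"
          by (rule Cauchy_Schwarz_ineq2)
        also have "\<dots> \<le> e / I * norm h"
          using d(2)[of x z] that by (intro mult_right_mono) (auto simp: dist_norm norm_minus_commute)
        finally show "norm (((\<bullet>) (D x) - (\<bullet>) (D z)) h) \<le> e / I * norm h" .
      qed
      show "z \<in> ball z d" using d by simp
    qed
    then show ?thesis by simp
  qed
  show "\<exists>d>0. \<forall>y. norm (y - x) < d \<longrightarrow>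
       norm (mollify \<phi> f y - mollify \<phi> f x - (LINT y|lebesgue. f y *\<^sub>R D (x - y)) \<bullet> (y - x)) \<le> e * norm (y - x)"
  proof (intro exI conjI allI impI)
    show "0 < d" by fact
    fix y assume y: "norm (y - x) < d"
    define h where "h = y - x"
    note int = C1c_mollify_integrable[OF \<phi> f] C1c_grad_integrable[OF \<phi> f, THEN integrable_inner_left]
    have "mollify \<phi> f y - mollify \<phi> f x - (LINT y|lebesgue. f y *\<^sub>R D (x - y)) \<bullet> h =
       (\<integral>z. \<phi> (y - z) *\<^sub>R f z - \<phi> (x - z) *\<^sub>R f z - (f z *\<^sub>R D (x - z)) \<bullet> h \<partial>lebesgue)"
      unfolding mollify_def integral_inner_left[OF C1c_grad_integrable[OF \<phi> f, of x], symmetric]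
      by (simp only: int Bochner_Integration.integral_diff Bochner_Integration.integrable_diff)
    also have "\<bar>\<dots>\<bar> \<le> (\<integral>z. (norm h * (e / I)) * \<bar>f z\<bar> \<partial>lebesgue)"
    proof (rule integral_abs_bound_integral)
      fix z
      have "\<phi> (y - z) *\<^sub>R f z - \<phi> (x - z) *\<^sub>R f z - (f z *\<^sub>R D (x - z)) \<bullet> h =
         (\<phi> ((x - z) + h) - \<phi> (x - z) - D (x - z) \<bullet> h) * f z"
        by (simp add: h_def algebra_simps)
      also have "\<bar>\<dots>\<bar> \<le> (norm h * (e / I)) * \<bar>f z\<bar>"
        unfolding abs_mult using y by (intro mult_right_mono lin) (auto simp: h_def)
      finally show "\<bar>\<phi> (y - z) *\<^sub>R f z - \<phi> (x - z) *\<^sub>R f z - (f z *\<^sub>R D (x - z)) \<bullet> h\<bar> \<le> (norm h * (e / I)) * \<bar>f z\<bar>" .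
    qed (use f int in auto)
    also have "\<dots> = (norm h * e) * ((\<integral>z. \<bar>f z\<bar> \<partial>lebesgue) / I)"
      by simp
    also have "\<dots> \<le> (norm h * e) * 1"
      using e I by (intro mult_left_mono) (auto simp: I_def)
    finally show "norm (mollify \<phi> f y - mollify \<phi> f x - (LINT y|lebesgue. f y *\<^sub>R D (x - y)) \<bullet> (y - x)) \<le> e * norm (y - x)"
      by (simp add: h_def mult.commute)
  qed
qed

text \<open>The mollifications of one fixed \<open>f\<close> by arbitrary test functions form a
  class closed under differentiation, since partial derivatives pass to the kernel.\<close>

lemma smooth_mollify:
  fixes f :: "real^'n::finite \<Rightarrow> real"
  assumes \<phi>: "test_function U \<phi>" and f: "integrable lebesgue f"
  shows "smooth_on UNIV (mollify \<phi> f)"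
proof (rule smooth_on_UNIV_coinduct[where S="{mollify \<phi> f | \<phi>. test_function U \<phi>}"])
  show "g differentiable at x" if "g \<in> {mollify \<phi> f | \<phi>. test_function U \<phi>}" for g x
    using that mollify_has_derivative[OF test_function_C1c f] by (auto simp: differentiable_def)
  show "partial i g \<in> {mollify \<phi> f | \<phi>. test_function U \<phi>}"
    if g: "g \<in> {mollify \<phi> f | \<phi>. test_function U \<phi>}" for g i
  proof -
    obtain \<phi> where g: "g = mollify \<phi> f" and \<phi>: "test_function U \<phi>" using g by auto
    have "partial i g = mollify (partial i \<phi>) f"
    proof
      fix x
      have "partial i g x = (\<integral>y. f y *\<^sub>R grad \<phi> (x - y) \<partial>lebesgue) \<bullet> axis i 1"
        unfolding g by (rule partial_eqI[OF mollify_has_derivative[OF test_function_C1c[OF \<phi>] f]])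
      also have "\<dots> = (\<integral>y. (f y *\<^sub>R grad \<phi> (x - y)) \<bullet> axis i 1 \<partial>lebesgue)"
        by (intro integral_inner_left[symmetric] C1c_grad_integrable[OF test_function_C1c[OF \<phi>] f])
      also have "\<dots> = mollify (partial i \<phi>) f x"
        by (simp add: mollify_def inner_axis grad_def mult.commute)
      finally show "partial i g x = mollify (partial i \<phi>) f x" .
    qed
    with test_function_partial[OF \<phi>] show ?thesis by blast
  qed
qed (use \<phi> in blast)

text \<open>Convolution with the indicator of a large ball gives a function that is constant near 0,
  so its derivative at 0 vanishes; by \<open>mollify_has_derivative\<close> that derivative is the
  integral of \<open>D\<close>, up to a reflection. This replaces integration by parts through
  iterated integrals.\<close>

lemma C1c_integral_grad_eq_0:
  assumes \<Psi>: "C1c U \<Psi> D"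
  shows "(\<integral>x. D x \<partial>lebesgue) = 0"
proof -
  obtain C where C: "compact C" "\<And>x. x \<notin> C \<Longrightarrow> \<Psi> x = 0" "\<And>x. x \<notin> C \<Longrightarrow> D x = 0"
    using \<Psi> by (rule C1c_support) blast
  obtain R where R: "0 < R" "C \<subseteq> ball 0 R"
    using C(1) compact_imp_bounded bounded_subset_ballD by blast
  define f :: "real^'a \<Rightarrow> real" where "f = indicator (cball 0 (R + 1))"
  have f: "integrable lebesgue f"
    unfolding f_def by (simp add: integrable_indicator_iff emeasure_bounded_finite[unfolded infinity_ennreal_def])
  have const: "mollify \<Psi> f x = (\<integral>y. \<Psi> y \<partial>lebesgue)" if "x \<in> ball 0 1" for x
  proof -
    have "\<Psi> (x - y) *\<^sub>R f y = \<Psi> (x - y)" for y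
    proof (cases "y \<in> cball 0 (R + 1)")
      case False
      then have "x - y \<notin> ball 0 R"
        using that norm_triangle_ineq2[of y x] by (auto simp: norm_minus_commute)
      then have "\<Psi> (x - y) = 0" using R C(2) by blast
      then show ?thesis by simp
    qed (auto simp: f_def)
    then have "mollify \<Psi> f x = (\<integral>y. \<Psi> (x - y) \<partial>lebesgue)"
      unfolding mollify_def by (simp only:)
    then show ?thesis
      by (simp add: lebesgue_integral_reflect lebesgue_measurable_continuous C1cD(3)[OF \<Psi>])
  qed
  have "(mollify \<Psi> f has_derivative (\<lambda>h. 0)) (at 0)"
    by (rule has_derivative_transform_within_open[where s="ball 0 1" and f="\<lambda>_. (\<integral>y. \<Psi> y \<partial>lebesgue)"])
      (use const in auto)
  then have "(\<lambda>h. (\<integral>y. f y *\<^sub>R D (0 - y) \<partial>lebesgue) \<bullet> h) = (\<lambda>h. 0)"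
    by (rule has_derivative_unique[OF mollify_has_derivative[OF \<Psi> f]])
  then have "(\<integral>y. f y *\<^sub>R D (0 - y) \<partial>lebesgue) = 0"
    by (rule inner_eq_zeroI)
  moreover have "f y *\<^sub>R D (0 - y) = D (0 - y)" for y
  proof (cases "y \<in> cball 0 (R + 1)")
    case False
    then have "0 - y \<notin> ball 0 R" by auto
    then have "D (0 - y) = 0" using R C(3) by blast
    then show ?thesis by simp
  qed (auto simp: f_def)
  ultimately show ?thesis
    using lebesgue_integral_reflect[of D 0] lebesgue_measurable_continuous[OF C1cD(2)[OF \<Psi>]] by simp
qed

section \<open>Smoothing kernels of unit mass and the averages they define\<close>

definition mollifier :: "real \<Rightarrow> (real^'n::finite \<Rightarrow> real) \<Rightarrow> bool" where
  "mollifier \<epsilon> J \<longleftrightarrow> test_function UNIV J \<and> (\<forall>x. 0 \<le> J x) \<and> (\<forall>x. \<epsilon> < norm x \<longrightarrow> J x = 0) \<and>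
     (\<integral>x. J x \<partial>lebesgue) = 1"

text \<open>Rescalings of one product bump. The constant in the gradient bound depends only on the
  dimension; \<open>cutoff_near_set\<close> takes its own gradient bound from it.\<close>

lemma ex_mollifier:
  "\<exists>C. \<forall>\<epsilon>>0. \<exists>J :: real^'n::finite \<Rightarrow> real. mollifier \<epsilon> J \<and> (\<integral>x. norm (grad J x) \<partial>lebesgue) \<le> C / \<epsilon>"
proof -
  define \<phi> :: "real^'n \<Rightarrow> real" where "\<phi> x = (\<Prod>i\<in>UNIV. bump1 1 0 (x $ i))" for x
  define N where "N = real CARD('n)"
  have N: "0 < N" by (simp add: N_def)
  have smooth: "smooth_on UNIV \<phi>"
    unfolding \<phi>_def by (rule smooth_prod_bump1)
  have nonneg: "0 \<le> \<phi> x" for x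
    unfolding \<phi>_def by (intro prod_nonneg) (simp add: bump1_def)
  \<comment> \<open>The bump vanishes as soon as one coordinate has modulus at least 1; otherwise
    the l1 norm, hence the norm, is below the dimension \<open>N\<close>.\<close>
  have zero: "\<phi> x = 0" if "N < norm x" for x
  proof -
    have "\<exists>i. 1 \<le> \<bar>x $ i\<bar>"
    proof (rule ccontr)
      assume "\<nexists>i. 1 \<le> \<bar>x $ i\<bar>"
      then have "\<And>i. \<bar>x $ i\<bar> < 1" by (auto simp: not_le)
      then have "(\<Sum>i\<in>UNIV. \<bar>x $ i\<bar>) < N"
        using sum_strict_mono[of UNIV "\<lambda>i. \<bar>x $ i\<bar>" "\<lambda>_. 1"] by (simp add: N_def)
      with norm_le_l1_cart[of x] that show False by linarith
    qed
    then obtain i where "1 \<le> \<bar>x $ i\<bar>" ..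
    then show ?thesis
      unfolding \<phi>_def by (intro prod_zero) (auto simp: bump1_def intro!: exI[of _ i])
  qed
  have test: "test_function UNIV \<phi>"
    by (rule test_functionI[OF smooth, of "cball 0 N"]) (use zero in auto)
  note C1 = test_function_C1c[OF test]
  have int: "integrable lebesgue \<phi>"
    by (rule compact_support_integrable[OF C1cD(3)[OF C1], of "cball 0 N"]) (use zero in auto)
  define I where "I = (\<integral>x. \<phi> x \<partial>lebesgue)"
  define I' where "I' = (\<integral>x. norm (grad \<phi> x) \<partial>lebesgue)"
  have "I \<noteq> 0"
  proof
    assume "I = 0"
    then have "AE x in lebesgue. \<phi> x = 0"
      unfolding I_def using integral_nonneg_eq_0_iff_AE[OF int] nonneg by simp
    moreover have op: "open {x. \<phi> x \<noteq> 0}"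
      by (intro open_Collect_neq C1cD(3)[OF C1] continuous_intros)
    ultimately have "negligible {x. \<phi> x \<noteq> 0}"
      by (subst (asm) AE_iff_null) (auto simp: negligible_iff_null_sets)
    moreover have "\<phi> 0 \<noteq> 0" by (simp add: \<phi>_def bump1_def)
    ultimately show False
      using open_not_negligible[OF op] by blast
  qed
  then have I: "0 < I"
    using nonneg by (simp add: I_def less_le integral_nonneg_AE)
  show ?thesis
  proof (intro exI[of _ "N * I' / I"] allI impI)
    fix \<epsilon> :: real assume e: "0 < \<epsilon>"
    \<comment> \<open>This scale brings the support from the ball of radius \<open>N\<close> into
      the ball of radius \<epsilon>; \<open>c\<close> restores the unit integral.\<close>
    define a where "a = N / \<epsilon>"
    have a: "0 < a" using N e by (simp add: a_def)
    define c where "c = a ^ CARD('n) / I"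
    have c: "0 < c" using a I by (simp add: c_def)
    define J where "J = (\<lambda>x. c * \<phi> (0 + a *\<^sub>R x))"
    have Jz: "J x = 0" if "\<epsilon> < norm x" for x
      using zero[of "a *\<^sub>R x"] that e N a by (simp add: J_def a_def field_simps)
    have "smooth_on UNIV J"
      unfolding J_def by (intro smooth_affine smooth)
    then have tJ: "test_function UNIV J"
      by (rule test_functionI[of _ "cball 0 \<epsilon>"]) (use Jz in auto)
    have gJ: "grad J x = (c * a) *\<^sub>R grad \<phi> (a *\<^sub>R x)" for x
    proof (rule grad_eqI)
      have "(J has_derivative (\<lambda>h. c * (grad \<phi> (0 + a *\<^sub>R x) \<bullet> (a *\<^sub>R h)))) (at x)"
        unfolding J_def
        by (rule derivative_eq_intros smooth_has_derivative[OF smooth, THEN has_derivative_compose[rotated]] refl | simp)+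
      then show "(J has_derivative (\<lambda>h. (c * a) *\<^sub>R grad \<phi> (a *\<^sub>R x) \<bullet> h)) (at x)"
        by (simp add: mult.assoc)
    qed
    have "(\<integral>x. J x \<partial>lebesgue) = c * (I / a ^ CARD('n))"
      using lebesgue_integral_scale[OF C1cD(3)[OF C1] a] by (simp add: J_def I_def divide_inverse mult.commute)
    then have "mollifier \<epsilon> J"
      using tJ nonneg Jz c a I by (auto simp: mollifier_def J_def c_def)
    moreover have "(\<integral>x. norm (grad J x) \<partial>lebesgue) = c * a * (I' / a ^ CARD('n))"
      using lebesgue_integral_scale[OF continuous_on_norm[OF C1cD(2)[OF C1]] a] c a
      by (simp add: gJ I'_def divide_inverse mult.commute)
    then have "(\<integral>x. norm (grad J x) \<partial>lebesgue) \<le> N * I' / I / \<epsilon>"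
      using a e I by (simp add: c_def a_def)
    ultimately show "\<exists>J :: real^'n \<Rightarrow> real. mollifier \<epsilon> J \<and> (\<integral>x. norm (grad J x) \<partial>lebesgue) \<le> N * I' / I / \<epsilon>"
      by blast
  qed
qed

lemma mollifierD:
  assumes "mollifier \<epsilon> J"
  shows "test_function UNIV J" "0 \<le> J x" "\<epsilon> < norm x \<Longrightarrow> J x = 0" "(\<integral>x. J x \<partial>lebesgue) = 1"
    "C1c UNIV J (grad J)" "continuous_on UNIV J" "integrable lebesgue J"
proof -
  show test: "test_function UNIV J" and "0 \<le> J x" "\<epsilon> < norm x \<Longrightarrow> J x = 0" "(\<integral>x. J x \<partial>lebesgue) = 1"
    using assms by (auto simp: mollifier_def)
  show C1: "C1c UNIV J (grad J)"
    by (rule test_function_C1c[OF test])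
  show "continuous_on UNIV J"
    by (rule C1cD(3)[OF C1])
  show "integrable lebesgue J"
    by (rule C1c_support[OF C1]) (rule compact_support_integrable[OF C1cD(3)[OF C1]])
qed

lemma mollifier_reflect:
  assumes "mollifier \<epsilon> J"
  shows "integrable lebesgue (\<lambda>y. J (x - y))" "(\<integral>y. J (x - y) \<partial>lebesgue) = 1"
proof -
  show "(\<integral>y. J (x - y) \<partial>lebesgue) = 1"
    using lebesgue_integral_reflect[of J x] mollifierD[OF assms] by (simp add: lebesgue_measurable_continuous)
  \<comment> \<open>A non-integrable function has integral 0 by convention, so the value 1 forces
    integrability.\<close>
  then show "integrable lebesgue (\<lambda>y. J (x - y))"
    using not_integrable_integral_eq by fastforce
qed

lemma mollify_local:
  assumes "mollifier \<epsilon> J" "\<And>y. y \<in> cball x \<epsilon> \<Longrightarrow> f y = g y"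
  shows "mollify J f x = mollify J g x"
  unfolding mollify_def
proof (intro Bochner_Integration.integral_cong refl)
  fix y
  show "J (x - y) *\<^sub>R f y = J (x - y) *\<^sub>R g y"
    using mollifierD(3)[OF assms(1), of "x - y"] assms(2)[of y] by (cases "y \<in> cball x \<epsilon>") (auto simp: dist_norm)
qed

lemma mollify_le:
  fixes f :: "real^'n::finite \<Rightarrow> real"
  assumes J: "mollifier \<epsilon> J" and f: "integrable lebesgue f" and b: "\<And>y. y \<in> cball x \<epsilon> \<Longrightarrow> f y \<le> b"
  shows "mollify J f x \<le> b"
proof -
  have "mollify J f x \<le> (\<integral>y. J (x - y) * b \<partial>lebesgue)"
    unfolding mollify_def
  proof (intro integral_mono)
    fix y
    show "J (x - y) *\<^sub>R f y \<le> J (x - y) * b"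
      using mollifierD(2,3)[OF J, of "x - y"] b[of y] by (cases "y \<in> cball x \<epsilon>") (auto simp: dist_norm mult_left_mono)
  qed (use C1c_mollify_integrable[OF mollifierD(5)[OF J] f] mollifier_reflect[OF J] in auto)
  then show ?thesis
    using mollifier_reflect[OF J] by simp
qed

lemma mollify_ge:
  fixes f :: "real^'n::finite \<Rightarrow> real"
  assumes J: "mollifier \<epsilon> J" and f: "integrable lebesgue f" and b: "\<And>y. y \<in> cball x \<epsilon> \<Longrightarrow> b \<le> f y"
  shows "b \<le> mollify J f x"
  using mollify_le[OF J, of "\<lambda>y. - f y" x "- b"] f b by (simp add: mollify_def)

text \<open>Averages stay in every closed ball that contains the averaged values: the vector-valued
  counterpart of the two order bounds before it.\<close>

lemma mollify_dist_le:
  fixes f :: "real^'n::finite \<Rightarrow> 'b::euclidean_space"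
  assumes J: "mollifier \<epsilon> J" and f: "integrable lebesgue f" and b: "\<And>y. y \<in> cball x \<epsilon> \<Longrightarrow> norm (f y - b) \<le> e"
  shows "norm (mollify J f x - b) \<le> e"
proof -
  note int = C1c_mollify_integrable[OF mollifierD(5)[OF J] f] mollifier_reflect[OF J]
  have "mollify J f x - b = (\<integral>y. J (x - y) *\<^sub>R f y - J (x - y) *\<^sub>R b \<partial>lebesgue)"
    unfolding mollify_def using int by (subst Bochner_Integration.integral_diff) auto
  also have "norm \<dots> \<le> (\<integral>y. J (x - y) * e \<partial>lebesgue)"
  proof (rule Bochner_Integration.integral_norm_bound_integral)
    fix y
    have "norm (J (x - y) *\<^sub>R f y - J (x - y) *\<^sub>R b) = J (x - y) * norm (f y - b)"
      using mollifierD(2)[OF J, of "x - y"] by (simp flip: scaleR_diff_right)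
    also have "\<dots> \<le> J (x - y) * e"
      using mollifierD(2,3)[OF J, of "x - y"] b[of y] by (cases "y \<in> cball x \<epsilon>") (auto simp: dist_norm mult_left_mono)
    finally show "norm (J (x - y) *\<^sub>R f y - J (x - y) *\<^sub>R b) \<le> J (x - y) * e" .
  qed (use int in auto)
  finally show ?thesis using int by simp
qed

text \<open>For vector-valued \<open>f\<close>, which \<open>mollify_has_derivative\<close> does not
  cover; it supplies the measurability of mollified gradients.\<close>

lemma continuous_on_mollify:
  fixes f :: "real^'n::finite \<Rightarrow> 'b::euclidean_space"
  assumes \<phi>: "C1c U \<phi> D" and f: "integrable lebesgue f"
  shows "continuous_on UNIV (mollify \<phi> f)"
  unfolding continuous_on_iff
proof (intro ballI allI impI)
  fix x and e :: real assume e: "0 < e"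
  define I where "I = (\<integral>y. norm (f y) \<partial>lebesgue) + 1"
  have I: "0 < I" unfolding I_def by (intro add_nonneg_pos integral_nonneg_AE) auto
  obtain C where C: "compact C" "\<And>x. x \<notin> C \<Longrightarrow> \<phi> x = 0"
    using \<phi> by (rule C1c_support) blast
  have "uniformly_continuous_on UNIV \<phi>"
    by (rule compact_support_uniformly_continuous[OF C1cD(3)[OF \<phi>] C])
  then obtain d where d: "0 < d" "\<And>z z'. dist z' z < d \<Longrightarrow> dist (\<phi> z') (\<phi> z) < e / I"
    using e I unfolding uniformly_continuous_on_def by (metis UNIV_I divide_pos_pos)
  show "\<exists>d>0. \<forall>x'\<in>UNIV. dist x' x < d \<longrightarrow> dist (mollify \<phi> f x') (mollify \<phi> f x) < e"
  proof (intro exI conjI ballI impI)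
    fix x' assume x': "dist x' x < d"
    note int = C1c_mollify_integrable[OF \<phi> f]
    have "mollify \<phi> f x' - mollify \<phi> f x = (\<integral>y. \<phi> (x' - y) *\<^sub>R f y - \<phi> (x - y) *\<^sub>R f y \<partial>lebesgue)"
      unfolding mollify_def by (rule Bochner_Integration.integral_diff[OF int int, symmetric])
    also have "norm \<dots> \<le> (\<integral>y. e / I * norm (f y) \<partial>lebesgue)"
    proof (rule Bochner_Integration.integral_norm_bound_integral)
      fix y
      have "dist (x' - y) (x - y) < d" using x' by (simp add: dist_norm)
      from d(2)[OF this] show "norm (\<phi> (x' - y) *\<^sub>R f y - \<phi> (x - y) *\<^sub>R f y) \<le> e / I * norm (f y)"
        using mult_right_mono[of "\<bar>\<phi> (x' - y) - \<phi> (x - y)\<bar>" "e / I" "norm (f y)"]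
        by (simp add: dist_norm flip: scaleR_diff_left)
    qed (use int f in auto)
    also have "\<dots> = e * ((\<integral>y. norm (f y) \<partial>lebesgue) / I)" by simp
    also have "\<dots> < e * 1" using e I by (intro mult_strict_left_mono) (auto simp: I_def)
    finally show "dist (mollify \<phi> f x') (mollify \<phi> f x) < e" by (simp add: dist_norm)
  qed (use d in auto)
qed

section \<open>Mollification in Lp\<close>

lemma nn_integral_lborel_translate:
  fixes f :: "'a::euclidean_space \<Rightarrow> ennreal"
  assumes [measurable]: "f \<in> borel_measurable borel"
  shows "(\<integral>\<^sup>+x. f (x - y) \<partial>lborel) = (\<integral>\<^sup>+x. f x \<partial>lborel)"
proof -
  have "(\<integral>\<^sup>+x. f x \<partial>lborel) = (\<integral>\<^sup>+x. f x \<partial>distr lborel borel ((+) (- y)))"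
    by (simp only: lborel_distr_plus)
  also have "\<dots> = (\<integral>\<^sup>+x. f (x - y) \<partial>lborel)"
    by (subst nn_integral_distr) auto
  finally show ?thesis by simp
qed

text \<open>Jensen's inequality is obtained by integrating the tangent inequality at \<open>s = \<integral> J(x - y) |f(y)| dy\<close>.\<close>

lemma mollify_Lp_contraction:
  fixes f :: "real^'n::finite \<Rightarrow> 'b::euclidean_space"
  assumes J: "mollifier \<epsilon> J" and f: "integrable lebesgue f" and p: "1 < p"
    and fp: "Lp_int lebesgue p f < \<infinity>"
  shows "Lp_int lebesgue p (\<lambda>x. mollify J f x) \<le> Lp_int lebesgue p f"
proof -
  have [measurable]: "J \<in> borel_measurable borel"
    using mollifierD(6)[OF J] by (rule borel_measurable_continuous_onI)
  have [measurable]: "f \<in> borel_measurable lebesgue" using f by auto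
  have ifp: "integrable lebesgue (\<lambda>x. norm (f x) powr p)"
    using fp by (auto simp: integrable_iff_bounded)
  have jensen: "ennreal (norm (mollify J f x) powr p) \<le> (\<integral>\<^sup>+y. ennreal (J (x - y)) * ennreal (norm (f y) powr p) \<partial>lebesgue)" for x
  proof -
    note int = C1c_mollify_integrable[OF mollifierD(5)[OF J], of _ x]
    define s where "s = (\<integral>y. J (x - y) * norm (f y) \<partial>lebesgue)"
    have i1: "integrable lebesgue (\<lambda>y. J (x - y) * norm (f y))"
      using int[of "\<lambda>y. norm (f y)"] f by simp
    have i2: "integrable lebesgue (\<lambda>y. J (x - y) * norm (f y) powr p)"
      using int[OF ifp] by simp
    have s0: "0 \<le> s" unfolding s_def using mollifierD(2)[OF J] by (intro integral_nonneg_AE) auto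
    have "norm (mollify J f x) \<le> (\<integral>y. norm (J (x - y) *\<^sub>R f y) \<partial>lebesgue)"
      unfolding mollify_def by (rule integral_norm_bound)
    also have "\<dots> = s" unfolding s_def using mollifierD(2)[OF J] by simp
    finally have le: "norm (mollify J f x) \<le> s" .
    have "(\<integral>y. p * s powr (p - 1) * (J (x - y) * norm (f y)) \<partial>lebesgue) \<le>
       (\<integral>y. (p - 1) * s powr p * J (x - y) + J (x - y) * norm (f y) powr p \<partial>lebesgue)"
    proof (rule integral_mono)
      fix y
      have "J (x - y) * (p * s powr (p - 1) * norm (f y)) \<le> J (x - y) * ((p - 1) * s powr p + norm (f y) powr p)"
        using p s0 by (intro mult_left_mono tangent_powr_le mollifierD(2)[OF J]) auto
      then show "p * s powr (p - 1) * (J (x - y) * norm (f y)) \<le> (p - 1) * s powr p * J (x - y) + J (x - y) * norm (f y) powr p"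
        by (simp add: algebra_simps)
    qed (use i1 i2 mollifier_reflect[OF J] in auto)
    also have "(\<integral>y. p * s powr (p - 1) * (J (x - y) * norm (f y)) \<partial>lebesgue) = p * s powr (p - 1) * s"
      by (simp add: s_def)
    also have "(\<integral>y. (p - 1) * s powr p * J (x - y) + J (x - y) * norm (f y) powr p \<partial>lebesgue) =
       (p - 1) * s powr p + (\<integral>y. J (x - y) * norm (f y) powr p \<partial>lebesgue)"
      using i2 mollifier_reflect[OF J] by simp
    finally have "s powr p \<le> (\<integral>y. J (x - y) * norm (f y) powr p \<partial>lebesgue)"
      using s0 by (cases "s = 0") (auto simp: powr_diff algebra_simps)
    moreover have "norm (mollify J f x) powr p \<le> s powr p"
      using le p by (intro powr_mono2) auto
    ultimately have "ennreal (norm (mollify J f x) powr p) \<le> ennreal (\<integral>y. J (x - y) * norm (f y) powr p \<partial>lebesgue)"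
      by (intro ennreal_leI) linarith
    also have "\<dots> = (\<integral>\<^sup>+y. ennreal (J (x - y) * norm (f y) powr p) \<partial>lebesgue)"
      using i2 mollifierD(2)[OF J] by (intro nn_integral_eq_integral[symmetric]) auto
    finally show ?thesis
      using mollifierD(2)[OF J] by (simp add: ennreal_mult)
  qed
  \<comment> \<open>Exchanging the integrals requires joint Borel measurability, so the Lebesgue
    measurable power of \<open>f\<close> is replaced by a Borel version.\<close>
  obtain h where h[measurable]: "h \<in> borel_measurable lborel" and fh: "AE x in lborel. ennreal (norm (f x) powr p) = h x"
    using completion_ex_borel_measurable[of "\<lambda>x. ennreal (norm (f x) powr p)" lborel] by auto
  have "Lp_int lebesgue p (\<lambda>x. mollify J f x) \<le>
      (\<integral>\<^sup>+x. (\<integral>\<^sup>+y. ennreal (J (x - y)) * ennreal (norm (f y) powr p) \<partial>lebesgue) \<partial>lebesgue)"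
    by (intro nn_integral_mono jensen)
  also have "\<dots> = (\<integral>\<^sup>+x. (\<integral>\<^sup>+y. ennreal (J (x - y)) * ennreal (norm (f y) powr p) \<partial>lborel) \<partial>lborel)"
    by (simp add: nn_integral_completion)
  also have "\<dots> = (\<integral>\<^sup>+x. (\<integral>\<^sup>+y. ennreal (J (x - y)) * h y \<partial>lborel) \<partial>lborel)"
    by (intro nn_integral_cong nn_integral_cong_AE) (use fh in auto)
  also have "\<dots> = (\<integral>\<^sup>+y. (\<integral>\<^sup>+x. ennreal (J (x - y)) * h y \<partial>lborel) \<partial>lborel)"
    by (rule lborel_pair.Fubini') measurable
  also have "\<dots> = (\<integral>\<^sup>+y. (\<integral>\<^sup>+x. ennreal (J x) \<partial>lborel) * h y \<partial>lborel)"
    using nn_integral_lborel_translate[of "\<lambda>x. ennreal (J x)"] by (simp add: nn_integral_multc)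
  also have "(\<integral>\<^sup>+x. ennreal (J x) \<partial>lborel) = ennreal (\<integral>x. J x \<partial>lebesgue)"
    using mollifierD(2,7)[OF J] by (subst nn_integral_eq_integral[symmetric]) (auto simp: nn_integral_completion)
  also have "(\<integral>\<^sup>+y. ennreal (\<integral>x. J x \<partial>lebesgue) * h y \<partial>lborel) = (\<integral>\<^sup>+y. h y \<partial>lborel)"
    by (simp add: mollifierD(4)[OF J])
  also have "\<dots> = Lp_int lebesgue p f"
    unfolding nn_integral_completion by (intro nn_integral_cong_AE) (use fh in auto)
  finally show ?thesis .
qed

text \<open>\<open>closest_point\<close> onto a ball truncates vector values; as 0 lies in the ball,
  the error is dominated by \<open>f\<close> itself.\<close>

lemma Lp_truncation:
  fixes f :: "'a \<Rightarrow> 'b::euclidean_space"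
  assumes f[measurable]: "f \<in> borel_measurable M" and p: "0 < p"
    and fp: "Lp_int M p f < \<infinity>" and e: "0 < (e::real)"
  shows "\<exists>k::nat. 0 < k \<and> (Lp_int M p (\<lambda>x. f x - closest_point (cball 0 (real k)) (f x))) < ennreal e"
proof -
  let ?c = "\<lambda>k::nat. closest_point (cball (0::'b) (real k))"
  have cont: "continuous_on UNIV (?c k)" for k
    by (rule continuous_on_closest_point) auto
  have [measurable]: "?c k \<in> borel_measurable borel" for k
    by (rule borel_measurable_continuous_onI[OF cont])
  have "(\<lambda>k. \<integral>\<^sup>+x. ennreal (norm (f x - ?c k (f x)) powr p) \<partial>M) \<longlonglongrightarrow> (\<integral>\<^sup>+x. 0 \<partial>M)"
  proof (rule nn_integral_dominated_convergence[where w="\<lambda>x. ennreal (norm (f x) powr p)"])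
    show "AE x in M. ennreal (norm (f x - ?c k (f x)) powr p) \<le> ennreal (norm (f x) powr p)" for k
      using closest_point_le[of "cball 0 (real k)" 0] p
      by (intro AE_I2 ennreal_leI powr_mono2) (auto simp: dist_norm)
    show "AE x in M. (\<lambda>k. ennreal (norm (f x - ?c k (f x)) powr p)) \<longlonglongrightarrow> 0"
    proof (rule AE_I2)
      fix x
      obtain N :: nat where N: "norm (f x) \<le> real N" using real_arch_simple by blast
      have "ennreal (norm (f x - ?c k (f x)) powr p) = 0" if "k \<ge> N" for k
        using N that closest_point_self[of "f x" "cball 0 (real k)"] by simp
      then show "(\<lambda>k. ennreal (norm (f x - ?c k (f x)) powr p)) \<longlonglongrightarrow> 0"
        by (intro tendsto_eventually) (auto simp: eventually_sequentially)
    qed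
  qed (use fp in auto)
  then have "(\<lambda>k. \<integral>\<^sup>+x. ennreal (norm (f x - ?c k (f x)) powr p) \<partial>M) \<longlonglongrightarrow> 0" by simp
  from eventually_conj[OF ennreal_tendsto_0D[OF this e] eventually_gt_at_top[of 0]]
  show ?thesis by (auto simp: eventually_sequentially)
qed

text \<open>A measurable function is an almost everywhere limit of continuous ones. Truncating their
  values by \<open>closest_point\<close> and cutting them off in space by \<kappa> gives a common
  bound and a common bounded support, so dominated convergence applies.\<close>

lemma Lp_dense_continuous:
  fixes f :: "'a::euclidean_space \<Rightarrow> 'b::euclidean_space"
  assumes f[measurable]: "f \<in> borel_measurable lebesgue" and p: "0 < p"
    and fp: "Lp_int lebesgue p f < \<infinity>"
    and C: "bounded C" "\<And>x. x \<notin> C \<Longrightarrow> f x = 0" and e: "0 < (e::real)"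
  shows "\<exists>g C'. continuous_on UNIV g \<and> compact C' \<and> (\<forall>x. x \<notin> C' \<longrightarrow> g x = 0) \<and>
     (Lp_int lebesgue p (\<lambda>x. f x - g x)) \<le> ennreal e"
proof -
  \<comment> \<open>Two errors of this size meet in one triangle estimate, whose factor is
    \<open>2 powr p\<close>.\<close>
  define e' where "e' = e / (2 * 2 powr p)"
  have e': "0 < e'" using e by (simp add: e'_def)
  obtain M :: nat where M: "0 < M" and fM: "Lp_int lebesgue p (\<lambda>x. f x - closest_point (cball 0 (real M)) (f x)) < ennreal e'"
    using Lp_truncation[OF f p fp e'] by blast
  let ?c = "closest_point (cball (0::'b) (real M))"
  have cont: "continuous_on S ?c" for S
    by (rule continuous_on_closest_point) auto
  have [measurable]: "?c \<in> borel_measurable borel"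
    by (rule borel_measurable_continuous_onI[OF cont])
  have cM: "norm (?c v) \<le> M" for v
    using closest_point_in_set[of "cball (0::'b) (real M)" v] by auto
  have c0: "?c 0 = 0" by (rule closest_point_self) simp
  obtain R where R: "C \<subseteq> ball 0 R"
    using bounded_subset_ballD[OF C(1)] by blast
  define \<kappa> :: "'a \<Rightarrow> real" where "\<kappa> x = max 0 (min 1 (R + 1 - norm x))" for x
  have \<kappa>cont: "continuous_on S \<kappa>" for S unfolding \<kappa>_def by (intro continuous_intros)
  have \<kappa>: "0 \<le> \<kappa> x" "\<kappa> x \<le> 1" "x \<in> C \<Longrightarrow> \<kappa> x = 1" "x \<notin> cball 0 (R + 1) \<Longrightarrow> \<kappa> x = 0" for x
    using R by (auto simp: \<kappa>_def subset_iff)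
  obtain N g where N: "negligible N" and g: "\<And>n. continuous_on UNIV (g n)" "\<And>x. x \<notin> N \<Longrightarrow> (\<lambda>n. g n x) \<longlonglongrightarrow> f x"
    using lebesgue_measurable_imp_measurable_on[OF f, of UNIV] unfolding measurable_on_def by auto
  define h where "h n x = \<kappa> x *\<^sub>R ?c (g n x)" for n x
  have hcont: "continuous_on UNIV (h n)" for n
    unfolding h_def by (intro continuous_intros \<kappa>cont continuous_on_compose2[OF cont g(1)]) auto
  have [measurable]: "h n \<in> borel_measurable lebesgue" for n
    by (rule lebesgue_measurable_continuous[OF hcont])
  have "(\<lambda>n. \<integral>\<^sup>+x. ennreal (norm (?c (f x) - h n x) powr p) \<partial>lebesgue) \<longlonglongrightarrow> (\<integral>\<^sup>+x. 0 \<partial>(lebesgue :: 'a measure))"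
  proof (rule nn_integral_dominated_convergence[where w="\<lambda>x. ennreal ((2 * M) powr p) * indicator (cball 0 (R + 1)) x"])
    show "AE x in lebesgue. ennreal (norm (?c (f x) - h n x) powr p) \<le> ennreal ((2 * M) powr p) * indicator (cball 0 (R + 1)) x" for n
    proof (rule AE_I2)
      fix x
      show "ennreal (norm (?c (f x) - h n x) powr p) \<le> ennreal ((2 * M) powr p) * indicator (cball 0 (R + 1)) x"
      proof (cases "x \<in> cball 0 (R + 1)")
        case True
        have "norm (h n x) \<le> 1 * real M"
          unfolding h_def norm_scaleR using \<kappa>[of x] cM by (intro mult_mono) auto
        then have "norm (?c (f x) - h n x) \<le> 2 * M"
          using norm_triangle_ineq4[of "?c (f x)" "h n x"] cM[of "f x"] by linarith
        then have "norm (?c (f x) - h n x) powr p \<le> (2 * M) powr p"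
          using p by (intro powr_mono2) auto
        then show ?thesis using True by (simp add: ennreal_leI)
      next
        case False
        then have "x \<notin> C" using R by auto
        then show ?thesis using False \<kappa>(4)[of x] C(2) p c0 by (simp add: h_def)
      qed
    qed
    show "(\<integral>\<^sup>+ x. ennreal ((2 * M) powr p) * indicator (cball 0 (R + 1)) x \<partial>(lebesgue :: 'a measure)) < \<infinity>"
      using emeasure_bounded_finite[OF bounded_cball[of "0::'a" "R + 1"]]
      by (subst nn_integral_cmult_indicator) (simp_all add: ennreal_mult_less_top)
    have "AE x in lebesgue. x \<notin> N"
      using N by (intro AE_not_in) (simp add: negligible_iff_null_sets)
    then show "AE x in lebesgue. (\<lambda>n. ennreal (norm (?c (f x) - h n x) powr p)) \<longlonglongrightarrow> 0"
    proof eventually_elim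
      fix x assume x: "x \<notin> N"
      have "(\<lambda>n. ?c (g n x)) \<longlonglongrightarrow> ?c (f x)"
        by (rule continuous_on_tendsto_compose[OF cont[of UNIV] g(2)[OF x]]) auto
      then have "(\<lambda>n. h n x) \<longlonglongrightarrow> \<kappa> x *\<^sub>R ?c (f x)"
        unfolding h_def by (intro tendsto_intros)
      also have "\<kappa> x *\<^sub>R ?c (f x) = ?c (f x)"
        using \<kappa>(3) C(2) c0 by (cases "x \<in> C") auto
      finally have "(\<lambda>n. norm (?c (f x) - h n x)) \<longlonglongrightarrow> norm (?c (f x) - ?c (f x))"
        by (intro tendsto_intros)
      then have "(\<lambda>n. norm (?c (f x) - h n x)) \<longlonglongrightarrow> 0" by simp
      then have "(\<lambda>n. norm (?c (f x) - h n x) powr p) \<longlonglongrightarrow> 0"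
        using p by (intro tendsto_zero_powrI[where b=p]) (auto intro: tendsto_const)
      then show "(\<lambda>n. ennreal (norm (?c (f x) - h n x) powr p)) \<longlonglongrightarrow> 0"
        by (metis ennreal_0 tendsto_ennrealI)
    qed
    show "(\<lambda>x. ennreal ((2 * M) powr p) * indicator (cball 0 (R + 1)) x) \<in> borel_measurable (lebesgue :: 'a measure)"
      by (intro borel_measurable_times_ennreal borel_measurable_const borel_measurable_indicator) simp
    show "(\<lambda>x. ennreal (norm (?c (f x) - h n x) powr p)) \<in> borel_measurable lebesgue" for n
      by measurable
    show "(\<lambda>x. 0) \<in> borel_measurable lebesgue" by simp
  qed
  then have "(\<lambda>n. \<integral>\<^sup>+x. ennreal (norm (?c (f x) - h n x) powr p) \<partial>lebesgue) \<longlonglongrightarrow> 0" by simp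
  from eventually_happens'[OF _ ennreal_tendsto_0D[OF this e']]
  obtain n where n: "Lp_int lebesgue p (\<lambda>x. ?c (f x) - h n x) < ennreal e'" by auto
  have "Lp_int lebesgue p (\<lambda>x. f x - h n x) \<le>
      ennreal (2 powr p) * (Lp_int lebesgue p (\<lambda>x. f x - ?c (f x)) + Lp_int lebesgue p (\<lambda>x. ?c (f x) - h n x))"
    using p by (intro nn_integral_norm_diff_powr_triangle) auto
  also have "\<dots> \<le> ennreal (2 powr p) * (ennreal e' + ennreal e')"
    using fM n by (intro mult_left_mono add_mono) auto
  also have "\<dots> = ennreal e"
    using e' by (simp add: e'_def flip: ennreal_mult ennreal_plus)
  finally have "Lp_int lebesgue p (\<lambda>x. f x - h n x) \<le> ennreal e" .
  moreover have "\<forall>x. x \<notin> cball 0 (R + 1) \<longrightarrow> h n x = 0"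
    using \<kappa>(4) by (simp add: h_def)
  ultimately show ?thesis
    using hcont compact_cball by blast
qed

text \<open>Uniform continuity makes the error uniformly small, and all errors live on one ball of
  finite measure.\<close>

lemma mollify_Lp_tendsto_continuous:
  fixes g :: "real^'n::finite \<Rightarrow> 'b::euclidean_space"
  assumes J: "\<And>k. mollifier (\<epsilon> k) (J k)" and \<epsilon>: "\<epsilon> \<longlonglongrightarrow> 0" and p: "0 < p"
    and g: "continuous_on UNIV g" "compact C" "\<And>x. x \<notin> C \<Longrightarrow> g x = 0"
  shows "(\<lambda>k. \<integral>\<^sup>+x. ennreal (norm (mollify (J k) g x - g x) powr p) \<partial>lebesgue) \<longlonglongrightarrow> 0"
proof (rule ennreal_tendsto_0I)
  fix e :: real assume e: "0 < e"
  have int: "integrable lebesgue g"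
    by (rule compact_support_integrable[OF g])
  obtain R where R: "0 < R" "C \<subseteq> ball 0 R"
    using bounded_subset_ballD[OF compact_imp_bounded[OF g(2)]] by blast
  let ?B = "cball (0::real^'n) (R + 1)"
  define m where "m = measure lebesgue ?B + 1"
  have m: "0 < m" unfolding m_def by (intro add_nonneg_pos) auto
  have em: "emeasure lebesgue ?B \<le> ennreal m"
    using emeasure_bounded_finite[OF bounded_cball[of "0::real^'n" "R + 1"]]
    by (simp add: m_def emeasure_eq_ennreal_measure ennreal_leI)
  \<comment> \<open>A uniform error \<eta> on a set of measure \<open>m\<close> contributes exactly
    \<open>e\<close>.\<close>
  define \<eta> where "\<eta> = (e / m) powr (1 / p)"
  have \<eta>: "0 < \<eta>" "\<eta> powr p = e / m" using e m p by (auto simp: \<eta>_def powr_powr)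
  have "uniformly_continuous_on UNIV g"
    by (rule compact_support_uniformly_continuous[OF g])
  then obtain d where d: "0 < d" "\<And>x y. dist y x < d \<Longrightarrow> dist (g y) (g x) < \<eta>"
    using \<eta>(1) unfolding uniformly_continuous_on_def by (metis UNIV_I)
  have "\<forall>\<^sub>F k in sequentially. \<epsilon> k < min d 1"
    using d by (intro order_tendstoD(2)[OF \<epsilon>]) auto
  then show "\<forall>\<^sub>F k in sequentially. (Lp_int lebesgue p (\<lambda>x. mollify (J k) g x - g x)) \<le> ennreal e"
  proof eventually_elim
    fix k assume k: "\<epsilon> k < min d 1"
    have "Lp_int lebesgue p (\<lambda>x. mollify (J k) g x - g x) \<le> (\<integral>\<^sup>+x. ennreal (e / m) * indicator ?B x \<partial>lebesgue)"
    proof (rule nn_integral_mono)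
      fix x
      show "ennreal (norm (mollify (J k) g x - g x) powr p) \<le> ennreal (e / m) * indicator ?B x"
      proof (cases "x \<in> ?B")
        case True
        have "norm (mollify (J k) g x - g x) \<le> \<eta>"
        proof (rule mollify_dist_le[OF J int])
          fix y assume "y \<in> cball x (\<epsilon> k)"
          then show "norm (g y - g x) \<le> \<eta>"
            using d(2)[of y x] k by (auto simp: dist_norm norm_minus_commute)
        qed
        then have "norm (mollify (J k) g x - g x) powr p \<le> \<eta> powr p"
          using p by (intro powr_mono2) auto
        with True \<eta> show ?thesis by (simp add: ennreal_leI)
      next
        case False
        have "g y = 0" if "y \<in> cball x (\<epsilon> k)" for y
        proof -
          have "y \<notin> ball 0 R"
            using False that k norm_triangle_ineq2[of x y] by (auto simp: dist_norm)
          then show ?thesis using R g(3) by blast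
        qed
        moreover have "x \<notin> ball 0 R" using False by auto
        then have "g x = 0" using R g(3) by blast
        ultimately have "norm (mollify (J k) g x - g x) \<le> 0"
          by (intro mollify_dist_le[OF J int]) auto
        with p show ?thesis by simp
      qed
    qed
    also have "\<dots> = ennreal (e / m) * emeasure lebesgue ?B"
      by (rule nn_integral_cmult_indicator) simp
    also have "\<dots> \<le> ennreal (e / m) * ennreal m"
      by (intro mult_left_mono em) auto
    also have "\<dots> = ennreal e"
      using e m by (simp flip: ennreal_mult)
    finally show "Lp_int lebesgue p (\<lambda>x. mollify (J k) g x - g x) \<le> ennreal e" .
  qed
qed

text \<open>By \<open>mollify_Lp_contraction\<close>, the mollifications of \<open>f\<close> and of
  a continuous approximation \<open>g\<close> differ no more than \<open>f\<close> and
  \<open>g\<close> do, uniformly in \<open>k\<close>.\<close>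

lemma mollify_Lp_tendsto:
  fixes f :: "real^'n::finite \<Rightarrow> 'b::euclidean_space"
  assumes J: "\<And>k. mollifier (\<epsilon> k) (J k)" and \<epsilon>: "\<epsilon> \<longlonglongrightarrow> 0" and p: "1 < p"
    and f: "integrable lebesgue f" and fp: "Lp_int lebesgue p f < \<infinity>"
    and C: "bounded C" "\<And>x. x \<notin> C \<Longrightarrow> f x = 0"
  shows "Lp_tendsto lebesgue p (\<lambda>k. mollify (J k) f) f"
  unfolding Lp_tendsto_def
proof (intro conjI allI)
  have meas: "mollify (J k) h \<in> borel_measurable lebesgue" if "integrable lebesgue h" for h :: "real^'n \<Rightarrow> 'b" and k
    by (rule lebesgue_measurable_continuous[OF continuous_on_mollify[OF mollifierD(5)[OF J] that]])
  show "mollify (J k) f \<in> borel_measurable lebesgue" for k by (rule meas[OF f])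
  show fm[measurable]: "f \<in> borel_measurable lebesgue" using f by auto
  show "(\<lambda>k. \<integral>\<^sup>+x. ennreal (norm (mollify (J k) f x - f x) powr p) \<partial>lebesgue) \<longlonglongrightarrow> 0"
  proof (rule ennreal_tendsto_0I)
    fix e :: real assume e: "0 < e"
    \<comment> \<open>Solves \<open>2 powr p * (e' + 2 powr p * (e' + e')) = e\<close>: three errors
      joined by two nested triangle estimates.\<close>
    define e' where "e' = e / (2 powr p * (1 + 2 powr p * 2))"
    have e': "0 < e'" using e by (simp add: e'_def add_pos_pos)
    obtain g C' where g: "continuous_on UNIV g" "compact C'" "\<And>x. x \<notin> C' \<Longrightarrow> g x = 0"
      and fg: "Lp_int lebesgue p (\<lambda>x. f x - g x) \<le> ennreal e'"
      using Lp_dense_continuous[OF fm _ fp C e'] p by auto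
    have ig: "integrable lebesgue g" by (rule compact_support_integrable[OF g])
    have [measurable]: "g \<in> borel_measurable lebesgue" using ig by auto
    have gf: "Lp_int lebesgue p (\<lambda>x. g x - f x) \<le> ennreal e'"
      using fg by (simp add: norm_minus_commute)
    have "\<forall>\<^sub>F k in sequentially. (Lp_int lebesgue p (\<lambda>x. mollify (J k) g x - g x)) < ennreal e'"
      using p by (intro ennreal_tendsto_0D[OF mollify_Lp_tendsto_continuous[OF J \<epsilon> _ g] e']) auto
    then show "\<forall>\<^sub>F k in sequentially. (Lp_int lebesgue p (\<lambda>x. mollify (J k) f x - f x)) \<le> ennreal e"
    proof eventually_elim
      fix k assume k: "Lp_int lebesgue p (\<lambda>x. mollify (J k) g x - g x) < ennreal e'"
      note [measurable] = meas[OF f] meas[OF ig]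
      have "mollify (J k) f x - mollify (J k) g x = mollify (J k) (\<lambda>x. f x - g x) x" for x
        using C1c_mollify_integrable[OF mollifierD(5)[OF J[of k]] f] C1c_mollify_integrable[OF mollifierD(5)[OF J[of k]] ig]
        by (simp add: mollify_def scaleR_diff_right)
      then have "Lp_int lebesgue p (\<lambda>x. mollify (J k) f x - mollify (J k) g x) =
         (Lp_int lebesgue p (\<lambda>x. mollify (J k) (\<lambda>x. f x - g x) x))" by simp
      also have "\<dots> \<le> Lp_int lebesgue p (\<lambda>x. f x - g x)"
        by (rule mollify_Lp_contraction[OF J _ p]) (use f ig fg in \<open>auto simp: order.strict_iff_not top_unique\<close>)
      also note fg
      finally have 1: "Lp_int lebesgue p (\<lambda>x. mollify (J k) f x - mollify (J k) g x) \<le> ennreal e'" .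
      have 2: "Lp_int lebesgue p (\<lambda>x. mollify (J k) g x - f x) \<le> ennreal (2 powr p) * (ennreal e' + ennreal e')"
        by (rule order_trans[OF nn_integral_norm_diff_powr_triangle[where g=g]])
          (use p k gf in \<open>auto intro!: mult_left_mono add_mono\<close>)
      have "Lp_int lebesgue p (\<lambda>x. mollify (J k) f x - f x) \<le>
         ennreal (2 powr p) * (ennreal e' + ennreal (2 powr p) * (ennreal e' + ennreal e'))"
        by (rule order_trans[OF nn_integral_norm_diff_powr_triangle[where g="mollify (J k) g"]])
          (use p 1 2 in \<open>auto intro!: mult_left_mono add_mono\<close>)
      also have "\<dots> = ennreal (2 powr p * (e' + 2 powr p * (e' + e')))"
        using e' by (simp flip: ennreal_mult ennreal_plus)
      also have "2 powr p * (e' + 2 powr p * (e' + e')) = 2 powr p * (1 + 2 powr p * 2) * e'"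
        by (simp add: algebra_simps)
      also have "\<dots> = e"
        using e by (simp add: e'_def add_pos_pos less_imp_neq[symmetric])
      finally show "Lp_int lebesgue p (\<lambda>x. mollify (J k) f x - f x) \<le> ennreal e" .
    qed
  qed
qed

lemma Lp_tendsto_subseq:
  "Lp_tendsto M p V W \<Longrightarrow> strict_mono r \<Longrightarrow> Lp_tendsto M p (\<lambda>k. V (r k)) W"
  unfolding Lp_tendsto_def
  using LIMSEQ_subseq_LIMSEQ[of "\<lambda>k. \<integral>\<^sup>+x. ennreal (norm (V k x - W x) powr p) \<partial>M" 0 r] by (auto simp: comp_def)

text \<open>The p-th powers of the differences tend to 0 in L1, once finitely many possibly
  non-integrable ones are dropped, hence almost everywhere along a subsequence.\<close>

lemma Lp_tendsto_AE_subseq: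
  fixes V :: "nat \<Rightarrow> 'a \<Rightarrow> 'b::euclidean_space"
  assumes V: "Lp_tendsto M p V W" and p: "0 < p"
  shows "\<exists>r. strict_mono r \<and> (AE x in M. (\<lambda>k. V (r k) x) \<longlonglongrightarrow> W x)"
proof -
  have [measurable]: "\<And>k. V k \<in> borel_measurable M" "W \<in> borel_measurable M"
    and V0: "(\<lambda>k. \<integral>\<^sup>+x. ennreal (norm (V k x - W x) powr p) \<partial>M) \<longlonglongrightarrow> 0"
    using V by (auto simp: Lp_tendsto_def)
  obtain N where N: "\<And>k. k \<ge> N \<Longrightarrow> (Lp_int M p (\<lambda>x. V k x - W x)) < ennreal 1"
    using ennreal_tendsto_0D[OF V0, of 1] by (auto simp: eventually_sequentially)
  define u where "u k x = norm (V (k + N) x - W x) powr p" for k x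
  have u0: "0 \<le> u k x" for k x by (simp add: u_def)
  have [measurable]: "u k \<in> borel_measurable M" for k
    unfolding u_def by measurable
  have iu: "integrable M (u k)" for k
    using order.strict_trans[OF N[of "k + N"] ennreal_less_top] by (auto simp: u_def integrable_iff_bounded)
  have "(\<lambda>k. \<integral>\<^sup>+x. ennreal (u k x) \<partial>M) \<longlonglongrightarrow> 0"
    unfolding u_def by (rule LIMSEQ_ignore_initial_segment[OF V0])
  moreover have "(\<integral>\<^sup>+x. ennreal (u k x) \<partial>M) = ennreal (\<integral>x. norm (u k x) \<partial>M)" for k
    using nn_integral_eq_integral[OF iu[of k]] u0 by simp
  ultimately have "(\<lambda>k. ennreal (\<integral>x. norm (u k x) \<partial>M)) \<longlonglongrightarrow> ennreal 0"
    by simp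
  then have "(\<lambda>k. \<integral>x. norm (u k x) \<partial>M) \<longlonglongrightarrow> 0"
    by (rule tendsto_ennreal_iff[THEN iffD1, rotated 2]) auto
  from tendsto_L1_AE_subseq[OF iu this] obtain r :: "nat \<Rightarrow> nat"
    where r: "strict_mono r" "AE x in M. (\<lambda>n. u (r n) x) \<longlonglongrightarrow> 0" by blast
  have "AE x in M. (\<lambda>k. V (r k + N) x) \<longlonglongrightarrow> W x"
    using r(2)
  proof eventually_elim
    fix x assume "(\<lambda>n. u (r n) x) \<longlonglongrightarrow> 0"
    then have "(\<lambda>n. u (r n) x powr (1 / p)) \<longlonglongrightarrow> 0"
      using p by (intro tendsto_zero_powrI[where b="1 / p"]) (auto intro: tendsto_const simp: u_def)
    then have "(\<lambda>n. norm (V (r n + N) x - W x)) \<longlonglongrightarrow> 0"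
      using p by (simp add: u_def powr_powr)
    then show "(\<lambda>k. V (r k + N) x) \<longlonglongrightarrow> W x"
      using LIM_zero_cancel tendsto_norm_zero_iff by blast
  qed
  moreover have "strict_mono (\<lambda>k. r k + N)"
    using r(1) by (auto simp: strict_mono_def)
  ultimately show ?thesis by blast
qed

section \<open>Approximation by smooth functions\<close>

text \<open>\<open>C1c_integral_grad_eq_0\<close> for the function sending \<open>y\<close> to
  \<open>J (x - y) * \<Psi> y\<close> moves the derivative from the kernel to \<Psi>.\<close>

lemma mollify_C1c_has_derivative:
  assumes J: "mollifier \<epsilon> J" and \<Psi>: "C1c U \<Psi> D"
  shows "(mollify J \<Psi> has_derivative (\<lambda>h. mollify J D x \<bullet> h)) (at x)"
proof -
  obtain C where C: "compact C" "\<And>x. x \<notin> C \<Longrightarrow> \<Psi> x = 0" "\<And>x. x \<notin> C \<Longrightarrow> D x = 0"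
    using \<Psi> by (rule C1c_support) blast
  have i\<Psi>: "integrable lebesgue \<Psi>" and iD: "integrable lebesgue D"
    by (rule compact_support_integrable[OF C1cD(3)[OF \<Psi>] C(1,2)], assumption)
      (rule compact_support_integrable[OF C1cD(2)[OF \<Psi>] C(1,3)], assumption)
  have "C1c UNIV (\<lambda>y. J (x - y) * \<Psi> y) (\<lambda>y. J (x - y) *\<^sub>R D y - \<Psi> y *\<^sub>R grad J (x - y))"
  proof (rule C1cI[OF _ _ C(1)])
    fix y
    have "((\<lambda>y. J (x - y)) has_derivative (\<lambda>h. grad J (x - y) \<bullet> (- h))) (at y)"
      by (rule derivative_eq_intros has_derivative_compose[OF _ C1cD(1)[OF mollifierD(5)[OF J]]] refl | simp)+
    from has_derivative_mult[OF this C1cD(1)[OF \<Psi>]]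
    show "((\<lambda>y. J (x - y) * \<Psi> y) has_derivative (\<lambda>h. (J (x - y) *\<^sub>R D y - \<Psi> y *\<^sub>R grad J (x - y)) \<bullet> h)) (at y)"
      by (rule has_derivative_eq_rhs) (auto simp: inner_diff_left algebra_simps)
  next
    show "continuous_on UNIV (\<lambda>y. J (x - y) *\<^sub>R D y - \<Psi> y *\<^sub>R grad J (x - y))"
      by (intro continuous_intros C1cD[OF \<Psi>] continuous_on_compose2[OF mollifierD(6)[OF J]]
          continuous_on_compose2[OF C1cD(2)[OF mollifierD(5)[OF J]]]) auto
  qed (use C in auto)
  from C1c_integral_grad_eq_0[OF this]
  have "(\<integral>y. \<Psi> y *\<^sub>R grad J (x - y) \<partial>lebesgue) = mollify J D x"
    using C1c_mollify_integrable[OF mollifierD(5)[OF J] iD, of x] C1c_grad_integrable[OF mollifierD(5)[OF J] i\<Psi>, of x]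
    by (simp add: mollify_def)
  with mollify_has_derivative[OF mollifierD(5)[OF J] i\<Psi>, of x] show ?thesis by simp
qed

lemma compact_neighbourhood:
  fixes C :: "'a::euclidean_space set"
  assumes "compact C" "open U" "C \<subseteq> U"
  obtains \<delta> C' where "0 < \<delta>" "compact C'" "C' \<subseteq> U" "\<And>x. x \<in> C \<Longrightarrow> cball x \<delta> \<subseteq> C'"
proof -
  obtain d where d: "0 < d" "\<And>x y. x \<in> C \<Longrightarrow> y \<in> - U \<Longrightarrow> d \<le> dist x y"
    using separate_compact_closed[OF assms(1) closed_Compl[OF assms(2)]] assms(3) by blast
  define C' where "C' = {x + y | x y. x \<in> C \<and> y \<in> cball 0 (d / 2)}"
  show thesis
  proof (rule that[of "d / 2" C'])
    show "compact C'" unfolding C'_def by (intro compact_sums assms compact_cball)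
    show "C' \<subseteq> U"
    proof
      fix z assume "z \<in> C'"
      then obtain x y where z: "z = x + y" "x \<in> C" "norm y \<le> d / 2" by (auto simp: C'_def)
      then have "dist x z < d" using d(1) by (simp add: dist_norm)
      then show "z \<in> U" using d(2)[OF z(2), of z] by fastforce
    qed
    show "cball x (d / 2) \<subseteq> C'" if "x \<in> C" for x
    proof
      fix z assume "z \<in> cball x (d / 2)"
      then have "z = x + (z - x)" "z - x \<in> cball 0 (d / 2)" by (auto simp: dist_norm norm_minus_commute)
      then show "z \<in> C'" using that unfolding C'_def by blast
    qed
  qed (use d in auto)
qed

text \<open>All approximating test functions share the support set \<open>C'\<close>. The flux is
  only locally integrable, so uniform closeness of gradients is useful only with such a common
  compact set.\<close>

lemma C1c_dense:
  fixes U :: "(real^'n::finite) set"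
  assumes \<Psi>: "C1c U \<Psi> D" and U: "open U"
  obtains C' where "compact C'" "C' \<subseteq> U" "\<And>x. x \<notin> C' \<Longrightarrow> \<Psi> x = 0" "\<And>x. x \<notin> C' \<Longrightarrow> D x = 0"
    "\<And>e. 0 < e \<Longrightarrow> \<exists>\<phi>. test_function U \<phi> \<and> (\<forall>x. x \<notin> C' \<longrightarrow> \<phi> x = 0 \<and> grad \<phi> x = 0) \<and>
       (\<forall>x. \<bar>\<phi> x - \<Psi> x\<bar> \<le> e \<and> norm (grad \<phi> x - D x) \<le> e)"
proof -
  obtain C where C: "compact C" "C \<subseteq> U" "\<And>x. x \<notin> C \<Longrightarrow> \<Psi> x = 0" "\<And>x. x \<notin> C \<Longrightarrow> D x = 0"
    using \<Psi> by (rule C1c_support) blast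
  obtain \<delta> C' where \<delta>: "0 < \<delta>" and C': "compact C'" "C' \<subseteq> U" "\<And>x. x \<in> C \<Longrightarrow> cball x \<delta> \<subseteq> C'"
    by (rule compact_neighbourhood[OF C(1) U C(2)]) blast
  have sub: "C \<subseteq> C'" using C'(3) \<delta> by force
  have i\<Psi>: "integrable lebesgue \<Psi>"
    by (rule compact_support_integrable[OF C1cD(3)[OF \<Psi>] C(1,3)])
  have iD: "integrable lebesgue D"
    by (rule compact_support_integrable[OF C1cD(2)[OF \<Psi>] C(1,4)])
  have uc: "uniformly_continuous_on UNIV \<Psi>"
    by (rule compact_support_uniformly_continuous[OF C1cD(3)[OF \<Psi>] C(1,3)])
  have ucD: "uniformly_continuous_on UNIV D"
    by (rule compact_support_uniformly_continuous[OF C1cD(2)[OF \<Psi>] C(1,4)])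
  show thesis
  proof (rule that[OF C'(1,2)])
    fix e :: real assume e: "0 < e"
    obtain d1 where d1: "0 < d1" "\<And>x y. dist y x < d1 \<Longrightarrow> dist (\<Psi> y) (\<Psi> x) < e"
      using uc e unfolding uniformly_continuous_on_def by (metis UNIV_I)
    obtain d2 where d2: "0 < d2" "\<And>x y. dist y x < d2 \<Longrightarrow> dist (D y) (D x) < e"
      using ucD e unfolding uniformly_continuous_on_def by (metis UNIV_I)
    \<comment> \<open>Staying below \<delta> keeps the supports in \<open>C'\<close>; the other two
      terms stay strictly below the moduli of continuity of \<Psi> and \<open>D\<close>.\<close>
    define \<epsilon> where "\<epsilon> = min \<delta> (min (d1 / 2) (d2 / 2))"
    have \<epsilon>: "0 < \<epsilon>" "\<epsilon> \<le> \<delta>" "\<epsilon> < d1" "\<epsilon> < d2"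
      using \<delta> d1(1) d2(1) by (auto simp: \<epsilon>_def)
    obtain J :: "real^'n \<Rightarrow> real" where J: "mollifier \<epsilon> J"
      using ex_mollifier \<epsilon>(1) by blast
    have smooth: "smooth_on UNIV (mollify J \<Psi>)"
      by (rule smooth_mollify[OF mollifierD(1)[OF J] i\<Psi>])
    have zero: "mollify J \<Psi> x = 0" if "x \<notin> C'" for x
    proof -
      have "\<Psi> y = 0" if y: "y \<in> cball x \<epsilon>" for y
      proof (rule C(3), rule notI)
        assume "y \<in> C"
        then have "x \<in> C'" using C'(3)[of y] y \<epsilon>(2) by (auto simp: dist_commute)
        with \<open>x \<notin> C'\<close> show False by simp
      qed
      then have "mollify J \<Psi> x = mollify J (\<lambda>_. 0 :: real) x"
        by (intro mollify_local[OF J]) auto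
      then show ?thesis by (simp add: mollify_def)
    qed
    have test: "test_function U (mollify J \<Psi>)"
      by (rule test_functionI[OF smooth C'(1,2) zero])
    have grad: "grad (mollify J \<Psi>) x = mollify J D x" for x
      by (rule grad_eqI[OF mollify_C1c_has_derivative[OF J \<Psi>]])
    have c1: "C1c U (mollify J \<Psi>) (grad (mollify J \<Psi>))"
      by (rule C1cI[OF C1cD(1,2)[OF test_function_C1c[OF test]] C'(1,2) zero])
    have "grad (mollify J \<Psi>) x = 0" if "x \<notin> C'" for x
    proof -
      have "D y = 0" if y: "y \<in> cball x \<epsilon>" for y
      proof (rule C(4), rule notI)
        assume "y \<in> C"
        then have "x \<in> C'" using C'(3)[of y] y \<epsilon>(2) by (auto simp: dist_commute)
        with \<open>x \<notin> C'\<close> show False by simp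
      qed
      then have "mollify J D x = mollify J (\<lambda>_. 0 :: real^'n) x"
        by (intro mollify_local[OF J]) auto
      then show ?thesis by (simp add: grad) (simp add: mollify_def)
    qed
    moreover have "norm (mollify J \<Psi> x - \<Psi> x) \<le> e" for x
    proof (rule mollify_dist_le[OF J i\<Psi>])
      fix y assume "y \<in> cball x \<epsilon>"
      then have "dist y x < d1" using \<epsilon>(3) by (simp add: dist_commute)
      from d1(2)[OF this] show "norm (\<Psi> y - \<Psi> x) \<le> e" by (simp add: dist_norm)
    qed
    moreover have "norm (grad (mollify J \<Psi>) x - D x) \<le> e" for x
      unfolding grad
    proof (rule mollify_dist_le[OF J iD])
      fix y assume "y \<in> cball x \<epsilon>"
      then have "dist y x < d2" using \<epsilon>(4) by (simp add: dist_commute)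
      from d2(2)[OF this] show "norm (D y - D x) \<le> e" by (simp add: dist_norm)
    qed
    ultimately show "\<exists>\<phi>. test_function U \<phi> \<and> (\<forall>x. x \<notin> C' \<longrightarrow> \<phi> x = 0 \<and> grad \<phi> x = 0) \<and>
       (\<forall>x. \<bar>\<phi> x - \<Psi> x\<bar> \<le> e \<and> norm (grad \<phi> x - D x) \<le> e)"
      using test zero by (intro exI[of _ "mollify J \<Psi>"]) auto
  qed (use C sub in auto)
qed

text \<open>When the ball lies in \<open>U\<close>, the reflected kernel \<open>J (x - y)\<close>,
  as a function of \<open>y\<close>, is an admissible test function in the definition of the weak
  gradient. It sees \<open>g\<close> and \<open>H\<close> only on that ball.\<close>

lemma mollify_weak_gradient:
  fixes U :: "(real^'n::finite) set"
  assumes w: "has_weak_gradient U E G" and J: "mollifier \<epsilon> J" and sub: "cball x \<epsilon> \<subseteq> U"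
    and g: "integrable lebesgue g" "\<And>y. y \<in> cball x \<epsilon> \<Longrightarrow> g y = E y"
    and H: "\<And>y. y \<in> cball x \<epsilon> \<Longrightarrow> H y = G y"
  shows "(mollify J g has_derivative (\<lambda>h. mollify J H x \<bullet> h)) (at x)"
proof -
  define \<phi> where "\<phi> = (\<lambda>y. J (x - y))"
  have "smooth_on UNIV (\<lambda>y. 1 * J (x + (- 1) *\<^sub>R y))"
    using mollifierD(1)[OF J] by (intro smooth_affine) (simp add: test_function_def)
  then have smooth: "smooth_on UNIV \<phi>" by (simp add: \<phi>_def)
  have zero: "\<phi> y = 0" if "y \<notin> cball x \<epsilon>" for y
    using that mollifierD(3)[OF J, of "x - y"] by (auto simp: \<phi>_def dist_norm)
  have test: "test_function U \<phi>"
    by (rule test_functionI[OF smooth compact_cball sub zero])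
  have grad: "grad \<phi> y = - grad J (x - y)" for y
  proof (rule grad_eqI)
    have "(\<phi> has_derivative (\<lambda>h. grad J (x - y) \<bullet> (- h))) (at y)"
      unfolding \<phi>_def
      by (rule derivative_eq_intros has_derivative_compose[OF _ C1cD(1)[OF mollifierD(5)[OF J]]] refl | simp)+
    then show "(\<phi> has_derivative (\<lambda>h. - grad J (x - y) \<bullet> h)) (at y)" by simp
  qed
  have "C1c U \<phi> (grad \<phi>)"
    by (rule test_function_C1c[OF test])
  have gz: "grad \<phi> y = 0" if "y \<notin> cball x \<epsilon>" for y
  proof -
    have "(\<phi> has_derivative (\<lambda>h. 0)) (at y)"
      by (rule has_derivative_transform_within_open[where s="- cball x \<epsilon>" and f="\<lambda>_. 0"]) (use zero that in auto)
    then show ?thesis using grad_eqI[of \<phi> 0 y] by simp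
  qed
  have "indicator U y *\<^sub>R (E y *\<^sub>R grad \<phi> y) = - (g y *\<^sub>R grad J (x - y))" for y
    using gz[of y] g(2)[of y] sub by (cases "y \<in> cball x \<epsilon>") (auto simp: grad indicator_def)
  moreover have "indicator U y *\<^sub>R (\<phi> y *\<^sub>R G y) = J (x - y) *\<^sub>R H y" for y
    using zero[of y] H[of y] sub by (cases "y \<in> cball x \<epsilon>") (auto simp: \<phi>_def indicator_def)
  moreover have "set_lebesgue_integral lebesgue U (\<lambda>x. E x *\<^sub>R grad \<phi> x) =
        - set_lebesgue_integral lebesgue U (\<lambda>x. \<phi> x *\<^sub>R G x)"
    using w test by (simp add: has_weak_gradient_def)
  ultimately have "(\<integral>y. g y *\<^sub>R grad J (x - y) \<partial>lebesgue) = mollify J H x"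
    by (simp add: set_lebesgue_integral_def mollify_def)
  with mollify_has_derivative[OF mollifierD(5)[OF J] g(1), of x] show ?thesis by simp
qed

section \<open>Local Lp classes expressed through restricted measures\<close>

lemma in_Lp_iff:
  fixes f :: "real^'n::finite \<Rightarrow> 'b::euclidean_space"
  assumes "S \<in> sets lebesgue"
  shows "in_Lp p S f \<longleftrightarrow> f \<in> borel_measurable (lebesgue_on S) \<and>
     (Lp_int (lebesgue_on S) p f) < \<infinity>"
  using assms unfolding in_Lp_def set_borel_measurable_def
  by (simp add: borel_measurable_restrict_space_iff nn_integral_restrict_space)

lemma in_Lp_indicator:
  fixes f :: "real^'n::finite \<Rightarrow> 'b::euclidean_space"
  assumes "in_Lp p S f" "0 < p"
  shows "(\<lambda>x. indicator S x *\<^sub>R f x) \<in> borel_measurable lebesgue"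
    "Lp_int lebesgue p (\<lambda>x. indicator S x *\<^sub>R f x) < \<infinity>"
proof -
  have "ennreal (norm (indicator S x *\<^sub>R f x) powr p) = ennreal (norm (f x) powr p) * indicator S x" for x
    using assms(2) by (auto simp: indicator_def)
  then show "(\<lambda>x. indicator S x *\<^sub>R f x) \<in> borel_measurable lebesgue"
    "Lp_int lebesgue p (\<lambda>x. indicator S x *\<^sub>R f x) < \<infinity>"
    using assms(1) by (auto simp: in_Lp_def set_borel_measurable_def)
qed

lemma in_Lp_1_integrable:
  fixes f :: "real^'n::finite \<Rightarrow> 'b::euclidean_space"
  assumes "in_Lp 1 S f"
  shows "integrable lebesgue (\<lambda>x. indicator S x *\<^sub>R f x)"
  using in_Lp_indicator[OF assms] by (simp add: integrable_iff_bounded)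

lemma Lp_tendsto_lebesgue_on:
  fixes V :: "nat \<Rightarrow> real^'n::finite \<Rightarrow> 'b::euclidean_space"
  assumes V: "Lp_tendsto lebesgue p V W" and C: "C \<in> sets lebesgue"
    and V': "\<And>k x. x \<in> C \<Longrightarrow> V' k x = V k x" "\<And>x. x \<in> C \<Longrightarrow> W' x = W x"
  shows "Lp_tendsto (lebesgue_on C) p V' W'"
proof -
  have "V' k \<in> borel_measurable (lebesgue_on C)" for k
    using V V'(1) by (subst measurable_cong[where g="V k"])
      (auto simp: Lp_tendsto_def space_restrict_space intro: measurable_restrict_space1)
  moreover have "W' \<in> borel_measurable (lebesgue_on C)"
    using V V'(2) by (subst measurable_cong[where g="W"])
      (auto simp: Lp_tendsto_def space_restrict_space intro: measurable_restrict_space1)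
  moreover have "Lp_int (lebesgue_on C) p (\<lambda>x. V' k x - W' x) \<le>
      (Lp_int lebesgue p (\<lambda>x. V k x - W x))" for k
    using C V' by (subst nn_integral_restrict_space) (auto intro!: nn_integral_mono simp: indicator_def)
  ultimately show ?thesis
    using V unfolding Lp_tendsto_def by (blast intro: ennreal_tendsto_0_le)
qed

text \<open>Only the values of \<open>g\<close> on \<open>C1\<close> are tied to \<open>E\<close>. The freedom elsewhere is used to keep the
  approximants above or below a given level where \<open>E\<close> itself is not controlled.\<close>

lemma sobolev_approximation:
  fixes U :: "(real^'n::finite) set"
  assumes w: "has_weak_gradient U E G" and p: "1 < p"
    and C1: "compact C1" "C1 \<subseteq> U" "in_Lp p C1 G"
    and g: "integrable lebesgue g" "Lp_int lebesgue p g < \<infinity>"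
      "bounded B" "\<And>x. x \<notin> B \<Longrightarrow> g x = 0" "\<And>x. x \<in> C1 \<Longrightarrow> g x = E x"
    and C: "C \<in> sets lebesgue" "0 < \<rho>" "\<And>x. x \<in> C \<Longrightarrow> cball x \<rho> \<subseteq> C1"
  obtains e De where "\<And>k x. ((e k :: real^'n \<Rightarrow> real) has_derivative (\<lambda>h. De k x \<bullet> h)) (at x)"
    "\<And>k :: nat. continuous_on UNIV (De k)"
    "Lp_tendsto (lebesgue_on C) p De G"
    "AE x in lebesgue. (\<lambda>k. e k x) \<longlonglongrightarrow> g x"
    "\<And>k x b. (\<And>y. y \<in> cball x \<rho> \<Longrightarrow> g y \<le> b) \<Longrightarrow> e k x \<le> b"
    "\<And>k x b. (\<And>y. y \<in> cball x \<rho> \<Longrightarrow> b \<le> g y) \<Longrightarrow> b \<le> e k x"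
proof -
  \<comment> \<open>All radii are at most \<rho>, so averages at points of \<open>C\<close> use
    values on \<open>C1\<close> only.\<close>
  define \<epsilon> where "\<epsilon> k = \<rho> / real (Suc k)" for k
  have \<epsilon>: "0 < \<epsilon> k" "\<epsilon> k \<le> \<rho>" for k
    using C(2) by (auto simp: \<epsilon>_def field_simps)
  have \<epsilon>0: "\<epsilon> \<longlonglongrightarrow> 0"
    unfolding \<epsilon>_def by (intro LIMSEQ_Suc[OF lim_const_over_n])
  have "\<exists>J :: real^'n \<Rightarrow> real. mollifier (\<epsilon> k) J" for k
    using ex_mollifier \<epsilon>(1) by blast
  then obtain J :: "nat \<Rightarrow> real^'n \<Rightarrow> real" where J: "\<And>k. mollifier (\<epsilon> k) (J k)" by metis
  define H where "H = (\<lambda>x. indicator C1 x *\<^sub>R G x)"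
  have "in_Lp 1 C1 G"
    using w C1 by (auto simp: has_weak_gradient_def in_Lp_loc_def)
  then have iH: "integrable lebesgue H"
    unfolding H_def by (rule in_Lp_1_integrable)
  have HLp: "Lp_int lebesgue p H < \<infinity>"
    unfolding H_def using p by (intro in_Lp_indicator C1) auto
  have LH: "Lp_tendsto lebesgue p (\<lambda>k. mollify (J k) H) H"
    by (rule mollify_Lp_tendsto[OF J \<epsilon>0 p iH HLp compact_imp_bounded[OF C1(1)]]) (simp add: H_def)
  have Lg: "Lp_tendsto lebesgue p (\<lambda>k. mollify (J k) g) g"
    by (rule mollify_Lp_tendsto[OF J \<epsilon>0 p g(1-4)])
  \<comment> \<open>Only convergence almost everywhere forces a subsequence; the gradients converge
    along the whole sequence.\<close>
  obtain r where r: "strict_mono r" "AE x in lebesgue. (\<lambda>k. mollify (J (r k)) g x) \<longlonglongrightarrow> g x"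
    using Lp_tendsto_AE_subseq[OF Lg] p by auto
  have smooth: "smooth_on UNIV (mollify (J k) g)" for k
    by (rule smooth_mollify[OF mollifierD(1)[OF J] g(1)])
  have grad: "grad (mollify (J k) g) x = mollify (J k) H x" if "x \<in> C" for k x
  proof (rule grad_eqI, rule mollify_weak_gradient[OF w J _ g(1)])
    have sub: "cball x (\<epsilon> k) \<subseteq> C1" using C(3)[OF that] \<epsilon>(2)[of k] by auto
    then show "cball x (\<epsilon> k) \<subseteq> U" using C1(2) by simp
    show "g y = E y" "H y = G y" if "y \<in> cball x (\<epsilon> k)" for y
      using that sub g(5) by (auto simp: H_def)
  qed
  show thesis
  proof (rule that[of "\<lambda>k. mollify (J (r k)) g" "\<lambda>k. grad (mollify (J (r k)) g)"])
    show "(mollify (J (r k)) g has_derivative (\<bullet>) (grad (mollify (J (r k)) g) x)) (at x)" for k x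
      using smooth by (intro smooth_has_derivative) auto
    show "continuous_on UNIV (grad (mollify (J (r k)) g))" for k
      by (rule smooth_continuous_grad[OF smooth])
    show "Lp_tendsto (lebesgue_on C) p (\<lambda>k. grad (mollify (J (r k)) g)) G"
    proof (rule Lp_tendsto_lebesgue_on[OF Lp_tendsto_subseq[OF LH r(1)] C(1)])
      show "grad (mollify (J (r k)) g) x = mollify (J (r k)) H x" if "x \<in> C" for k x
        using grad[OF that] .
      show "G x = H x" if "x \<in> C" for x
      proof -
        have "x \<in> cball x \<rho>" using C(2) by simp
        then have "x \<in> C1" using C(3)[OF that] by blast
        then show ?thesis by (simp add: H_def)
      qed
    qed
    show "AE x in lebesgue. (\<lambda>k. mollify (J (r k)) g x) \<longlonglongrightarrow> g x" by (rule r(2))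
    show "mollify (J (r k)) g x \<le> b" if "\<And>y. y \<in> cball x \<rho> \<Longrightarrow> g y \<le> b" for k x b
      by (rule mollify_le[OF J g(1)]) (use that \<epsilon>(2)[of "r k"] in auto)
    show "b \<le> mollify (J (r k)) g x" if "\<And>y. y \<in> cball x \<rho> \<Longrightarrow> b \<le> g y" for k x b
      by (rule mollify_ge[OF J g(1)]) (use that \<epsilon>(2)[of "r k"] in auto)
  qed
qed

section \<open>The quadratic form\<close>

lemma norm_A_scaleR: "norm_A M (c *\<^sub>R \<xi>) = \<bar>c\<bar> * norm_A M \<xi>"
proof -
  have "(M *v (c *\<^sub>R \<xi>)) \<bullet> (c *\<^sub>R \<xi>) = c\<^sup>2 * ((M *v \<xi>) \<bullet> \<xi>)"
    by (simp add: matrix_vector_mult_scaleR power2_eq_square)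
  then show ?thesis by (simp add: norm_A_def real_sqrt_mult)
qed

lemma norm_A_zero [simp]: "norm_A M 0 = 0"
  by (simp add: norm_A_def)

lemma norm_A_nonneg:
  assumes "\<And>\<xi>. 0 \<le> (M *v \<xi>) \<bullet> \<xi>"
  shows "0 \<le> norm_A M \<xi>" "(norm_A M \<xi>)\<^sup>2 = (M *v \<xi>) \<bullet> \<xi>"
  using assms by (auto simp: norm_A_def)

text \<open>The discriminant of the nonnegative quadratic polynomial in \<open>q\<close>. The form
  is merely semidefinite here, so its leading coefficient \<open>c\<close> may vanish, and then
  \<open>b\<close> must vanish too.\<close>

lemma norm_A_Cauchy_Schwarz:
  fixes M :: "real^'n::finite^'n"
  assumes sym: "transpose M = M" and psd: "\<And>\<xi>. 0 \<le> (M *v \<xi>) \<bullet> \<xi>"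
  shows "\<bar>(M *v \<xi>) \<bullet> \<eta>\<bar> \<le> norm_A M \<xi> * norm_A M \<eta>"
proof -
  define a where "a = (M *v \<xi>) \<bullet> \<xi>"
  define b where "b = (M *v \<xi>) \<bullet> \<eta>"
  define c where "c = (M *v \<eta>) \<bullet> \<eta>"
  have b': "(M *v \<eta>) \<bullet> \<xi> = b"
    using sym by (metis b_def dot_lmul_matrix inner_commute vector_transpose_matrix transpose_matrix_vector)
  have q: "0 \<le> a + 2 * b * t + c * t\<^sup>2" for t
    using psd[of "\<xi> + t *\<^sub>R \<eta>"] b'
    by (simp add: a_def[symmetric] b_def[symmetric] c_def[symmetric] matrix_vector_right_distrib matrix_vector_mult_scaleR
        inner_add_left inner_add_right power2_eq_square algebra_simps)
  have ac: "0 \<le> a" "0 \<le> c" using psd by (auto simp: a_def c_def)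
  have "b\<^sup>2 \<le> a * c"
  proof (cases "c = 0")
    case True
    have "b = 0"
    proof (rule ccontr)
      assume "b \<noteq> 0"
      \<comment> \<open>At this point the polynomial, now linear, takes the value -1.\<close>
      then show False using q[of "- (a + 1) / (2 * b)"] True by (simp add: field_simps)
    qed
    then show ?thesis using ac by simp
  next
    case False
    then have "0 \<le> a - b\<^sup>2 / c"
      using q[of "- b / c"] by (simp add: power2_eq_square field_simps)
    then show ?thesis using False ac by (simp add: field_simps)
  qed
  then have "sqrt (b\<^sup>2) \<le> sqrt (a * c)" by (rule real_sqrt_le_mono)
  then show ?thesis
    by (simp add: norm_A_def a_def b_def c_def real_sqrt_mult)
qed

lemma norm_A_triangle:
  fixes M :: "real^'n::finite^'n"
  assumes sym: "transpose M = M" and psd: "\<And>\<xi>. 0 \<le> (M *v \<xi>) \<bullet> \<xi>"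
  shows "norm_A M (\<xi> + \<eta>) \<le> norm_A M \<xi> + norm_A M \<eta>"
proof (rule power2_le_imp_le)
  have "(M *v \<eta>) \<bullet> \<xi> = (M *v \<xi>) \<bullet> \<eta>"
    using sym by (metis dot_lmul_matrix inner_commute vector_transpose_matrix transpose_matrix_vector)
  then have "(norm_A M (\<xi> + \<eta>))\<^sup>2 = (norm_A M \<xi>)\<^sup>2 + 2 * ((M *v \<xi>) \<bullet> \<eta>) + (norm_A M \<eta>)\<^sup>2"
    using norm_A_nonneg(2)[OF psd] by (simp add: matrix_vector_right_distrib inner_add_left inner_add_right)
  also have "\<dots> \<le> (norm_A M \<xi> + norm_A M \<eta>)\<^sup>2"
    using norm_A_Cauchy_Schwarz[OF sym psd, of \<xi> \<eta>] by (simp add: power2_sum)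
  finally show "(norm_A M (\<xi> + \<eta>))\<^sup>2 \<le> (norm_A M \<xi> + norm_A M \<eta>)\<^sup>2" .
  show "0 \<le> norm_A M \<xi> + norm_A M \<eta>"
    using norm_A_nonneg(1)[OF psd] by (simp add: add_nonneg_nonneg)
qed

lemma norm_matrix_vector_le:
  fixes M :: "real^'n::finite^'n"
  assumes "\<And>i j. \<bar>M $ i $ j\<bar> \<le> B"
  shows "norm (M *v \<xi>) \<le> real CARD('n) * (real CARD('n) * B) * norm \<xi>"
proof -
  have B: "0 \<le> B" using assms by (meson abs_ge_zero order_trans)
  have "\<bar>(M *v \<xi>) $ i\<bar> \<le> real CARD('n) * B * norm \<xi>" for i
  proof -
    have "\<bar>(M *v \<xi>) $ i\<bar> \<le> (\<Sum>j\<in>UNIV. \<bar>M $ i $ j * \<xi> $ j\<bar>)"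
      unfolding matrix_vector_mult_def by (simp add: sum_abs)
    also have "\<dots> \<le> (\<Sum>j\<in>(UNIV::'n set). B * norm \<xi>)"
      unfolding abs_mult using B by (intro sum_mono mult_mono assms component_le_norm_cart) auto
    finally show ?thesis by simp
  qed
  then have "(\<Sum>i\<in>UNIV. \<bar>(M *v \<xi>) $ i\<bar>) \<le> (\<Sum>i\<in>(UNIV::'n set). real CARD('n) * B * norm \<xi>)"
    by (intro sum_mono)
  then show ?thesis
    using norm_le_l1_cart[of "M *v \<xi>"] by simp
qed

text \<open>The entries of \<open>A\<close> are restrictions to \<Omega> of continuous functions on
  its compact closure, hence bounded.\<close>

lemma admissible_matrix_bounded:
  assumes A: "admissible_matrix \<Omega> A" and \<Omega>: "bounded \<Omega>"
  obtains \<Lambda> where "0 < \<Lambda>" "\<And>x \<xi>. x \<in> \<Omega> \<Longrightarrow> norm (A x *v \<xi>) \<le> \<Lambda> * norm \<xi>"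
proof -
  have "\<exists>B. \<forall>x\<in>\<Omega>. \<bar>A x $ i $ j\<bar> \<le> B" for i j
  proof -
    have "\<exists>g. continuous_on (closure \<Omega>) g \<and> (\<forall>x\<in>\<Omega>. g x = partials [] (\<lambda>x. A x $ i $ j) x)"
      using A unfolding admissible_matrix_def smooth_up_to_boundary_def by blast
    then obtain g where g: "continuous_on (closure \<Omega>) g" "\<And>x. x \<in> \<Omega> \<Longrightarrow> g x = A x $ i $ j"
      by auto
    have "compact (g ` closure \<Omega>)"
      using g(1) \<Omega> by (intro compact_continuous_image) auto
    then obtain B where "\<And>x. x \<in> closure \<Omega> \<Longrightarrow> \<bar>g x\<bar> \<le> B"
      by (force dest: compact_imp_bounded simp: bounded_iff)
    then show ?thesis using g(2) closure_subset[of \<Omega>] by (metis subsetD)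
  qed
  then obtain B where B: "\<And>i j x. x \<in> \<Omega> \<Longrightarrow> \<bar>A x $ i $ j\<bar> \<le> B i j" by metis
  define B' where "B' = (\<Sum>i\<in>UNIV. \<Sum>j\<in>UNIV. \<bar>B i j\<bar>)"
  have B': "\<bar>A x $ i $ j\<bar> \<le> B'" if "x \<in> \<Omega>" for i j x
  proof -
    have "\<bar>A x $ i $ j\<bar> \<le> \<bar>B i j\<bar>" using B[OF that, of i j] by linarith
    also have "\<dots> \<le> (\<Sum>j\<in>UNIV. \<bar>B i j\<bar>)" by (intro member_le_sum) auto
    also have "\<dots> \<le> B'" unfolding B'_def by (rule member_le_sum) (auto intro: sum_nonneg)
    finally show ?thesis .
  qed
  define \<Lambda> where "\<Lambda> = real CARD('a) * (real CARD('a) * B') + 1"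
  have "0 \<le> B'" unfolding B'_def by (intro sum_nonneg) auto
  then have "0 < \<Lambda>" unfolding \<Lambda>_def by (intro add_nonneg_pos mult_nonneg_nonneg) auto
  moreover have "norm (A x *v \<xi>) \<le> \<Lambda> * norm \<xi>" if "x \<in> \<Omega>" for x \<xi>
  proof -
    have "norm (A x *v \<xi>) \<le> real CARD('a) * (real CARD('a) * B') * norm \<xi>"
      by (rule norm_matrix_vector_le[OF B'[OF that]])
    also have "\<dots> \<le> \<Lambda> * norm \<xi>" unfolding \<Lambda>_def by (intro mult_right_mono) auto
    finally show ?thesis .
  qed
  ultimately show thesis by (rule that)
qed

lemma admissible_matrix_continuous:
  assumes "admissible_matrix \<Omega> A"
  shows "continuous_on \<Omega> (\<lambda>x. A x $ i $ j)"
  using assms by (auto simp: admissible_matrix_def smooth_up_to_boundary_def intro: smooth_continuous_on)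

lemma admissible_matrix_measurable:
  fixes V :: "real^'n::finite \<Rightarrow> real^'n"
  assumes A: "admissible_matrix \<Omega> A" and S: "S \<in> sets lebesgue" "S \<subseteq> \<Omega>" and V: "V \<in> borel_measurable (lebesgue_on S)"
  shows "(\<lambda>x. A x *v V x) \<in> borel_measurable (lebesgue_on S)"
    "(\<lambda>x. norm_A (A x) (V x)) \<in> borel_measurable (lebesgue_on S)"
proof -
  have [measurable]: "(\<lambda>x. A x $ i $ j) \<in> borel_measurable (lebesgue_on S)" for i j
    using admissible_matrix_continuous[OF A] S by (intro continuous_imp_measurable_on_sets_lebesgue) (auto intro: continuous_on_subset)
  have [measurable]: "(\<lambda>x. V x $ j) \<in> borel_measurable (lebesgue_on S)" for j
    using measurable_compose[OF V borel_measurable_continuous_onI[OF continuous_on_component[OF continuous_on_id]]] by simp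
  have "(\<lambda>x. (A x *v V x) \<bullet> axis i 1) \<in> borel_measurable (lebesgue_on S)" for i
    by (simp add: inner_axis matrix_vector_mult_def)
  then show m[measurable]: "(\<lambda>x. A x *v V x) \<in> borel_measurable (lebesgue_on S)"
    by (subst borel_measurable_euclidean_space) (auto simp: Basis_vec_def)
  show "(\<lambda>x. norm_A (A x) (V x)) \<in> borel_measurable (lebesgue_on S)"
    unfolding norm_A_def using V by measurable
qed

text \<open>The box dimension is represented here only by \<open>K\<close> being a Lebesgue null
  set. Optimality is proved at this level; the volume decay needed for the inequality itself is
  added in \<open>p_potential_null_capacity\<close>.\<close>

locale p_potential =
  fixes \<Omega> K :: "(real^'n::finite) set" and A :: "real^'n \<Rightarrow> real^'n^'n" and p :: real
    and \<mu> :: "(real^'n) measure" and E :: "real^'n \<Rightarrow> real" and G :: "real^'n \<Rightarrow> real^'n"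
  assumes \<Omega>: "open \<Omega>" "bounded \<Omega>"
    and A: "admissible_matrix \<Omega> A"
    and p: "1 < p"
    and K: "compact K" "K \<subseteq> \<Omega>" "K \<in> null_sets lebesgue"
    and mu: "sets \<mu> = sets borel" "finite_measure \<mu>"
    and supp: "emeasure \<mu> (- K) = 0"
    and E_pos: "\<And>x. x \<in> \<Omega> - K \<Longrightarrow> 0 < E x"
    and E_sol: "solves_measure_equation p A \<Omega> K \<mu> E G"
begin

section \<open>Pointwise bounds for the quadratic form and the flux\<close>

lemma psd: "x \<in> \<Omega> \<Longrightarrow> 0 \<le> (A x *v \<xi>) \<bullet> \<xi>"
proof -
  assume x: "x \<in> \<Omega>"
  obtain \<theta> where "0 < \<theta>" "(A x *v \<xi>) \<bullet> \<xi> \<ge> \<theta> * (norm \<xi>)\<^sup>2"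
    using A x unfolding admissible_matrix_def by blast
  then show ?thesis by (meson less_imp_le mult_nonneg_nonneg order_trans zero_le_power2)
qed

lemma sym: "x \<in> \<Omega> \<Longrightarrow> transpose (A x) = A x"
  using A by (auto simp: admissible_matrix_def)

lemma nA_nonneg: "x \<in> \<Omega> \<Longrightarrow> 0 \<le> norm_A (A x) \<xi>"
  by (intro norm_A_nonneg psd)

lemma nA_sq: "x \<in> \<Omega> \<Longrightarrow> (norm_A (A x) \<xi>)\<^sup>2 = (A x *v \<xi>) \<bullet> \<xi>"
  by (intro norm_A_nonneg psd)

lemma nA_CS: "x \<in> \<Omega> \<Longrightarrow> \<bar>(A x *v \<xi>) \<bullet> \<eta>\<bar> \<le> norm_A (A x) \<xi> * norm_A (A x) \<eta>"
  by (intro norm_A_Cauchy_Schwarz sym psd)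

lemma nA_triangle: "x \<in> \<Omega> \<Longrightarrow> norm_A (A x) (\<xi> + \<eta>) \<le> norm_A (A x) \<xi> + norm_A (A x) \<eta>"
  by (intro norm_A_triangle sym psd)

text \<open>One upper bound for \<open>A\<close> on \<Omega>, fixed by choice so that later
  constants can refer to it.\<close>

definition \<Lambda> :: real where
  "\<Lambda> = (SOME \<Lambda>. 0 < \<Lambda> \<and> (\<forall>x\<in>\<Omega>. \<forall>\<xi>. norm (A x *v \<xi>) \<le> \<Lambda> * norm \<xi>))"

lemma \<Lambda>: "0 < \<Lambda>" "x \<in> \<Omega> \<Longrightarrow> norm (A x *v \<xi>) \<le> \<Lambda> * norm \<xi>"
proof -
  have "0 < \<Lambda> \<and> (\<forall>x\<in>\<Omega>. \<forall>\<xi>. norm (A x *v \<xi>) \<le> \<Lambda> * norm \<xi>)"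
    unfolding \<Lambda>_def by (rule someI_ex) (use admissible_matrix_bounded[OF A \<Omega>(2)] in metis)
  then show "0 < \<Lambda>" "x \<in> \<Omega> \<Longrightarrow> norm (A x *v \<xi>) \<le> \<Lambda> * norm \<xi>" by auto
qed

lemma nA_le: "x \<in> \<Omega> \<Longrightarrow> norm_A (A x) \<xi> \<le> sqrt \<Lambda> * norm \<xi>"
proof -
  assume x: "x \<in> \<Omega>"
  have "(A x *v \<xi>) \<bullet> \<xi> \<le> norm (A x *v \<xi>) * norm \<xi>" by (rule norm_cauchy_schwarz)
  also have "\<dots> \<le> \<Lambda> * norm \<xi> * norm \<xi>" by (intro mult_right_mono \<Lambda> x) auto
  finally have "norm_A (A x) \<xi> \<le> sqrt (\<Lambda> * norm \<xi> * norm \<xi>)"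
    unfolding norm_A_def by (rule real_sqrt_le_mono)
  also have "sqrt (\<Lambda> * norm \<xi> * norm \<xi>) = sqrt \<Lambda> * norm \<xi>"
    by (simp add: real_sqrt_mult mult.assoc)
  finally show ?thesis .
qed

text \<open>Cauchy-Schwarz for the form, with \<open>A x *v \<xi>\<close> itself as the second
  argument; one factor \<open>norm ?v\<close> then cancels.\<close>

lemma norm_A_mult_le: "x \<in> \<Omega> \<Longrightarrow> norm (A x *v \<xi>) \<le> sqrt \<Lambda> * norm_A (A x) \<xi>"
proof -
  assume x: "x \<in> \<Omega>"
  let ?v = "A x *v \<xi>"
  have "norm ?v * norm ?v \<le> norm_A (A x) \<xi> * norm_A (A x) ?v"
    using nA_CS[OF x, of \<xi> ?v] by (simp add: power2_norm_eq_inner flip: power2_eq_square)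
  also have "\<dots> \<le> norm_A (A x) \<xi> * (sqrt \<Lambda> * norm ?v)"
    by (intro mult_left_mono nA_le nA_nonneg x)
  finally have "norm ?v * norm ?v \<le> (sqrt \<Lambda> * norm_A (A x) \<xi>) * norm ?v" by (simp add: mult_ac)
  then show ?thesis
    using nA_nonneg[OF x, of \<xi>] \<Lambda>(1) by (cases "norm ?v = 0") (auto simp: mult_le_cancel_right)
qed

lemma flux_inner_le: "x \<in> \<Omega> \<Longrightarrow> \<bar>flux p A V x \<bullet> \<xi>\<bar> \<le> norm_A (A x) (V x) powr (p - 1) * norm_A (A x) \<xi>"
proof -
  assume x: "x \<in> \<Omega>"
  have "\<bar>flux p A V x \<bullet> \<xi>\<bar> = norm_A (A x) (V x) powr (p - 2) * \<bar>(A x *v V x) \<bullet> \<xi>\<bar>"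
    by (simp add: flux_def abs_mult)
  also have "\<dots> \<le> norm_A (A x) (V x) powr (p - 2) * (norm_A (A x) (V x) * norm_A (A x) \<xi>)"
    by (intro mult_left_mono nA_CS x) auto
  \<comment> \<open>If the norm of \<open>V x\<close> vanishes, both sides are 0 by the convention
    \<open>0 powr (p - 2) = 0\<close>, also for \<open>p < 2\<close>.\<close>
  also have "\<dots> = norm_A (A x) (V x) powr (p - 1) * norm_A (A x) \<xi>"
    using nA_nonneg[OF x, of "V x"] powr_add[of "norm_A (A x) (V x)" "p - 2" 1]
    by (cases "norm_A (A x) (V x) = 0") auto
  finally show ?thesis .
qed

lemma flux_inner_self: "x \<in> \<Omega> \<Longrightarrow> flux p A V x \<bullet> V x = norm_A (A x) (V x) powr p"
  using nA_nonneg[of x "V x"] nA_sq[of x "V x"] powr_add[of "norm_A (A x) (V x)" "p - 2" 2]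
  by (cases "norm_A (A x) (V x) = 0") (auto simp: flux_def)

lemma norm_flux_le: "x \<in> \<Omega> \<Longrightarrow> norm (flux p A V x) \<le> sqrt \<Lambda> * norm_A (A x) (V x) powr (p - 1)"
proof -
  assume x: "x \<in> \<Omega>"
  have "norm (flux p A V x) \<le> norm_A (A x) (V x) powr (p - 2) * (sqrt \<Lambda> * norm_A (A x) (V x))"
    unfolding flux_def norm_scaleR using norm_A_mult_le[OF x, of "V x"] by (intro mult_mono) auto
  also have "\<dots> = sqrt \<Lambda> * norm_A (A x) (V x) powr (p - 1)"
    using nA_nonneg[OF x, of "V x"] powr_add[of "norm_A (A x) (V x)" "p - 2" 1]
    by (cases "norm_A (A x) (V x) = 0") auto
  finally show ?thesis .
qed

lemma flux_measurable:
  assumes "S \<in> sets lebesgue" "S \<subseteq> \<Omega>" "V \<in> borel_measurable (lebesgue_on S)"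
  shows "flux p A V \<in> borel_measurable (lebesgue_on S)"
  using admissible_matrix_measurable[OF A assms] unfolding flux_def by measurable

lemma open_U: "open (\<Omega> - K)"
  using \<Omega> K by (simp add: open_Diff compact_imp_closed)

lemma Omega_sets [measurable]: "\<Omega> \<in> sets lebesgue"
  using \<Omega> by simp

lemma weak_gradient_E: "has_weak_gradient (\<Omega> - K) E G"
  using E_sol by (auto simp: solves_measure_equation_def in_W1p_loc_def)

lemma in_Lp_E:
  assumes "compact C" "C \<subseteq> \<Omega> - K"
  shows "in_Lp p C E" "in_Lp p C G" "in_Lp 1 C E" "in_Lp 1 C G"
  using E_sol assms by (auto simp: solves_measure_equation_def in_W1p_loc_def in_Lp_loc_def has_weak_gradient_def)

lemma AE_not_K: "AE x in lebesgue. x \<notin> K"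
  using K(3) by (rule AE_not_in)

text \<open>Test functions with supports in one compact \<open>C\<close> approximate \<Psi> in C1.
  The flux is integrable on \<open>C\<close> and \<mu> is finite, so an error \<open>e\<close> in C1
  changes the two sides by at most \<open>e * I\<close> together.\<close>

lemma equation_C1c:
  assumes \<Psi>: "C1c \<Omega> \<Psi> D"
  shows "set_lebesgue_integral lebesgue \<Omega> (\<lambda>x. flux p A G x \<bullet> D x) = (\<integral>x. \<Psi> x \<partial>\<mu>)"
proof -
  interpret finite_measure \<mu> by (rule mu(2))
  obtain C where C: "compact C" "C \<subseteq> \<Omega>" "\<And>x. x \<notin> C \<Longrightarrow> \<Psi> x = 0" "\<And>x. x \<notin> C \<Longrightarrow> D x = 0"
    and dense: "\<And>e. 0 < e \<Longrightarrow> \<exists>\<phi>. test_function \<Omega> \<phi> \<and> (\<forall>x. x \<notin> C \<longrightarrow> \<phi> x = 0 \<and> grad \<phi> x = 0) \<and>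
       (\<forall>x. \<bar>\<phi> x - \<Psi> x\<bar> \<le> e \<and> norm (grad \<phi> x - D x) \<le> e)"
    by (rule C1c_dense[OF \<Psi> \<Omega>(1)]) blast
  define F where "F = (\<lambda>x. indicator C x *\<^sub>R flux p A G x)"
  have "in_Lp 1 C (flux p A G)"
    using E_sol C by (auto simp: solves_measure_equation_def in_Lp_loc_def)
  then have iF: "integrable lebesgue F"
    unfolding F_def by (rule in_Lp_1_integrable)
  have setint: "set_lebesgue_integral lebesgue \<Omega> (\<lambda>x. flux p A G x \<bullet> V x) = (\<integral>x. F x \<bullet> V x \<partial>lebesgue)"
    if "\<And>x. x \<notin> C \<Longrightarrow> V x = 0" for V
    unfolding set_lebesgue_integral_def
  proof (intro Bochner_Integration.integral_cong refl)
    fix x show "indicator \<Omega> x *\<^sub>R (flux p A G x \<bullet> V x) = F x \<bullet> V x"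
      using that[of x] C(2) by (cases "x \<in> C") (auto simp: F_def indicator_def)
  qed
  have iFV: "integrable lebesgue (\<lambda>x. F x \<bullet> V x)" if V: "continuous_on UNIV V" "\<And>x. x \<notin> C \<Longrightarrow> V x = 0" for V
  proof -
    obtain B where B: "\<And>x. norm (V x) \<le> B"
      using compact_support_bounded[OF V(1) C(1) V(2)] by auto
    have [measurable]: "V \<in> borel_measurable lebesgue" by (rule lebesgue_measurable_continuous[OF V(1)])
    show ?thesis
    proof (rule Bochner_Integration.integrable_bound)
      show "integrable lebesgue (\<lambda>x. norm (F x) * B)" using iF by auto
      show "(\<lambda>x. F x \<bullet> V x) \<in> borel_measurable lebesgue" using iF by auto
      have "norm (F x \<bullet> V x) \<le> norm (norm (F x) * B)" for x
      proof -
        have "norm (F x \<bullet> V x) \<le> norm (F x) * norm (V x)" by (simp add: Cauchy_Schwarz_ineq2)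
        also have "\<dots> \<le> norm (F x) * B" by (intro mult_left_mono B) auto
        finally show ?thesis by simp
      qed
      then show "AE x in lebesgue. norm (F x \<bullet> V x) \<le> norm (norm (F x) * B)" by (intro AE_I2)
    qed
  qed
  have i\<mu>: "integrable \<mu> f" if f: "continuous_on UNIV f" "\<And>x. x \<notin> C \<Longrightarrow> f x = 0" for f :: "real^'n \<Rightarrow> real"
  proof -
    obtain B where B: "\<And>x. norm (f x) \<le> B"
      using compact_support_bounded[OF f(1) C(1) f(2)] by auto
    have "f \<in> borel_measurable \<mu>"
      using borel_measurable_continuous_onI[OF f(1)] measurable_cong_sets[OF mu(1) refl] by blast
    then show ?thesis using B by (intro integrable_const_bound[where B=B]) auto
  qed
  define a where "a = (\<integral>x. F x \<bullet> D x \<partial>lebesgue)"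
  define b where "b = (\<integral>x. \<Psi> x \<partial>\<mu>)"
  define I where "I = (\<integral>x. norm (F x) \<partial>lebesgue) + measure \<mu> (space \<mu>)"
  have le: "\<bar>a - b\<bar> \<le> e * I" if e: "0 < e" for e
  proof -
    obtain \<phi> where \<phi>: "test_function \<Omega> \<phi>" "\<And>x. x \<notin> C \<Longrightarrow> \<phi> x = 0" "\<And>x. x \<notin> C \<Longrightarrow> grad \<phi> x = 0"
      "\<And>x. \<bar>\<phi> x - \<Psi> x\<bar> \<le> e" "\<And>x. norm (grad \<phi> x - D x) \<le> e"
      using dense[OF e] by blast
    note c\<phi> = C1cD[OF test_function_C1c[OF \<phi>(1)]]
    have "(\<integral>x. F x \<bullet> grad \<phi> x \<partial>lebesgue) = (\<integral>x. \<phi> x \<partial>\<mu>)"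
      using E_sol \<phi>(1) setint[of "grad \<phi>"] \<phi>(3) by (simp add: solves_measure_equation_def)
    then have "a - b = (\<integral>x. F x \<bullet> D x \<partial>lebesgue) - (\<integral>x. F x \<bullet> grad \<phi> x \<partial>lebesgue) + ((\<integral>x. \<phi> x \<partial>\<mu>) - (\<integral>x. \<Psi> x \<partial>\<mu>))"
      by (simp add: a_def b_def)
    also have "\<dots> = (\<integral>x. F x \<bullet> D x - F x \<bullet> grad \<phi> x \<partial>lebesgue) + (\<integral>x. \<phi> x - \<Psi> x \<partial>\<mu>)"
      using iFV[OF C1cD(2)[OF \<Psi>] C(4)] iFV[OF c\<phi>(2) \<phi>(3)] i\<mu>[OF c\<phi>(3) \<phi>(2)] i\<mu>[OF C1cD(3)[OF \<Psi>] C(3)] by simp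
    finally have eq: "a - b = (\<integral>x. F x \<bullet> D x - F x \<bullet> grad \<phi> x \<partial>lebesgue) + (\<integral>x. \<phi> x - \<Psi> x \<partial>\<mu>)" .
    have "\<bar>\<integral>x. F x \<bullet> D x - F x \<bullet> grad \<phi> x \<partial>lebesgue\<bar> \<le> (\<integral>x. e * norm (F x) \<partial>lebesgue)"
    proof (rule integral_abs_bound_integral)
      fix x
      have "\<bar>F x \<bullet> D x - F x \<bullet> grad \<phi> x\<bar> = \<bar>F x \<bullet> (grad \<phi> x - D x)\<bar>"
        by (simp add: inner_diff_right abs_minus_commute)
      also have "\<dots> \<le> norm (F x) * norm (grad \<phi> x - D x)" by (rule Cauchy_Schwarz_ineq2)
      also have "\<dots> \<le> norm (F x) * e" by (intro mult_left_mono \<phi>) auto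
      finally show "\<bar>F x \<bullet> D x - F x \<bullet> grad \<phi> x\<bar> \<le> e * norm (F x)" by (simp add: mult.commute)
    qed (use iF iFV[OF C1cD(2)[OF \<Psi>] C(4)] iFV[OF c\<phi>(2) \<phi>(3)] in auto)
    moreover have "\<bar>\<integral>x. \<phi> x - \<Psi> x \<partial>\<mu>\<bar> \<le> (\<integral>x. e \<partial>\<mu>)"
      by (rule integral_abs_bound_integral)
        (use i\<mu>[OF c\<phi>(3) \<phi>(2)] i\<mu>[OF C1cD(3)[OF \<Psi>] C(3)] \<phi>(4) in auto)
    ultimately show ?thesis
      unfolding eq I_def by (simp add: distrib_left mult.commute)
  qed
  have "a = b"
  proof (rule ccontr)
    assume "a \<noteq> b"
    have "0 \<le> I" unfolding I_def by (intro add_nonneg_nonneg integral_nonneg_AE) auto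
    \<comment> \<open>The choice \<open>e = \<bar>a - b\<bar> / (2 * (I + 1))\<close> contradicts
      the bound unless the difference is 0.\<close>
    have "\<bar>a - b\<bar> \<le> \<bar>a - b\<bar> / (2 * (I + 1)) * I"
      using \<open>a \<noteq> b\<close> \<open>0 \<le> I\<close> by (intro le) auto
    also have "\<dots> = \<bar>a - b\<bar> * (I / (2 * (I + 1)))" by simp
    also have "\<dots> < \<bar>a - b\<bar> * 1"
      using \<open>a \<noteq> b\<close> \<open>0 \<le> I\<close> by (intro mult_strict_left_mono) (auto simp: divide_less_eq)
    finally show False by simp
  qed
  then show ?thesis
    using setint[of D] C(4) by (simp add: a_def b_def)
qed

end

section \<open>The Hardy inequality away from K\<close>

lemma Lp_tendsto_add:
  fixes V :: "nat \<Rightarrow> 'a \<Rightarrow> 'b::euclidean_space"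
  assumes "Lp_tendsto M p V W" "Lp_tendsto M p V' W'" "0 \<le> p"
  shows "Lp_tendsto M p (\<lambda>k x. V k x + V' k x) (\<lambda>x. W x + W' x)"
proof -
  have [measurable]: "\<And>k. V k \<in> borel_measurable M" "W \<in> borel_measurable M" "\<And>k. V' k \<in> borel_measurable M" "W' \<in> borel_measurable M"
    and lim: "(\<lambda>k. \<integral>\<^sup>+x. ennreal (norm (V k x - W x) powr p) \<partial>M) \<longlonglongrightarrow> 0"
      "(\<lambda>k. \<integral>\<^sup>+x. ennreal (norm (V' k x - W' x) powr p) \<partial>M) \<longlonglongrightarrow> 0"
    using assms by (auto simp: Lp_tendsto_def)
  let ?b = "\<lambda>k. ennreal (2 powr p) * (Lp_int M p (\<lambda>x. V k x - W x) + Lp_int M p (\<lambda>x. V' k x - W' x))"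
  have "Lp_int M p (\<lambda>x. V k x + V' k x - (W x + W' x)) \<le> ?b k" for k
  proof -
    have "Lp_int M p (\<lambda>x. V k x + V' k x - (W x + W' x)) \<le>
       ennreal (2 powr p) * (Lp_int M p (\<lambda>x. V k x + V' k x - (W x + V' k x)) +
          (Lp_int M p (\<lambda>x. W x + V' k x - (W x + W' x))))"
      using assms(3) by (intro nn_integral_norm_diff_powr_triangle) auto
    then show ?thesis by simp
  qed
  moreover have "?b \<longlonglongrightarrow> 0"
    using ennreal_tendsto_cmult[OF _ tendsto_add[OF lim], of "ennreal (2 powr p)"] by simp
  ultimately show ?thesis
    unfolding Lp_tendsto_def by (auto intro: ennreal_tendsto_0_le)
qed

lemma Lp_finite_add:
  fixes V W :: "'a \<Rightarrow> 'b::euclidean_space"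
  assumes "V \<in> borel_measurable M" "W \<in> borel_measurable M" "0 \<le> p"
    and "Lp_int M p V < \<infinity>" "Lp_int M p W < \<infinity>"
  shows "Lp_int M p (\<lambda>x. V x + W x) < \<infinity>"
proof -
  have "Lp_int M p (\<lambda>x. V x - (- W x)) \<le>
      ennreal (2 powr p) * (Lp_int M p (\<lambda>x. V x - 0) + Lp_int M p (\<lambda>x. 0 - (- W x)))"
    using assms(1-3) by (intro nn_integral_norm_diff_powr_triangle) auto
  also have "\<dots> < \<infinity>" using assms(4,5) by (simp add: ennreal_mult_less_top)
  finally show ?thesis by simp
qed

lemma Lp_finite_scaleR:
  fixes W :: "'a \<Rightarrow> 'b::euclidean_space"
  assumes [measurable]: "W \<in> borel_measurable M" and p: "0 \<le> p"
    and W: "Lp_int M p W < \<infinity>"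
    and c: "\<And>x. x \<in> space M \<Longrightarrow> norm (V x) \<le> B * norm (W x)" and B: "0 \<le> B"
  shows "Lp_int M p V < \<infinity>"
proof -
  have "Lp_int M p V \<le> (\<integral>\<^sup>+x. ennreal (B powr p) * ennreal (norm (W x) powr p) \<partial>M)"
  proof (rule nn_integral_mono)
    fix x assume "x \<in> space M"
    then have "norm (V x) powr p \<le> (B * norm (W x)) powr p"
      using c p by (intro powr_mono2) auto
    then show "ennreal (norm (V x) powr p) \<le> ennreal (B powr p) * ennreal (norm (W x) powr p)"
      using B by (simp add: powr_mult ennreal_leI flip: ennreal_mult)
  qed
  also have "\<dots> < \<infinity>" using W by (simp add: nn_integral_cmult ennreal_mult_less_top)
  finally show ?thesis .
qed

lemma Lp_finite_bounded:
  fixes C :: "(real^'n::finite) set"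
  assumes "\<And>x. x \<in> C \<Longrightarrow> norm (f x) \<le> B" "bounded C" "C \<in> sets lebesgue" "0 \<le> p"
  shows "Lp_int (lebesgue_on C) p f < \<infinity>"
proof -
  have "Lp_int (lebesgue_on C) p f \<le> (\<integral>\<^sup>+x. ennreal (B powr p) \<partial>lebesgue_on C)"
    using assms by (intro nn_integral_mono ennreal_leI powr_mono2) (auto simp: space_restrict_space)
  also have "\<dots> = ennreal (B powr p) * emeasure lebesgue C"
    using assms(3) by (simp add: space_restrict_space emeasure_restrict_space)
  also have "emeasure lebesgue C < \<infinity>"
    using fmeasurableD2[OF bounded_set_imp_lmeasurable[OF assms(2,3)]] by (simp add: top.not_eq_extremum)
  then have "ennreal (B powr p) * emeasure lebesgue C < \<infinity>" by (simp add: ennreal_mult_less_top)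
  finally show ?thesis .
qed

text \<open>Writing the derivative with positive and negative parts makes its continuity evident. At
  0 the difference quotient is bounded by \<open>\<bar>h\<bar> powr (p - 1)\<close>.\<close>

lemma abs_powr_has_derivative:
  fixes p s :: real
  assumes p: "1 < p"
  shows "((\<lambda>s. \<bar>s\<bar> powr p) has_real_derivative p * (max s 0 powr (p - 1) - max (- s) 0 powr (p - 1))) (at s)"
proof -
  consider "s > 0" | "s < 0" | "s = 0" by linarith
  then show ?thesis
  proof cases
    case 1
    have ev: "eventually (\<lambda>s. \<bar>s\<bar> powr p = s powr p) (nhds s)"
      by (rule eventually_mono[OF eventually_nhds_in_open[of "{0<..}" s]]) (use 1 in auto)
    have "((\<lambda>s. s powr p) has_real_derivative p * s powr (p - 1)) (at s)"
      by (rule derivative_eq_intros refl 1 | simp)+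
    then show ?thesis using DERIV_cong_ev[OF refl ev refl] 1 by (simp add: max_def)
  next
    case 2
    have ev: "eventually (\<lambda>s. \<bar>s\<bar> powr p = (- s) powr p) (nhds s)"
      by (rule eventually_mono[OF eventually_nhds_in_open[of "{..<0}" s]]) (use 2 in auto)
    have "((\<lambda>s. (- s) powr p) has_real_derivative - (p * (- s) powr (p - 1))) (at s)"
      by (rule derivative_eq_intros refl | use 2 in simp)+
    then show ?thesis using DERIV_cong_ev[OF refl ev refl] 2 by (simp add: max_def)
  next
    case 3
    have "((\<lambda>h. \<bar>h\<bar> powr p / h) \<longlongrightarrow> 0) (at 0)"
    proof (rule Lim_null_comparison)
      show "\<forall>\<^sub>F h in at 0. norm (\<bar>h\<bar> powr p / h) \<le> \<bar>h\<bar> powr (p - 1)"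
        using p by (intro always_eventually allI) (auto simp: powr_diff)
      show "((\<lambda>h. \<bar>h\<bar> powr (p - 1)) \<longlongrightarrow> 0) (at (0::real))"
        using p by (intro tendsto_zero_powrI[where b="p - 1"]) (auto intro!: tendsto_eq_intros)
    qed
    then show ?thesis
      using p by (simp add: 3 has_field_derivative_iff)
  qed
qed

text \<open>The tangent inequality for \<open>s * X\<close> and \<open>Y * s powr (1 - p)\<close>,
  where \<open>s powr p = \<beta>\<close>; the two powers of \<open>s\<close> cancel in the
  product.\<close>

lemma young_hardy:
  fixes p X Y :: real
  assumes p: "1 < p" and "0 \<le> X" "0 \<le> Y"
  defines "\<beta> \<equiv> (p - 1) / p"
  shows "p * X powr (p - 1) * Y \<le> (p - 1) * \<beta> * X powr p + \<beta> powr (1 - p) * Y powr p"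
proof -
  have \<beta>: "0 < \<beta>" using p by (simp add: \<beta>_def)
  define s where "s = \<beta> powr (1 / p)"
  have s: "0 < s" using \<beta> by (simp add: s_def)
  have "p * (s * X) powr (p - 1) * (Y * s powr (1 - p)) \<le> (p - 1) * (s * X) powr p + (Y * s powr (1 - p)) powr p"
    using assms s by (intro tangent_powr_le) auto
  moreover have "(s * X) powr (p - 1) * (Y * s powr (1 - p)) = X powr (p - 1) * Y"
  proof -
    have "s powr (p - 1) * s powr (1 - p) = 1" using s by (simp flip: powr_add)
    moreover have "(s * X) powr (p - 1) = s powr (p - 1) * X powr (p - 1)"
      by (rule powr_mult)
    ultimately show ?thesis by (simp add: algebra_simps)
  qed
  moreover have "(s * X) powr p = \<beta> * X powr p"
    using s p \<beta> assms by (simp add: powr_mult s_def powr_powr)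
  moreover have "(Y * s powr (1 - p)) powr p = \<beta> powr (1 - p) * Y powr p"
    using s p \<beta> assms by (simp add: powr_mult s_def powr_powr)
  ultimately show ?thesis
    by (metis mult.assoc)
qed

context p_potential
begin

lemma nA_Lp_finite:
  assumes "S \<in> sets lebesgue" "S \<subseteq> \<Omega>" "V \<in> borel_measurable (lebesgue_on S)"
    and "Lp_int (lebesgue_on S) p V < \<infinity>"
  shows "(\<integral>\<^sup>+x. ennreal (norm_A (A x) (V x) powr p) \<partial>lebesgue_on S) < \<infinity>"
proof -
  have nn: "norm (norm_A (A x) (V x)) = norm_A (A x) (V x)" if "x \<in> space (lebesgue_on S)" for x
    using that assms(2) nA_nonneg[of x "V x"] by (auto simp: space_restrict_space)
  have le: "norm (norm_A (A x) (V x)) \<le> sqrt \<Lambda> * norm (V x)" if "x \<in> space (lebesgue_on S)" for x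
    unfolding nn[OF that] by (rule nA_le) (use that assms(2) in \<open>auto simp: space_restrict_space\<close>)
  have "Lp_int (lebesgue_on S) p (\<lambda>x. norm_A (A x) (V x)) < \<infinity>"
    by (rule Lp_finite_scaleR[OF assms(3) _ assms(4) le]) (use p \<Lambda>(1) in auto)
  also have "Lp_int (lebesgue_on S) p (\<lambda>x. norm_A (A x) (V x)) = (\<integral>\<^sup>+x. ennreal (norm_A (A x) (V x) powr p) \<partial>lebesgue_on S)"
    by (intro nn_integral_cong) (simp only: nn)
  finally show ?thesis .
qed

text \<open>Only the gradients have to vanish off \<open>C\<close>; \<Psi> itself may be nonzero on
  \<open>K\<close>, where it contributes the constant \<open>m\<close>. The Hardy inequality uses
  \<open>m = 0\<close>, the push-forward formula a multiple of the mass of \<mu>.\<close>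

lemma equation_limit:
  assumes C: "compact C" "C \<subseteq> \<Omega> - K"
    and \<Psi>: "\<And>k. C1c \<Omega> (\<Psi> k) (D k)" "\<And>k x. x \<notin> C \<Longrightarrow> D k x = 0" "\<And>k::nat. (\<integral>x. \<Psi> k x \<partial>\<mu>) = m"
    and W: "Lp_tendsto (lebesgue_on C) p D W" "Lp_int (lebesgue_on C) p W < \<infinity>"
  shows "(\<integral>x. flux p A G x \<bullet> W x \<partial>lebesgue_on C) = m"
proof -
  have Cs: "C \<in> sets lebesgue" "C \<subseteq> \<Omega>"
    using C by (auto intro: lmeasurable_compact fmeasurableD)
  have G: "G \<in> borel_measurable (lebesgue_on C)" "Lp_int (lebesgue_on C) p G < \<infinity>"
    using in_Lp_E(2)[OF C] Cs(1) by (auto simp: in_Lp_iff)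
  have "(\<lambda>k. \<integral>x. flux p A G x \<bullet> D k x \<partial>lebesgue_on C) \<longlonglongrightarrow> (\<integral>x. flux p A G x \<bullet> W x \<partial>lebesgue_on C)"
    by (rule Lp_tendsto_integral_inner[OF p W(1) flux_measurable[OF Cs G(1)]
          admissible_matrix_measurable(2)[OF A Cs G(1)] _ _ nA_Lp_finite[OF Cs G] W(2)])
      (use Cs(2) in \<open>auto simp: space_restrict_space intro: nA_nonneg norm_flux_le\<close>)
  moreover have "(\<integral>x. flux p A G x \<bullet> D k x \<partial>lebesgue_on C) = m" for k
  proof -
    have "(\<integral>x. flux p A G x \<bullet> D k x \<partial>lebesgue_on C) = set_lebesgue_integral lebesgue \<Omega> (\<lambda>x. flux p A G x \<bullet> D k x)"
      unfolding set_lebesgue_integral_def using Cs \<Psi>(2)[of _ k]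
      by (subst integral_restrict_space) (auto intro!: Bochner_Integration.integral_cong simp: indicator_def)
    then show ?thesis using equation_C1c[OF \<Psi>(1)] \<Psi>(3) by simp
  qed
  ultimately have "(\<lambda>k::nat. m) \<longlonglongrightarrow> (\<integral>x. flux p A G x \<bullet> W x \<partial>lebesgue_on C)" by simp
  then show ?thesis by (simp add: LIMSEQ_const_iff)
qed

lemma AE_mu_K: "AE x in \<mu>. x \<in> K"
proof -
  have "- K \<in> null_sets \<mu>"
  proof (rule null_setsI[OF supp])
    have "open (- K)" using K(1) by (simp add: compact_imp_closed open_Compl)
    then show "- K \<in> sets \<mu>" unfolding mu(1) by (rule borel_open)
  qed
  from AE_not_in[OF this] show ?thesis by simp
qed

lemma integral_eq_0_off_K:
  assumes "\<And>x. x \<in> K \<Longrightarrow> f x = 0"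
  shows "(\<integral>x. f x \<partial>\<mu>) = (0::real)"
proof -
  have "AE x in \<mu>. f x = 0" using AE_mu_K by eventually_elim (use assms in auto)
  then show ?thesis using integral_eq_zero_AE by blast
qed

text \<open>The mollifications \<open>e k\<close> replace \<open>E\<close> in the test function, so
  only classical derivatives occur. In the limit, the part of the gradient along \<open>G\<close>
  yields \<open>p - 1\<close> times the weighted term, and the part along \<open>D\<close> is
  estimated by \<open>young_hardy\<close>.\<close>

lemma hardy_C1c_shifted:
  assumes \<psi>: "C1c (\<Omega> - K) \<psi> D" and C: "compact C" "C \<subseteq> \<Omega> - K" "\<And>x. x \<notin> C \<Longrightarrow> \<psi> x = 0" "\<And>x. x \<notin> C \<Longrightarrow> D x = 0"
    and \<delta>: "0 < \<delta>"
  defines "\<beta> \<equiv> (p - 1) / p"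
  shows "ennreal (\<beta> powr p) * (\<integral>\<^sup>+x. ennreal ((\<bar>\<psi> x\<bar> * norm_A (A x) (G x) / (E x + \<delta>)) powr p) \<partial>lebesgue_on C)
     \<le> (\<integral>\<^sup>+x. ennreal (norm_A (A x) (D x) powr p) \<partial>lebesgue_on C)"
proof -
  have Cs[measurable]: "C \<in> sets lebesgue" and C\<Omega>: "C \<subseteq> \<Omega>"
    using C by (auto intro: lmeasurable_compact fmeasurableD)
  obtain \<rho> C1 where \<rho>: "0 < \<rho>" and C1: "compact C1" "C1 \<subseteq> \<Omega> - K" "\<And>x. x \<in> C \<Longrightarrow> cball x \<rho> \<subseteq> C1"
    by (rule compact_neighbourhood[OF C(1) open_U C(2)]) blast
  \<comment> \<open>Extending \<open>E\<close> by 0 keeps \<open>g\<close>, and with it every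
    \<open>e k\<close>, nonnegative on the whole space, so \<open>e k x + \<delta>\<close> never
    falls below \<delta>.\<close>
  define g where "g = (\<lambda>x. indicator C1 x *\<^sub>R E x)"
  have g0: "0 \<le> g x" for x
    using E_pos[of x] C1(2) by (cases "x \<in> C1") (auto simp: g_def less_imp_le subset_iff)
  have CC1: "x \<in> C1" if "x \<in> C" for x using C1(3)[OF that] \<rho> by auto
  have gE: "g x = E x" if "x \<in> C" for x using CC1[OF that] by (simp add: g_def)
  have gLp: "Lp_int lebesgue p g < \<infinity>"
    unfolding g_def by (rule in_Lp_indicator(2)[OF in_Lp_E(1)[OF C1(1,2)]]) (use p in simp)
  have gint: "integrable lebesgue g"
    unfolding g_def by (rule in_Lp_1_integrable[OF in_Lp_E(3)[OF C1(1,2)]])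
  have gz: "x \<notin> C1 \<Longrightarrow> g x = 0" "x \<in> C1 \<Longrightarrow> g x = E x" for x
    by (auto simp: g_def)
  obtain e De where e: "\<And>k x. ((e k :: real^'n \<Rightarrow> real) has_derivative (\<lambda>h. De k x \<bullet> h)) (at x)"
    and De: "\<And>k :: nat. continuous_on UNIV (De k)"
    and lim: "Lp_tendsto (lebesgue_on C) p De G" "AE x in lebesgue. (\<lambda>k. e k x) \<longlonglongrightarrow> g x"
    and e0: "\<And>k x b. (\<And>y. y \<in> cball x \<rho> \<Longrightarrow> b \<le> g y) \<Longrightarrow> b \<le> e k x"
    by (rule sobolev_approximation[OF weak_gradient_E p C1(1,2) in_Lp_E(2)[OF C1(1,2)] gint gLp compact_imp_bounded[OF C1(1)] gz Cs \<rho> C1(3)])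
      blast+
  have e_nonneg: "0 \<le> e k x" for k x by (rule e0) (rule g0)
  have econt: "continuous_on UNIV (e k)" for k
    by (meson continuous_at_imp_continuous_on e has_derivative_continuous)
  define a where "a = (\<lambda>s. p * (max s 0 powr (p - 1) - max (- s) 0 powr (p - 1)))"
  have acont: "continuous_on UNIV a"
    unfolding a_def using p by (intro continuous_intros continuous_on_powr') auto
  have a_abs: "\<bar>a s\<bar> = p * \<bar>s\<bar> powr (p - 1)" for s
    using p by (auto simp: a_def max_def abs_mult)
  have \<psi>cont: "continuous_on UNIV \<psi>" by (rule C1cD(3)[OF \<psi>])
  \<comment> \<open>\<open>c1\<close> multiplies the gradient of \<psi> and \<open>c2\<close> that
    of the approximation of \<open>E\<close>; the argument \<open>t\<close> is first
    \<open>e k\<close> and in the limit \<open>E\<close>.\<close>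
  define c1 where "c1 t x = a (\<psi> x) * (t x + \<delta>) powr (1 - p)" for t :: "real^'n \<Rightarrow> real" and x
  define c2 where "c2 t x = \<bar>\<psi> x\<bar> powr p * ((1 - p) * (t x + \<delta>) powr (- p))" for t :: "real^'n \<Rightarrow> real" and x
  define \<Psi> where "\<Psi> k x = \<bar>\<psi> x\<bar> powr p * (e k x + \<delta>) powr (1 - p)" for k x
  define D' where "D' k x = c1 (e k) x *\<^sub>R D x + c2 (e k) x *\<^sub>R De k x" for k x
  have pos: "0 < e k x + \<delta>" for k x using e_nonneg[of k x] \<delta> by simp
  then have ne: "e k x + \<delta> \<noteq> 0" for k x by (metis less_irrefl)
  have "continuous_on UNIV (\<lambda>x. (e k x + \<delta>) powr q)" for k q
    by (intro continuous_on_powr continuous_intros econt) (use ne in auto)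
  moreover have "continuous_on UNIV (\<lambda>x. \<bar>\<psi> x\<bar> powr p)"
    using p by (intro continuous_on_powr' continuous_intros \<psi>cont) auto
  moreover have "continuous_on UNIV (\<lambda>x. a (\<psi> x))"
    by (rule continuous_on_compose2[OF acont \<psi>cont]) simp
  ultimately have ccont: "continuous_on UNIV (c1 (e k))" "continuous_on UNIV (c2 (e k))" for k
    unfolding c1_def c2_def by (auto intro!: continuous_on_mult continuous_on_const)
  have \<Psi>: "C1c (\<Omega> - K) (\<Psi> k) (D' k)" for k
  proof (rule C1cI[OF _ _ C(1,2)])
    fix x
    have "((\<lambda>t. (t + \<delta>) powr (1 - p)) has_real_derivative (1 - p) * (e k x + \<delta>) powr (- p)) (at (e k x))"
      by (rule derivative_eq_intros refl | use pos[of k x] in simp)+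
    from has_derivative_compose[OF e this[unfolded has_field_derivative_def]]
    have "((\<lambda>x. (e k x + \<delta>) powr (1 - p)) has_derivative (\<lambda>h. (1 - p) * (e k x + \<delta>) powr (- p) * (De k x \<bullet> h))) (at x)" .
    from has_derivative_mult[OF has_derivative_compose[OF C1cD(1)[OF \<psi>] abs_powr_has_derivative[OF p, unfolded has_field_derivative_def]] this]
    show "(\<Psi> k has_derivative (\<lambda>h. D' k x \<bullet> h)) (at x)"
      unfolding \<Psi>_def D'_def c1_def c2_def a_def
      by (rule has_derivative_eq_rhs) (auto simp: inner_add_left algebra_simps)
  next
    show "continuous_on UNIV (D' k)"
      unfolding D'_def by (intro continuous_intros ccont C1cD(2)[OF \<psi>] De)
  next
    show "\<Psi> k x = 0" if "x \<notin> C" for x using C(3)[OF that] p by (simp add: \<Psi>_def)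
  qed
  have D'0: "D' k x = 0" if "x \<notin> C" for k x
    using C(3,4)[OF that] p by (simp add: D'_def c1_def c2_def a_def)
  obtain B where B: "\<And>x. norm (\<psi> x) \<le> B" "0 < B"
    using compact_support_bounded[OF \<psi>cont C(1,3)] by blast
  obtain BD where BD: "\<And>x. norm (D x) \<le> BD"
    using compact_support_bounded[OF C1cD(2)[OF \<psi>] C(1,4)] by blast
  \<comment> \<open>The negative powers of \<open>t x + \<delta>\<close> are largest at
    \<open>t x = 0\<close>; this is where the shift makes the coefficients bounded.\<close>
  define B1 where "B1 = p * B powr (p - 1) * \<delta> powr (1 - p)"
  define B2 where "B2 = B powr p * ((p - 1) * \<delta> powr (- p))"
  have c1B: "\<bar>c1 t x\<bar> \<le> B1" if "0 \<le> t x" for t x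
  proof -
    have "\<bar>\<psi> x\<bar> powr (p - 1) \<le> B powr (p - 1)" using B p by (intro powr_mono2) auto
    moreover have "(t x + \<delta>) powr (1 - p) \<le> \<delta> powr (1 - p)"
      using that \<delta> p by (intro powr_mono2') auto
    ultimately show ?thesis
      unfolding c1_def B1_def abs_mult a_abs using p by (intro mult_mono) auto
  qed
  have c2B: "\<bar>c2 t x\<bar> \<le> B2" if "0 \<le> t x" for t x
  proof -
    have "\<bar>\<psi> x\<bar> powr p \<le> B powr p" using B p by (intro powr_mono2) auto
    moreover have "(t x + \<delta>) powr (- p) \<le> \<delta> powr (- p)"
      using that \<delta> p by (intro powr_mono2') auto
    ultimately show ?thesis
      unfolding c2_def B2_def abs_mult using p by (intro mult_mono) auto
  qed
  let ?M = "lebesgue_on C"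
  have sp: "space ?M = C" by (simp add: space_restrict_space)
  have G[measurable]: "G \<in> borel_measurable ?M" and GLp: "Lp_int ?M p G < \<infinity>"
    using in_Lp_E(2)[OF C(1,2)] by (auto simp: in_Lp_iff)
  have [measurable]: "E \<in> borel_measurable ?M"
    using in_Lp_E(1)[OF C(1,2)] by (auto simp: in_Lp_iff)
  have contM: "f \<in> borel_measurable ?M" if "continuous_on UNIV f" for f :: "real^'n \<Rightarrow> 'c::euclidean_space"
    using lebesgue_measurable_continuous[OF that] by (rule measurable_restrict_space1)
  have [measurable]: "D \<in> borel_measurable ?M" "\<psi> \<in> borel_measurable ?M" "(\<lambda>x. a (\<psi> x)) \<in> borel_measurable ?M"
    by (intro contM C1cD(2)[OF \<psi>] \<psi>cont continuous_on_compose2[OF acont \<psi>cont]; simp)+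
  have DLp: "Lp_int ?M p D < \<infinity>"
    using BD p compact_imp_bounded[OF C(1)] Cs by (intro Lp_finite_bounded[where B=BD]) auto
  have limM: "AE x in ?M. (\<lambda>k. e k x) \<longlonglongrightarrow> E x"
    using lim(2) gE by (subst AE_restrict_space_iff) (auto elim!: eventually_mono)
  have cE[measurable]: "c1 E \<in> borel_measurable ?M" "c2 E \<in> borel_measurable ?M"
    unfolding c1_def c2_def by measurable
  have E0: "0 < E x" if "x \<in> C" for x using that C(2) E_pos by auto
  have climc: "AE x in ?M. (\<lambda>k. c1 (e k) x) \<longlonglongrightarrow> c1 E x" "AE x in ?M. (\<lambda>k. c2 (e k) x) \<longlonglongrightarrow> c2 E x"
  proof -
    have "AE x in ?M. (\<lambda>k. c1 (e k) x) \<longlonglongrightarrow> c1 E x \<and> (\<lambda>k. c2 (e k) x) \<longlonglongrightarrow> c2 E x"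
      using limM AE_space
    proof eventually_elim
      fix x assume "(\<lambda>k. e k x) \<longlonglongrightarrow> E x" "x \<in> space ?M"
      then show "(\<lambda>k. c1 (e k) x) \<longlonglongrightarrow> c1 E x \<and> (\<lambda>k. c2 (e k) x) \<longlonglongrightarrow> c2 E x"
        unfolding c1_def c2_def using E0[of x] \<delta> sp by (intro conjI tendsto_intros) auto
    qed
    then show "AE x in ?M. (\<lambda>k. c1 (e k) x) \<longlonglongrightarrow> c1 E x" "AE x in ?M. (\<lambda>k. c2 (e k) x) \<longlonglongrightarrow> c2 E x" by auto
  qed
  have "Lp_tendsto ?M p (\<lambda>k x. c1 (e k) x *\<^sub>R D x) (\<lambda>x. c1 E x *\<^sub>R D x)"
    by (rule Lp_tendsto_scaleR[OF _ p DLp contM[OF ccont(1)] cE(1) c1B c1B climc(1)])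
      (use e_nonneg E0 sp p in \<open>auto simp: Lp_tendsto_def less_imp_le\<close>)
  moreover have "Lp_tendsto ?M p (\<lambda>k x. c2 (e k) x *\<^sub>R De k x) (\<lambda>x. c2 E x *\<^sub>R G x)"
    by (rule Lp_tendsto_scaleR[OF lim(1) p GLp contM[OF ccont(2)] cE(2) c2B c2B climc(2)])
      (use e_nonneg E0 sp in \<open>auto simp: less_imp_le\<close>)
  ultimately have limD': "Lp_tendsto ?M p D' (\<lambda>x. c1 E x *\<^sub>R D x + c2 E x *\<^sub>R G x)"
    unfolding D'_def using p by (intro Lp_tendsto_add) auto
  have L1: "Lp_int ?M p (\<lambda>x. c1 E x *\<^sub>R D x) < \<infinity>"
    using p B by (intro Lp_finite_scaleR[OF _ _ DLp, where B=B1])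
      (auto simp: sp B1_def[symmetric] intro!: mult_right_mono c1B less_imp_le[OF E0], simp add: B1_def)
  have L2: "Lp_int ?M p (\<lambda>x. c2 E x *\<^sub>R G x) < \<infinity>"
    using p B by (intro Lp_finite_scaleR[OF _ _ GLp, where B=B2])
      (auto simp: sp B2_def[symmetric] intro!: mult_right_mono c2B less_imp_le[OF E0], simp add: B2_def)
  have "(\<integral>x. flux p A G x \<bullet> (c1 E x *\<^sub>R D x + c2 E x *\<^sub>R G x) \<partial>?M) = 0"
  proof (rule equation_limit[OF C(1,2) C1c_mono[OF \<Psi>] D'0 _ limD'])
    show "(\<integral>x. \<Psi> k x \<partial>\<mu>) = 0" for k
      by (rule integral_eq_0_off_K) (use C p in \<open>auto simp: \<Psi>_def\<close>)
    show "Lp_int ?M p (\<lambda>x. c1 E x *\<^sub>R D x + c2 E x *\<^sub>R G x) < \<infinity>"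
      using p by (intro Lp_finite_add L1 L2) auto
  qed auto
  moreover have int: "integrable ?M (\<lambda>x. flux p A G x \<bullet> V x)"
    if "V \<in> borel_measurable ?M" "Lp_int ?M p V < \<infinity>" for V
    by (rule integrable_inner_Lp[OF p flux_measurable[OF Cs C\<Omega> G] that(1) admissible_matrix_measurable(2)[OF A Cs C\<Omega> G]
          _ _ nA_Lp_finite[OF Cs C\<Omega> G GLp] that(2), where C="sqrt \<Lambda>"])
      (use C\<Omega> \<Lambda>(1) in \<open>auto simp: space_restrict_space intro: nA_nonneg norm_flux_le\<close>)
  have i1: "integrable ?M (\<lambda>x. flux p A G x \<bullet> (c1 E x *\<^sub>R D x))"
    by (rule int[OF _ L1]) measurable
  have i2: "integrable ?M (\<lambda>x. flux p A G x \<bullet> (c2 E x *\<^sub>R G x))"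
    by (rule int[OF _ L2]) measurable
  ultimately have id: "(\<integral>x. flux p A G x \<bullet> (c1 E x *\<^sub>R D x) \<partial>?M) = (\<integral>x. - (flux p A G x \<bullet> (c2 E x *\<^sub>R G x)) \<partial>?M)"
    by (simp only: inner_add_right Bochner_Integration.integral_add[OF i1 i2] Bochner_Integration.integral_minus)
  define X where "X x = \<bar>\<psi> x\<bar> * norm_A (A x) (G x) / (E x + \<delta>)" for x
  define Y where "Y x = norm_A (A x) (D x)" for x
  have X0: "0 \<le> X x" and Y0: "0 \<le> Y x" if "x \<in> C" for x
    using nA_nonneg[of x] that C\<Omega> E0[OF that] \<delta> by (auto simp: X_def Y_def)
  have eq2: "- (flux p A G x \<bullet> (c2 E x *\<^sub>R G x)) = (p - 1) * X x powr p" if "x \<in> C" for x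
  proof -
    have "X x powr p = \<bar>\<psi> x\<bar> powr p * norm_A (A x) (G x) powr p * (E x + \<delta>) powr (- p)"
      using E0[OF that] \<delta> by (simp add: X_def powr_mult powr_divide powr_minus_divide)
    moreover have "x \<in> \<Omega>" using that C\<Omega> by auto
    ultimately show ?thesis by (simp add: c2_def flux_inner_self algebra_simps)
  qed
  have le1: "flux p A G x \<bullet> (c1 E x *\<^sub>R D x) \<le> (p - 1) * \<beta> * X x powr p + \<beta> powr (1 - p) * Y x powr p" if "x \<in> C" for x
  proof -
    have x: "x \<in> \<Omega>" using that C\<Omega> by auto
    have "flux p A G x \<bullet> (c1 E x *\<^sub>R D x) \<le> \<bar>c1 E x\<bar> * \<bar>flux p A G x \<bullet> D x\<bar>"
      by (simp add: abs_mult[symmetric])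
    also have "\<dots> \<le> \<bar>c1 E x\<bar> * (norm_A (A x) (G x) powr (p - 1) * Y x)"
      unfolding Y_def by (intro mult_left_mono flux_inner_le x) auto
    also have "\<dots> = p * X x powr (p - 1) * Y x"
    proof -
      have "X x powr (p - 1) = \<bar>\<psi> x\<bar> powr (p - 1) * norm_A (A x) (G x) powr (p - 1) * (E x + \<delta>) powr (1 - p)"
        using E0[OF that] \<delta> powr_minus_divide[of "E x + \<delta>" "p - 1"]
        by (simp add: X_def powr_mult powr_divide)
      then show ?thesis by (simp add: c1_def abs_mult a_abs)
    qed
    also have "\<dots> \<le> (p - 1) * \<beta> * X x powr p + \<beta> powr (1 - p) * Y x powr p"
      unfolding \<beta>_def by (rule young_hardy[OF p X0[OF that] Y0[OF that]])
    finally show ?thesis .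
  qed
  \<comment> \<open>Finiteness of the weighted term has to be known before a multiple of it is
    subtracted; it follows from the integrability of the \<open>c2\<close> part, which is a multiple
    of it.\<close>
  have iX: "integrable ?M (\<lambda>x. X x powr p)"
  proof -
    have "integrable ?M (\<lambda>x. (1 / (p - 1)) * - (flux p A G x \<bullet> (c2 E x *\<^sub>R G x)))"
      by (intro integrable_mult_right integrable_minus i2)
    also have "?this \<longleftrightarrow> ?thesis"
      using p eq2 by (intro Bochner_Integration.integrable_cong refl) (auto simp: sp)
    finally show ?thesis .
  qed
  have iY: "integrable ?M (\<lambda>x. Y x powr p)"
    unfolding Y_def using nA_Lp_finite[OF Cs C\<Omega> _ DLp] admissible_matrix_measurable(2)[OF A Cs C\<Omega>]
    by (auto simp: integrable_iff_bounded)
  have "(p - 1) * (\<integral>x. X x powr p \<partial>?M) = (\<integral>x. (p - 1) * X x powr p \<partial>?M)"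
    by simp
  also have "\<dots> = (\<integral>x. flux p A G x \<bullet> (c1 E x *\<^sub>R D x) \<partial>?M)"
    unfolding id using eq2 by (intro Bochner_Integration.integral_cong refl) (simp add: sp)
  also have "\<dots> \<le> (\<integral>x. (p - 1) * \<beta> * X x powr p + \<beta> powr (1 - p) * Y x powr p \<partial>?M)"
    by (intro integral_mono i1 Bochner_Integration.integrable_add integrable_mult_right iX iY) (use le1 sp in auto)
  also have "\<dots> = (p - 1) * \<beta> * (\<integral>x. X x powr p \<partial>?M) + \<beta> powr (1 - p) * (\<integral>x. Y x powr p \<partial>?M)"
    using iX iY by simp
  finally have "(p - 1) * (1 - \<beta>) * (\<integral>x. X x powr p \<partial>?M) \<le> \<beta> powr (1 - p) * (\<integral>x. Y x powr p \<partial>?M)"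
    by (simp add: algebra_simps)
  \<comment> \<open>What is left of the weighted term after absorbing the share
    \<open>(p - 1) * \<beta>\<close>.\<close>
  moreover have "(p - 1) * (1 - \<beta>) = \<beta>"
    using p by (simp add: \<beta>_def field_simps)
  ultimately have ineq: "\<beta> * (\<integral>x. X x powr p \<partial>?M) \<le> \<beta> powr (1 - p) * (\<integral>x. Y x powr p \<partial>?M)" by simp
  have \<beta>: "0 < \<beta>" using p by (simp add: \<beta>_def)
  have "\<beta> powr (p - 1) * (\<beta> * (\<integral>x. X x powr p \<partial>?M)) \<le> \<beta> powr (p - 1) * (\<beta> powr (1 - p) * (\<integral>x. Y x powr p \<partial>?M))"
    by (intro mult_left_mono ineq) auto
  then have fin: "\<beta> powr p * (\<integral>x. X x powr p \<partial>?M) \<le> (\<integral>x. Y x powr p \<partial>?M)"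
    using \<beta> by (simp add: powr_diff)
  have "ennreal (\<beta> powr p) * (\<integral>\<^sup>+x. ennreal (X x powr p) \<partial>?M) = ennreal (\<beta> powr p * (\<integral>x. X x powr p \<partial>?M))"
    using iX by (subst nn_integral_eq_integral) (auto simp: ennreal_mult)
  also have "\<dots> \<le> ennreal (\<integral>x. Y x powr p \<partial>?M)"
    by (rule ennreal_leI[OF fin])
  also have "\<dots> = (\<integral>\<^sup>+x. ennreal (Y x powr p) \<partial>?M)"
    using iY by (subst nn_integral_eq_integral) auto
  finally show ?thesis by (simp add: X_def Y_def)
qed

end

section \<open>The Hardy inequality\<close>

text \<open>Exhaust \<open>U\<close> by compact sets and pass to the pointwise limit.\<close>

lemma in_Lp_loc_measurable:
  fixes f :: "real^'n::finite \<Rightarrow> 'b::euclidean_space"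
  assumes f: "in_Lp_loc q U f" and U: "open U"
  shows "f \<in> borel_measurable (lebesgue_on U)"
proof (rule open_Union_compact_subsets[OF U])
  fix C :: "nat \<Rightarrow> (real^'n) set"
  assume C: "\<And>n. compact (C n)" "\<And>n. C n \<subseteq> U" "\<And>L. \<lbrakk>compact L; L \<subseteq> U\<rbrakk> \<Longrightarrow> \<exists>N. \<forall>n\<ge>N. L \<subseteq> C n"
  have "(\<lambda>x. indicator U x *\<^sub>R f x) \<in> borel_measurable lebesgue"
  proof (rule borel_measurable_LIMSEQ_metric)
    show "(\<lambda>x. indicator (C n) x *\<^sub>R f x) \<in> borel_measurable lebesgue" for n
      using f C(1,2) by (auto simp: in_Lp_loc_def in_Lp_def set_borel_measurable_def)
    show "(\<lambda>n. indicator (C n) x *\<^sub>R f x) \<longlonglongrightarrow> indicator U x *\<^sub>R f x" for x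
    proof (cases "x \<in> U")
      case True
      then obtain N where "\<And>n. n \<ge> N \<Longrightarrow> x \<in> C n" using C(3)[of "{x}"] by auto
      then show ?thesis
        using True by (intro tendsto_eventually) (auto simp: eventually_sequentially intro!: exI[of _ N])
    next
      case False
      then have "x \<notin> C n" for n using C(2) by blast
      with False show ?thesis by simp
    qed
  qed
  then show ?thesis
    using U by (subst borel_measurable_restrict_space_iff) auto
qed

text \<open>The distance to \<open>K\<close> is not differentiable everywhere, so the indicator of a
  neighbourhood is mollified at scale \<open>r\<close> instead. Its gradient is bounded by the
  integral of \<open>norm (grad J)\<close>, hence \<open>Q\<close> depends on the dimension
  alone.\<close>

lemma cutoff_near_set:
  "\<exists>Q>0. \<forall>(K :: (real^'n::finite) set) r. bounded K \<and> K \<noteq> {} \<and> 0 < r \<longrightarrow>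
     (\<exists>\<eta> D. (\<forall>x. (\<eta> has_derivative (\<lambda>h. D x \<bullet> h)) (at x)) \<and> continuous_on UNIV D \<and>
        (\<forall>x. 0 \<le> \<eta> x \<and> \<eta> x \<le> 1 \<and> norm (D x) \<le> Q / r) \<and>
        (\<forall>x. infdist x K < r \<longrightarrow> \<eta> x = 1) \<and> (\<forall>x. 4 * r \<le> infdist x K \<longrightarrow> \<eta> x = 0 \<and> D x = 0))"
proof -
  obtain Q' where Q': "\<And>\<epsilon>. 0 < \<epsilon> \<Longrightarrow> \<exists>J :: real^'n \<Rightarrow> real. mollifier \<epsilon> J \<and> (\<integral>x. norm (grad J x) \<partial>lebesgue) \<le> Q' / \<epsilon>"
    using ex_mollifier by metis
  define Q where "Q = \<bar>Q'\<bar> + 1"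
  have "\<exists>\<eta> D. (\<forall>x. (\<eta> has_derivative (\<lambda>h. D x \<bullet> h)) (at x)) \<and> continuous_on UNIV D \<and>
        (\<forall>x. 0 \<le> \<eta> x \<and> \<eta> x \<le> 1 \<and> norm (D x) \<le> Q / r) \<and>
        (\<forall>x. infdist x K < r \<longrightarrow> \<eta> x = 1) \<and> (\<forall>x. 4 * r \<le> infdist x K \<longrightarrow> \<eta> x = 0 \<and> D x = 0)"
    if K: "bounded K" "K \<noteq> {}" and r: "0 < r" for K :: "(real^'n) set" and r
  proof -
    obtain J :: "real^'n \<Rightarrow> real" where J: "mollifier r J" and Jg: "(\<integral>x. norm (grad J x) \<partial>lebesgue) \<le> Q' / r"
      using Q'[OF r] by blast
    \<comment> \<open>Width \<open>2 * r\<close> makes the whole averaging ball lie in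
      \<open>S\<close> at distance below \<open>r\<close> from \<open>K\<close> and miss
      \<open>S\<close> at distance \<open>4 * r\<close> or more.\<close>
    define S where "S = {x. infdist x K \<le> 2 * r}"
    define f where "f = (indicator S :: real^'n \<Rightarrow> real)"
    have "closed S" unfolding S_def by (intro closed_Collect_le continuous_intros)
    moreover have "bounded S"
    proof -
      obtain B where B: "\<And>y. y \<in> K \<Longrightarrow> norm y \<le> B" using K(1) by (auto simp: bounded_iff)
      have "norm x \<le> B + 3 * r" if "x \<in> S" for x
      proof -
        have "infdist x K < 3 * r" using that r by (simp add: S_def)
        then obtain y where y: "y \<in> K" "dist x y < 3 * r"
          using K(2) by (auto simp: infdist_def cInf_less_iff)
        then show ?thesis using B[OF y(1)] norm_triangle_sub[of x y] by (simp add: dist_norm)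
      qed
      then show ?thesis by (auto simp: bounded_iff)
    qed
    ultimately have "compact S" by (simp add: compact_eq_bounded_closed)
    then have f: "integrable lebesgue f"
      unfolding f_def using lmeasurable_compact[of S] by (intro integrable_real_indicator) (auto simp: fmeasurable_def)
    define \<eta> where "\<eta> = mollify J f"
    have smooth: "smooth_on UNIV \<eta>"
      unfolding \<eta>_def by (rule smooth_mollify[OF mollifierD(1)[OF J] f])
    have gJ: "grad J z = 0" if "r < norm z" for z
    proof -
      have "(J has_derivative (\<lambda>h. 0)) (at z)"
        by (rule has_derivative_transform_within_open[where s="- cball 0 r" and f="\<lambda>_. 0"])
          (use mollifierD(3)[OF J] that in auto)
      then show ?thesis using grad_eqI[of J 0 z] by simp
    qed
    have gr: "grad \<eta> x = (\<integral>y. f y *\<^sub>R grad J (x - y) \<partial>lebesgue)" for x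
      unfolding \<eta>_def by (rule grad_eqI[OF mollify_has_derivative[OF mollifierD(5)[OF J] f]])
    note gJm = lebesgue_measurable_continuous[OF continuous_on_norm[OF C1cD(2)[OF mollifierD(5)[OF J]]]]
    have igJ: "integrable lebesgue (\<lambda>y. norm (grad J (x - y)))" for x
    proof -
      have "integrable lebesgue (\<lambda>y. norm (grad J y))"
        by (rule C1c_support[OF mollifierD(5)[OF J]])
          (rule integrable_norm[OF compact_support_integrable[OF C1cD(2)[OF mollifierD(5)[OF J]]]])
      then have "integrable (distr lebesgue lebesgue (\<lambda>y. x - y)) (\<lambda>y. norm (grad J y))"
        by (simp only: distr_lebesgue_reflect(1))
      then show ?thesis
        using gJm by (subst (asm) integrable_distr_eq) (auto intro: distr_lebesgue_reflect)
    qed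
    have b1: "0 \<le> \<eta> x" "\<eta> x \<le> 1" for x
      unfolding \<eta>_def by (rule mollify_ge[OF J f], simp add: f_def) (rule mollify_le[OF J f], simp add: f_def indicator_def)
    have b2: "norm (grad \<eta> x) \<le> Q / r" for x
    proof -
      have "norm (grad \<eta> x) \<le> (\<integral>y. norm (grad J (x - y)) \<partial>lebesgue)"
        unfolding gr
        by (rule Bochner_Integration.integral_norm_bound_integral[OF C1c_grad_integrable[OF mollifierD(5)[OF J] f] igJ])
          (auto simp: f_def indicator_def)
      also have "\<dots> = (\<integral>y. norm (grad J y) \<partial>lebesgue)"
        by (rule lebesgue_integral_reflect[OF gJm])
      also have "\<dots> \<le> Q' / r" by (rule Jg)
      also have "\<dots> \<le> Q / r" using r by (intro divide_right_mono) (auto simp: Q_def)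
      finally show ?thesis .
    qed
    have b3: "\<eta> x = 1" if "infdist x K < r" for x
    proof -
      have "f y = 1" if "y \<in> cball x r" for y
        using infdist_triangle[of y K x] that \<open>infdist x K < r\<close> by (auto simp: f_def S_def dist_commute)
      then have "1 \<le> \<eta> x" unfolding \<eta>_def by (intro mollify_ge[OF J f]) auto
      with b1(2)[of x] show ?thesis by simp
    qed
    have b4: "\<eta> x = 0" "grad \<eta> x = 0" if "4 * r \<le> infdist x K" for x
    proof -
      have f0: "f y = 0" if "y \<in> cball x r" for y
        using infdist_triangle[of x K y] that \<open>4 * r \<le> infdist x K\<close> r by (auto simp: f_def S_def)
      then have "\<eta> x \<le> 0" unfolding \<eta>_def by (intro mollify_le[OF J f]) auto
      with b1(1)[of x] show "\<eta> x = 0" by simp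
      have "f y *\<^sub>R grad J (x - y) = 0" for y
        using f0[of y] gJ[of "x - y"] by (cases "y \<in> cball x r") (auto simp: dist_norm)
      then have "(\<lambda>y. f y *\<^sub>R grad J (x - y)) = (\<lambda>y. 0)" by (rule ext)
      then show "grad \<eta> x = 0" by (simp only: gr integral_zero)
    qed
    show ?thesis
      using smooth_has_derivative[OF smooth] smooth_continuous_grad[OF smooth] b1 b2 b3 b4
      by (intro exI[of _ \<eta>] exI[of _ "grad \<eta>"]) auto
  qed
  moreover have "0 < Q" by (simp add: Q_def)
  ultimately show ?thesis by blast
qed

context p_potential
begin

abbreviation (input) "U \<equiv> \<Omega> - K"

abbreviation (input) "M \<equiv> lebesgue_on (\<Omega> - K)"

lemma U_sets: "\<Omega> - K \<in> sets lebesgue"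
  using open_U by simp

text \<open>\<open>K\<close> is a null set, so integrals over \<Omega> move to \<Omega> - K, where
  \<open>E\<close> is positive and \<open>G\<close> is its weak gradient.\<close>

lemma nn_integral_Omega:
  "(\<integral>\<^sup>+x\<in>\<Omega>. f x \<partial>lebesgue) = (\<integral>\<^sup>+x. f x \<partial>M)"
proof -
  have "(\<integral>\<^sup>+x. f x \<partial>M) = (\<integral>\<^sup>+x. f x * indicator (\<Omega> - K) x \<partial>lebesgue)"
    using U_sets by (intro nn_integral_restrict_space) auto
  also have "\<dots> = (\<integral>\<^sup>+x. f x * indicator \<Omega> x \<partial>lebesgue)"
    using AE_not_K by (intro nn_integral_cong_AE) (auto elim!: eventually_mono simp: indicator_def)
  finally show ?thesis by simp
qed

lemma measurable_E: "E \<in> borel_measurable M" and measurable_G: "G \<in> borel_measurable M"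
proof -
  have "in_Lp_loc p U E" "in_Lp_loc p U G"
    using E_sol by (auto simp: solves_measure_equation_def in_W1p_loc_def)
  then show "E \<in> borel_measurable M" "G \<in> borel_measurable M"
    by (auto intro: in_Lp_loc_measurable open_U)
qed

lemma measurable_nA: "V \<in> borel_measurable M \<Longrightarrow> (\<lambda>x. norm_A (A x) (V x)) \<in> borel_measurable M"
  by (rule admissible_matrix_measurable(2)[OF A U_sets]) auto

text \<open>The shifts \<open>1 / (k + 1)\<close> tend to 0 under Fatou's lemma. The weighted
  integrand vanishes off the support \<open>C\<close> of \<psi>, so its integral over
  \<open>C\<close> is the one over \<Omega> - K.\<close>

lemma hardy_C1c:
  assumes \<psi>: "C1c (\<Omega> - K) \<psi> D"
  shows "ennreal (((p - 1) / p) powr p) * (\<integral>\<^sup>+x. ennreal (norm_A (A x) (G x) powr p / E x powr p * \<bar>\<psi> x\<bar> powr p) \<partial>M)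
     \<le> (\<integral>\<^sup>+x. ennreal (norm_A (A x) (D x) powr p) \<partial>M)"
proof -
  let ?\<beta> = "ennreal (((p - 1) / p) powr p)"
  obtain C where C: "compact C" "C \<subseteq> \<Omega> - K" "\<And>x. x \<notin> C \<Longrightarrow> \<psi> x = 0" "\<And>x. x \<notin> C \<Longrightarrow> D x = 0"
    using \<psi> by (rule C1c_support) blast
  have Cs: "C \<in> sets lebesgue" "C \<subseteq> \<Omega>"
    using C by (auto intro: lmeasurable_compact fmeasurableD)
  let ?N = "lebesgue_on C"
  have sp: "space ?N = C" by (simp add: space_restrict_space)
  have [measurable]: "G \<in> borel_measurable ?N" "E \<in> borel_measurable ?N"
    using in_Lp_E(1,2)[OF C(1,2)] Cs by (auto simp: in_Lp_iff)
  have [measurable]: "(\<lambda>x. norm_A (A x) (G x)) \<in> borel_measurable ?N"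
    by (rule admissible_matrix_measurable(2)[OF A Cs]) measurable
  have [measurable]: "\<psi> \<in> borel_measurable ?N"
    by (intro measurable_restrict_space1 lebesgue_measurable_continuous C1cD(3)[OF \<psi>])
  define F where "F \<delta> x = (\<bar>\<psi> x\<bar> * norm_A (A x) (G x) / (E x + \<delta>)) powr p" for \<delta> x
  have Fm[measurable]: "F \<delta> \<in> borel_measurable ?N" for \<delta>
    unfolding F_def by measurable
  have "(\<integral>\<^sup>+x. ?\<beta> * ennreal (F 0 x) \<partial>?N) \<le> (\<integral>\<^sup>+x. ennreal (norm_A (A x) (D x) powr p) \<partial>?N)"
  proof (rule nn_integral_le_limit[where f="\<lambda>k x. ?\<beta> * ennreal (F (inverse (real (Suc k))) x)", OF _ _ _ tendsto_const])
    show "(\<integral>\<^sup>+x. ?\<beta> * ennreal (F (inverse (real (Suc k))) x) \<partial>?N) \<le> (\<integral>\<^sup>+x. ennreal (norm_A (A x) (D x) powr p) \<partial>?N)" for k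
      using hardy_C1c_shifted[OF \<psi> C, of "inverse (real (Suc k))"] by (simp add: nn_integral_cmult) (simp add: F_def)
    show "AE x in ?N. (\<lambda>k. ?\<beta> * ennreal (F (inverse (real (Suc k))) x)) \<longlonglongrightarrow> ?\<beta> * ennreal (F 0 x)"
    proof (rule AE_I2)
      fix x assume "x \<in> space ?N"
      then have x: "0 < E x" "x \<in> \<Omega>" using E_pos C(2) Cs(2) sp by auto
      have "(\<lambda>k. F (inverse (real (Suc k))) x) \<longlonglongrightarrow> F 0 x"
        unfolding F_def using x(1) p nA_nonneg[OF x(2)]
        by (intro tendsto_powr' tendsto_intros LIMSEQ_inverse_real_of_nat) (auto intro!: always_eventually divide_nonneg_nonneg mult_nonneg_nonneg add_nonneg_nonneg)
      then show "(\<lambda>k. ?\<beta> * ennreal (F (inverse (real (Suc k))) x)) \<longlonglongrightarrow> ?\<beta> * ennreal (F 0 x)"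
        by (intro ennreal_tendsto_cmult tendsto_ennrealI) auto
    qed
  qed measurable
  also have "(\<integral>\<^sup>+x. ennreal (norm_A (A x) (D x) powr p) \<partial>?N) \<le> (\<integral>\<^sup>+x. ennreal (norm_A (A x) (D x) powr p) \<partial>M)"
    using Cs(1) C(2) U_sets by (simp add: nn_integral_restrict_space) (auto intro!: nn_integral_mono simp: indicator_def)
  finally have le: "(\<integral>\<^sup>+x. ?\<beta> * ennreal (F 0 x) \<partial>?N) \<le> (\<integral>\<^sup>+x. ennreal (norm_A (A x) (D x) powr p) \<partial>M)" .
  have "ennreal (norm_A (A x) (G x) powr p / E x powr p * \<bar>\<psi> x\<bar> powr p) * indicator (\<Omega> - K) x = ennreal (F 0 x) * indicator C x" for x
  proof (cases "x \<in> C")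
    case True
    then have "0 < E x" using E_pos C(2) by auto
    then have "F 0 x = norm_A (A x) (G x) powr p / E x powr p * \<bar>\<psi> x\<bar> powr p"
      by (simp add: F_def powr_mult powr_divide)
    with True C(2) show ?thesis by auto
  qed (use C(3) p in auto)
  then have "(\<integral>\<^sup>+x. ennreal (norm_A (A x) (G x) powr p / E x powr p * \<bar>\<psi> x\<bar> powr p) \<partial>M) = (\<integral>\<^sup>+x. ennreal (F 0 x) \<partial>?N)"
    using Cs(1) U_sets by (simp add: nn_integral_restrict_space)
  moreover have "(\<integral>\<^sup>+x. ?\<beta> * ennreal (F 0 x) \<partial>?N) = ?\<beta> * (\<integral>\<^sup>+x. ennreal (F 0 x) \<partial>?N)"
    by (rule nn_integral_cmult) measurable
  ultimately show ?thesis using le by simp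
qed

end

text \<open>By \<open>thin\<close>, a cutoff living in the \<open>r\<close>-neighbourhood of
  \<open>K\<close> with gradient of order \<open>1 / r\<close> has energy at most a constant times
  \<open>e\<close>: the p-capacity of \<open>K\<close> is 0. Suitable arbitrarily small radii are
  enough for this.\<close>

locale p_potential_null_capacity = p_potential \<Omega> K A p \<mu> E G
  for \<Omega> K :: "(real^'n::finite) set" and A p \<mu> E G +
  assumes K_nonempty: "K \<noteq> {}"
    and thin: "\<And>e. 0 < e \<Longrightarrow> \<exists>r. 0 < r \<and> r < e \<and> emeasure lebesgue {x. infdist x K < r} \<le> ennreal (e * r powr p)"
begin

lemma hardy_C1c_Omega:
  assumes \<phi>: "C1c \<Omega> \<phi> D"
  shows "ennreal (((p - 1) / p) powr p) * (\<integral>\<^sup>+x. ennreal (norm_A (A x) (G x) powr p / E x powr p * \<bar>\<phi> x\<bar> powr p) \<partial>M)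
     \<le> (\<integral>\<^sup>+x. ennreal (norm_A (A x) (D x) powr p) \<partial>M)"
proof -
  let ?\<beta> = "ennreal (((p - 1) / p) powr p)"
  obtain C where C: "compact C" "C \<subseteq> \<Omega>" "\<And>x. x \<notin> C \<Longrightarrow> \<phi> x = 0" "\<And>x. x \<notin> C \<Longrightarrow> D x = 0"
    using \<phi> by (rule C1c_support) blast
  obtain B\<phi> where B\<phi>: "0 < B\<phi>" "\<And>x. norm (\<phi> x) \<le> B\<phi>"
    using compact_support_bounded[OF C1cD(3)[OF \<phi>] C(1,3)] by blast
  obtain BD where BD: "0 < BD" "\<And>x. norm (D x) \<le> BD"
    using compact_support_bounded[OF C1cD(2)[OF \<phi>] C(1,4)] by blast
  obtain Q where Q: "0 < Q" and cut: "\<And>r. 0 < r \<Longrightarrow>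
     (\<exists>\<eta> D. (\<forall>x. (\<eta> has_derivative (\<lambda>h. D x \<bullet> h)) (at x)) \<and> continuous_on UNIV D \<and>
        (\<forall>x. 0 \<le> \<eta> x \<and> \<eta> x \<le> 1 \<and> norm (D x) \<le> Q / r) \<and>
        (\<forall>x. infdist x K < r \<longrightarrow> \<eta> x = 1) \<and> (\<forall>x. 4 * r \<le> infdist x K \<longrightarrow> \<eta> x = 0 \<and> D x = 0))"
    using cutoff_near_set K_nonempty compact_imp_bounded[OF K(1)] by metis
  obtain r where r: "\<And>k::nat. 0 < r k" "\<And>k. r k < inverse (Suc k)"
    "\<And>k. emeasure lebesgue {x. infdist x K < r k} \<le> ennreal (inverse (Suc k) * r k powr p)"
    using thin[of "inverse (Suc k)" for k :: nat] by (metis inverse_positive_iff_positive of_nat_0_less_iff zero_less_Suc)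
  \<comment> \<open>Taken at \<open>r k / 4\<close>, the cutoff and its gradient vanish at distance
    \<open>r k\<close> or more, so they live on the set whose measure is controlled.\<close>
  obtain \<eta> D\<eta> where \<eta>: "\<And>k x. ((\<eta> k) has_derivative (\<lambda>h. D\<eta> k x \<bullet> h)) (at x)" "\<And>k::nat. continuous_on UNIV (D\<eta> k)"
    "\<And>k x. 0 \<le> \<eta> k x" "\<And>k x. \<eta> k x \<le> 1" "\<And>k x. norm (D\<eta> k x) \<le> Q / (r k / 4)"
    "\<And>k x. infdist x K < r k / 4 \<Longrightarrow> \<eta> k x = 1"
    "\<And>k x. r k \<le> infdist x K \<Longrightarrow> \<eta> k x = 0" "\<And>k x. r k \<le> infdist x K \<Longrightarrow> D\<eta> k x = 0"
  proof -
    have "\<forall>k. \<exists>\<eta>D. (\<forall>x. (fst \<eta>D has_derivative (\<lambda>h. snd \<eta>D x \<bullet> h)) (at x)) \<and> continuous_on UNIV (snd \<eta>D) \<and>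
        (\<forall>x. 0 \<le> fst \<eta>D x \<and> fst \<eta>D x \<le> 1 \<and> norm (snd \<eta>D x) \<le> Q / (r k / 4)) \<and>
        (\<forall>x. infdist x K < r k / 4 \<longrightarrow> fst \<eta>D x = 1) \<and> (\<forall>x. r k \<le> infdist x K \<longrightarrow> fst \<eta>D x = 0 \<and> snd \<eta>D x = 0)"
      using cut[of "r k / 4" for k] r(1) by simp
    then obtain \<eta>D where h: "\<And>k. (\<forall>x. (fst (\<eta>D k) has_derivative (\<lambda>h. snd (\<eta>D k) x \<bullet> h)) (at x)) \<and> continuous_on UNIV (snd (\<eta>D k)) \<and>
        (\<forall>x. 0 \<le> fst (\<eta>D k) x \<and> fst (\<eta>D k) x \<le> 1 \<and> norm (snd (\<eta>D k) x) \<le> Q / (r k / 4)) \<and>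
        (\<forall>x. infdist x K < r k / 4 \<longrightarrow> fst (\<eta>D k) x = 1) \<and> (\<forall>x. r k \<le> infdist x K \<longrightarrow> fst (\<eta>D k) x = 0 \<and> snd (\<eta>D k) x = 0)"
      by metis
    show thesis
      by (rule that[of "\<lambda>k. fst (\<eta>D k)" "\<lambda>k. snd (\<eta>D k)"]) (use h in blast)+
  qed
  have \<eta>cont: "continuous_on UNIV (\<eta> k)" for k
    by (meson continuous_at_imp_continuous_on \<eta>(1) has_derivative_continuous)
  have r1: "r k < 1" for k
  proof -
    have "inverse (real (Suc k)) \<le> 1" by (simp add: inverse_le_1_iff)
    with r(2)[of k] show ?thesis by linarith
  qed
  define \<psi> where "\<psi> k x = \<phi> x * (1 - \<eta> k x)" for k x
  define D\<psi> where "D\<psi> k x = (1 - \<eta> k x) *\<^sub>R D x - \<phi> x *\<^sub>R D\<eta> k x" for k x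
  have \<psi>: "C1c (\<Omega> - K) (\<psi> k) (D\<psi> k)" for k
  proof (rule C1cI)
    show "(\<psi> k has_derivative (\<lambda>h. D\<psi> k x \<bullet> h)) (at x)" for x
      unfolding \<psi>_def D\<psi>_def
      by (rule has_derivative_eq_rhs, (rule derivative_eq_intros C1cD(1)[OF \<phi>] \<eta>(1) refl)+)
        (auto simp: inner_diff_left algebra_simps)
    show "continuous_on UNIV (D\<psi> k)"
      unfolding D\<psi>_def by (intro continuous_intros \<eta>cont \<eta>(2) C1cD[OF \<phi>])
    \<comment> \<open>Since \<open>\<eta> k\<close> equals 1 near \<open>K\<close>, the factor
      \<open>1 - \<eta> k\<close> pushes the support away from \<open>K\<close>.\<close>
    show "compact (C \<inter> {x. r k / 4 \<le> infdist x K})"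
      by (intro compact_Int_closed C(1) closed_Collect_le continuous_intros)
    show "C \<inter> {x. r k / 4 \<le> infdist x K} \<subseteq> \<Omega> - K"
      using C(2) r(1)[of k] by auto
    show "\<psi> k x = 0" if "x \<notin> C \<inter> {x. r k / 4 \<le> infdist x K}" for x
      using that C(3)[of x] \<eta>(6)[of x k] by (auto simp: \<psi>_def not_le)
  qed
  define P where "P = sqrt \<Lambda> * (BD + 4 * B\<phi> * Q)"
  have P: "0 \<le> P" unfolding P_def using \<Lambda>(1) BD(1) B\<phi>(1) Q by simp
  \<comment> \<open>Outside the neighbourhood the gradient is \<open>D\<close> itself, so the energy
    of \<open>D\<close> enters with factor 1; the crude bound \<open>P / r k\<close> is confined to
    a set of small measure.\<close>
  have pt: "ennreal (norm_A (A x) (D\<psi> k x) powr p) \<le> ennreal (norm_A (A x) (D x) powr p) +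
     ennreal (P powr p * r k powr (- p)) * indicator {x. infdist x K < r k} x" if x: "x \<in> \<Omega>" for x k
  proof (cases "infdist x K < r k")
    case False
    then show ?thesis using \<eta>(7,8)[of k x] by (simp add: D\<psi>_def)
  next
    case True
    have "norm (D\<psi> k x) \<le> norm ((1 - \<eta> k x) *\<^sub>R D x) + norm (\<phi> x *\<^sub>R D\<eta> k x)"
      unfolding D\<psi>_def by (rule norm_triangle_ineq4)
    also have "\<dots> \<le> 1 * BD + B\<phi> * (Q / (r k / 4))"
      unfolding norm_scaleR using \<eta>(3,4)[of k x] BD B\<phi> \<eta>(5)[of k x] by (intro add_mono mult_mono) auto
    \<comment> \<open>\<open>r k < 1\<close> brings the bounded part under the same
      denominator.\<close>
    also have "\<dots> \<le> BD / r k + B\<phi> * (Q / (r k / 4))"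
      using BD(1) r1[of k] r(1)[of k] by (intro add_right_mono) (simp add: le_divide_eq mult_left_le)
    also have "\<dots> = (BD + 4 * B\<phi> * Q) / r k"
      by (simp add: add_divide_distrib)
    finally have "sqrt \<Lambda> * norm (D\<psi> k x) \<le> P / r k"
      using \<Lambda>(1) unfolding P_def times_divide_eq_right[symmetric] by (intro mult_left_mono) auto
    then have "norm_A (A x) (D\<psi> k x) \<le> P / r k"
      using nA_le[OF x, of "D\<psi> k x"] by linarith
    then have "norm_A (A x) (D\<psi> k x) powr p \<le> (P / r k) powr p"
      using nA_nonneg[OF x] p by (intro powr_mono2) auto
    also have "\<dots> = P powr p * r k powr (- p)"
      using r(1)[of k] by (simp add: powr_divide powr_minus_divide)
    finally have "ennreal (norm_A (A x) (D\<psi> k x) powr p) \<le> ennreal (P powr p * r k powr (- p))"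
      by (rule ennreal_leI)
    with True show ?thesis by (simp add: add_increasing)
  qed
  have [measurable]: "D \<in> borel_measurable M"
    by (intro measurable_restrict_space1 lebesgue_measurable_continuous C1cD(2)[OF \<phi>])
  note [measurable] = measurable_nA[OF \<open>D \<in> borel_measurable M\<close>] measurable_E measurable_nA[OF measurable_G]
  define J where "J = (\<integral>\<^sup>+x. ennreal (norm_A (A x) (D x) powr p) \<partial>M)"
  define F where "F f x = norm_A (A x) (G x) powr p / E x powr p * \<bar>f x\<bar> powr p" for f x
  have bound: "?\<beta> * (\<integral>\<^sup>+x. ennreal (F (\<psi> k) x) \<partial>M) \<le> J + ennreal (P powr p * inverse (Suc k))" for k
  proof -
    let ?S = "{x. infdist x K < r k}"
    have S: "?S \<in> sets lebesgue"
      using open_Collect_less[of "\<lambda>x. infdist x K" "\<lambda>_. r k"] by (simp add: continuous_on_infdist continuous_on_id)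
    have "?\<beta> * (\<integral>\<^sup>+x. ennreal (F (\<psi> k) x) \<partial>M) \<le> (\<integral>\<^sup>+x. ennreal (norm_A (A x) (D\<psi> k x) powr p) \<partial>M)"
      unfolding F_def by (rule hardy_C1c[OF \<psi>])
    also have "\<dots> \<le> (\<integral>\<^sup>+x. ennreal (norm_A (A x) (D x) powr p) + ennreal (P powr p * r k powr (- p)) * indicator ?S x \<partial>M)"
      by (intro nn_integral_mono pt) (auto simp: space_restrict_space)
    also have "\<dots> = J + (\<integral>\<^sup>+x. ennreal (P powr p * r k powr (- p)) * indicator ?S x \<partial>M)"
    proof -
      have "(\<lambda>x. ennreal (P powr p * r k powr (- p)) * indicator ?S x) \<in> borel_measurable M"
        using S by (intro measurable_restrict_space1 borel_measurable_times_ennreal borel_measurable_const borel_measurable_indicator)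
      moreover have "(\<lambda>x. ennreal (norm_A (A x) (D x) powr p)) \<in> borel_measurable M" by measurable
      ultimately show ?thesis unfolding J_def by (intro nn_integral_add)
    qed
    also have "(\<integral>\<^sup>+x. ennreal (P powr p * r k powr (- p)) * indicator ?S x \<partial>M) \<le>
       (\<integral>\<^sup>+x. ennreal (P powr p * r k powr (- p)) * indicator ?S x \<partial>lebesgue)"
      using U_sets by (subst nn_integral_restrict_space) (auto intro!: nn_integral_mono simp: indicator_def)
    also have "\<dots> = ennreal (P powr p * r k powr (- p)) * emeasure lebesgue ?S"
      by (rule nn_integral_cmult_indicator[OF S])
    also have "\<dots> \<le> ennreal (P powr p * r k powr (- p)) * ennreal (inverse (Suc k) * r k powr p)"
      by (intro mult_left_mono r(3)) auto
    also have "\<dots> = ennreal (P powr p * inverse (Suc k))"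
      using r(1)[of k] by (simp add: powr_minus field_simps flip: ennreal_mult)
    finally show ?thesis by simp
  qed
  have Fm: "F f \<in> borel_measurable M" if "continuous_on UNIV f" for f
  proof -
    have [measurable]: "f \<in> borel_measurable M"
      by (intro measurable_restrict_space1 lebesgue_measurable_continuous that)
    show ?thesis unfolding F_def by measurable
  qed
  note [measurable] = Fm[OF C1cD(3)[OF \<psi>]] Fm[OF C1cD(3)[OF \<phi>]]
  have "(\<integral>\<^sup>+x. ?\<beta> * ennreal (F \<phi> x) \<partial>M) \<le> J"
  proof (rule nn_integral_le_limit)
    show "(\<lambda>x. ?\<beta> * ennreal (F (\<psi> k) x)) \<in> borel_measurable M" for k by measurable
    show "(\<integral>\<^sup>+x. ?\<beta> * ennreal (F (\<psi> k) x) \<partial>M) \<le> J + ennreal (P powr p * inverse (Suc k))" for k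
      using bound[of k] by (simp add: nn_integral_cmult)
    have "(\<lambda>k. J + ennreal (P powr p * inverse (Suc k))) \<longlonglongrightarrow> J + ennreal (P powr p * 0)"
      by (intro tendsto_add tendsto_const tendsto_ennrealI tendsto_mult LIMSEQ_inverse_real_of_nat)
    then show "(\<lambda>k. J + ennreal (P powr p * inverse (Suc k))) \<longlonglongrightarrow> J" by simp
    show "AE x in M. (\<lambda>k. ?\<beta> * ennreal (F (\<psi> k) x)) \<longlonglongrightarrow> ?\<beta> * ennreal (F \<phi> x)"
    proof (rule AE_I2)
      fix x assume "x \<in> space M"
      then have "x \<notin> K" by (simp add: space_restrict_space)
      then have "0 < infdist x K"
        using K(1) K_nonempty by (intro infdist_pos_not_in_closed) (auto intro: compact_imp_closed)
      \<comment> \<open>Once the radius is below the positive distance of \<open>x\<close> to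
        \<open>K\<close>, the cutoff vanishes at \<open>x\<close> and the integrand no longer
        changes.\<close>
      then have "\<forall>\<^sub>F k in sequentially. inverse (real (Suc k)) < infdist x K"
        by (intro order_tendstoD(2)[OF LIMSEQ_inverse_real_of_nat])
      then have "\<forall>\<^sub>F k in sequentially. ?\<beta> * ennreal (F (\<psi> k) x) = ?\<beta> * ennreal (F \<phi> x)"
      proof eventually_elim
        fix k assume "inverse (real (Suc k)) < infdist x K"
        then have "\<eta> k x = 0" using r(2)[of k] by (intro \<eta>(7)) linarith
        then show "?\<beta> * ennreal (F (\<psi> k) x) = ?\<beta> * ennreal (F \<phi> x)" by (simp add: F_def \<psi>_def)
      qed
      then show "(\<lambda>k. ?\<beta> * ennreal (F (\<psi> k) x)) \<longlonglongrightarrow> ?\<beta> * ennreal (F \<phi> x)"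
        by (rule tendsto_eventually)
    qed
  qed
  then show ?thesis
    by (simp add: nn_integral_cmult J_def) (simp add: F_def)
qed

text \<open>The energies of the approximants and of \<open>u\<close> are compared by
  \<open>powr_add_le\<close>. The index tends to infinity for fixed \<open>t\<close>, and afterwards
  \<open>t\<close> tends to 0, which restores the factor 1 in front of the energy of
  \<open>u\<close>.\<close>

lemma hardy_W1p_0:
  assumes u: "in_W1p_0 p \<Omega> u Du"
  shows "ennreal (((p - 1) / p) powr p) * (\<integral>\<^sup>+x. ennreal (norm_A (A x) (G x) powr p / E x powr p * \<bar>u x\<bar> powr p) \<partial>M)
     \<le> (\<integral>\<^sup>+x. ennreal (norm_A (A x) (Du x) powr p) \<partial>M)"
proof -
  let ?\<beta> = "ennreal (((p - 1) / p) powr p)"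
  have sub: "\<Omega> - K \<subseteq> \<Omega>" by auto
  have W: "in_Lp p \<Omega> u" "in_Lp p \<Omega> Du" using u by (auto simp: in_W1p_0_def in_W1p_def)
  obtain \<phi> where \<phi>: "\<And>k::nat. test_function \<Omega> (\<phi> k)" and
    lim: "(\<lambda>k. \<integral>\<^sup>+x\<in>\<Omega>. ennreal (\<bar>\<phi> k x - u x\<bar> powr p + norm (grad (\<phi> k) x - Du x) powr p) \<partial>lebesgue) \<longlonglongrightarrow> 0"
    using u by (auto simp: in_W1p_0_def)
  note C1 = test_function_C1c[OF \<phi>]
  have restr: "f \<in> borel_measurable M" if "f \<in> borel_measurable (lebesgue_on \<Omega>)" for f :: "real^'n \<Rightarrow> 'c::euclidean_space"
    using measurable_restrict_mono[OF that sub] .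
  have [measurable]: "u \<in> borel_measurable M" "Du \<in> borel_measurable M"
    using W by (auto intro!: restr simp: in_Lp_iff[OF Omega_sets])
  have [measurable]: "\<phi> k \<in> borel_measurable M" "grad (\<phi> k) \<in> borel_measurable M" for k
    by (intro measurable_restrict_space1 lebesgue_measurable_continuous C1cD[OF C1])+
  note [measurable] = measurable_nA[OF \<open>Du \<in> borel_measurable M\<close>] measurable_E measurable_nA[OF measurable_G]
  have Dfin: "Lp_int M p Du < \<infinity>"
    using W(2) by (simp add: in_Lp_def nn_integral_Omega)
  have lim': "(\<lambda>k. \<integral>\<^sup>+x. ennreal (\<bar>\<phi> k x - u x\<bar> powr p + norm (grad (\<phi> k) x - Du x) powr p) \<partial>M) \<longlonglongrightarrow> 0"
    using lim by (simp add: nn_integral_Omega)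
  have L1: "Lp_tendsto M p \<phi> u"
    unfolding Lp_tendsto_def using p by (auto intro!: ennreal_tendsto_0_le[OF lim'] nn_integral_mono ennreal_leI)
  have L2: "(\<lambda>k. \<integral>\<^sup>+x. ennreal (norm (grad (\<phi> k) x - Du x) powr p) \<partial>M) \<longlonglongrightarrow> 0"
    by (auto intro!: ennreal_tendsto_0_le[OF lim'] nn_integral_mono ennreal_leI)
  obtain r where r: "strict_mono r" "AE x in M. (\<lambda>k. \<phi> (r k) x) \<longlonglongrightarrow> u x"
    using Lp_tendsto_AE_subseq[OF L1] p by auto
  have L2': "(\<lambda>k. \<integral>\<^sup>+x. ennreal (norm (grad (\<phi> (r k)) x - Du x) powr p) \<partial>M) \<longlonglongrightarrow> 0"
    using LIMSEQ_subseq_LIMSEQ[OF L2 r(1)] by (simp add: comp_def)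
  define F where "F f x = norm_A (A x) (G x) powr p / E x powr p * \<bar>f x\<bar> powr p" for f x
  have Fm[measurable]: "F f \<in> borel_measurable M" if [measurable]: "f \<in> borel_measurable M" for f
    unfolding F_def by measurable
  define J where "J = (\<integral>\<^sup>+x. ennreal (norm_A (A x) (Du x) powr p) \<partial>M)"
  have J: "J < \<infinity>" unfolding J_def
    by (rule nA_Lp_finite[OF U_sets sub _ Dfin]) measurable
  have le: "(\<integral>\<^sup>+x. ?\<beta> * ennreal (F u x) \<partial>M) \<le> ennreal ((1 - t) powr (1 - p)) * J" if t: "0 < t" "t < 1" for t
  proof (rule nn_integral_le_limit)
    let ?b = "\<lambda>k. ennreal ((1 - t) powr (1 - p)) * J + ennreal (t powr (1 - p) * sqrt \<Lambda> powr p) * Lp_int M p (\<lambda>x. grad (\<phi> (r k)) x - Du x)"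
    show "(\<lambda>x. ?\<beta> * ennreal (F (\<phi> (r k)) x)) \<in> borel_measurable M" for k by measurable
    show "AE x in M. (\<lambda>k. ?\<beta> * ennreal (F (\<phi> (r k)) x)) \<longlonglongrightarrow> ?\<beta> * ennreal (F u x)"
      using r(2)
    proof eventually_elim
      fix x assume "(\<lambda>k. \<phi> (r k) x) \<longlonglongrightarrow> u x"
      then have "(\<lambda>k. \<bar>\<phi> (r k) x\<bar> powr p) \<longlonglongrightarrow> \<bar>u x\<bar> powr p"
        using p by (intro tendsto_powr' tendsto_intros) auto
      then have "(\<lambda>k. F (\<phi> (r k)) x) \<longlonglongrightarrow> F u x"
        unfolding F_def by (intro tendsto_mult tendsto_const)
      then show "(\<lambda>k. ?\<beta> * ennreal (F (\<phi> (r k)) x)) \<longlonglongrightarrow> ?\<beta> * ennreal (F u x)"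
        by (intro ennreal_tendsto_cmult tendsto_ennrealI) auto
    qed
    have "?b \<longlonglongrightarrow> ennreal ((1 - t) powr (1 - p)) * J + ennreal (t powr (1 - p) * sqrt \<Lambda> powr p) * 0"
      by (intro tendsto_add tendsto_const ennreal_tendsto_cmult L2') simp
    then show "?b \<longlonglongrightarrow> ennreal ((1 - t) powr (1 - p)) * J" by simp
    show "(\<integral>\<^sup>+x. ?\<beta> * ennreal (F (\<phi> (r k)) x) \<partial>M) \<le> ?b k" for k
    proof -
      have "(\<integral>\<^sup>+x. ?\<beta> * ennreal (F (\<phi> (r k)) x) \<partial>M) \<le> (\<integral>\<^sup>+x. ennreal (norm_A (A x) (grad (\<phi> (r k)) x) powr p) \<partial>M)"
        using hardy_C1c_Omega[OF C1[of "r k"]] by (simp add: nn_integral_cmult) (simp add: F_def)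
      also have "\<dots> \<le> (\<integral>\<^sup>+x. ennreal ((1 - t) powr (1 - p)) * ennreal (norm_A (A x) (Du x) powr p) +
           ennreal (t powr (1 - p) * sqrt \<Lambda> powr p) * ennreal (norm (grad (\<phi> (r k)) x - Du x) powr p) \<partial>M)"
      proof (rule nn_integral_mono)
        fix x assume "x \<in> space M"
        then have x: "x \<in> \<Omega>" by (simp add: space_restrict_space)
        let ?d = "grad (\<phi> (r k)) x - Du x"
        have "norm_A (A x) (Du x + ?d) \<le> norm_A (A x) (Du x) + norm_A (A x) ?d"
          by (rule nA_triangle[OF x])
        also have "\<dots> \<le> norm_A (A x) (Du x) + sqrt \<Lambda> * norm ?d"
          by (intro add_left_mono nA_le x)
        finally have "norm_A (A x) (grad (\<phi> (r k)) x) powr p \<le> (norm_A (A x) (Du x) + sqrt \<Lambda> * norm ?d) powr p"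
          using p nA_nonneg[OF x] by (intro powr_mono2) auto
        also have "\<dots> \<le> (1 - t) powr (1 - p) * norm_A (A x) (Du x) powr p + t powr (1 - p) * (sqrt \<Lambda> * norm ?d) powr p"
          using \<Lambda>(1) by (intro powr_add_le p nA_nonneg x t) auto
        also have "\<dots> = (1 - t) powr (1 - p) * norm_A (A x) (Du x) powr p + t powr (1 - p) * sqrt \<Lambda> powr p * norm ?d powr p"
          by (simp add: powr_mult)
        finally show "ennreal (norm_A (A x) (grad (\<phi> (r k)) x) powr p) \<le> ennreal ((1 - t) powr (1 - p)) * ennreal (norm_A (A x) (Du x) powr p) +
           ennreal (t powr (1 - p) * sqrt \<Lambda> powr p) * ennreal (norm ?d powr p)"
          by (simp add: ennreal_leI flip: ennreal_mult ennreal_plus)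
      qed
      also have "\<dots> = ?b k"
        unfolding J_def by (subst nn_integral_add) (auto simp: nn_integral_cmult)
      finally show ?thesis .
    qed
  qed
  obtain j where j: "0 \<le> j" "J = ennreal j" using J by (metis ennreal_cases infinity_ennreal_def less_irrefl)
  \<comment> \<open>The doubled successor keeps \<open>t = 1 / (n + 2)\<close> strictly below
    1.\<close>
  have "(\<lambda>n. ennreal ((1 - inverse (real (Suc (Suc n)))) powr (1 - p) * j)) \<longlonglongrightarrow> ennreal ((1 - 0) powr (1 - p) * j)"
    by (intro tendsto_ennrealI tendsto_mult tendsto_const tendsto_powr tendsto_diff LIMSEQ_Suc[OF LIMSEQ_inverse_real_of_nat]) auto
  then have "(\<integral>\<^sup>+x. ?\<beta> * ennreal (F u x) \<partial>M) \<le> ennreal ((1 - 0) powr (1 - p) * j)"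
  proof (rule LIMSEQ_le_const, intro exI[of _ 0] allI impI)
    fix n
    have t: "0 < inverse (real (Suc (Suc n)))" "inverse (real (Suc (Suc n))) < 1"
      by (auto simp: inverse_less_1_iff)
    show "(\<integral>\<^sup>+x. ?\<beta> * ennreal (F u x) \<partial>M) \<le> ennreal ((1 - inverse (real (Suc (Suc n)))) powr (1 - p) * j)"
      using le[OF t] j by (simp add: ennreal_mult)
  qed
  then have "(\<integral>\<^sup>+x. ?\<beta> * ennreal (F u x) \<partial>M) \<le> J" using j by simp
  then show ?thesis by (simp add: nn_integral_cmult J_def) (simp add: F_def)
qed

lemma hardy: "hardy_inequality p A \<Omega> E G (((p - 1) / p) powr p)"
  using hardy_W1p_0 by (simp add: hardy_inequality_def nn_integral_Omega)

end

section \<open>Functions of the potential\<close>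

text \<open>Turns the pointwise limits of \<open>E\<close> at \<open>K\<close> and at the boundary
  into neighbourhoods of these sets. As \<open>Z\<close> and \<open>S\<close> are disjoint, the
  punctured filters omit no point of \<open>S\<close>.\<close>

lemma compact_neighbourhood_property:
  fixes Z S :: "'a::metric_space set"
  assumes "compact Z" "Z \<inter> S = {}" "\<And>z. z \<in> Z \<Longrightarrow> eventually P (at z within S)"
  obtains W where "open W" "Z \<subseteq> W" "\<And>x. x \<in> S \<Longrightarrow> x \<in> W \<Longrightarrow> P x"
proof -
  have "\<exists>d>0. \<forall>x\<in>S. dist x z < d \<longrightarrow> P x" if z: "z \<in> Z" for z
  proof -
    obtain d where "0 < d" "\<And>x. x \<in> S \<Longrightarrow> x \<noteq> z \<Longrightarrow> dist x z < d \<Longrightarrow> P x"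
      using assms(3)[OF z] unfolding eventually_at by blast
    moreover have "z \<notin> S" using z assms(2) by blast
    ultimately show ?thesis by metis
  qed
  then obtain d where d: "\<And>z. z \<in> Z \<Longrightarrow> 0 < d z" "\<And>z x. z \<in> Z \<Longrightarrow> x \<in> S \<Longrightarrow> dist x z < d z \<Longrightarrow> P x"
    by metis
  show thesis
  proof (rule that[of "\<Union>z\<in>Z. ball z (d z)"])
    show "Z \<subseteq> (\<Union>z\<in>Z. ball z (d z))" using d(1) by force
    show "P x" if "x \<in> S" "x \<in> (\<Union>z\<in>Z. ball z (d z))" for x
      using that d(2) by (auto simp: dist_commute)
  qed auto
qed

lemma Lp_tendsto_extend:
  fixes V :: "nat \<Rightarrow> real^'n::finite \<Rightarrow> 'b::euclidean_space"
  assumes V: "Lp_tendsto (lebesgue_on C) p V W" and sets: "C \<in> sets lebesgue" "S \<in> sets lebesgue" "C \<subseteq> S"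
    and z: "\<And>k x. x \<notin> C \<Longrightarrow> V k x = 0" "\<And>x. x \<notin> C \<Longrightarrow> W x = 0" and p: "0 < p"
  shows "Lp_tendsto (lebesgue_on S) p V W"
proof -
  have m: "f \<in> borel_measurable (lebesgue_on S)" if "f \<in> borel_measurable (lebesgue_on C)" "\<And>x. x \<notin> C \<Longrightarrow> f x = 0"
    for f :: "real^'n \<Rightarrow> 'b"
  proof -
    have "(\<lambda>x. indicator C x *\<^sub>R f x) = f" using that(2) by (auto simp: indicator_def)
    then have "f \<in> borel_measurable lebesgue"
      using that(1) sets(1) by (simp add: borel_measurable_restrict_space_iff)
    then show ?thesis by (rule measurable_restrict_space1)
  qed
  have "Lp_int (lebesgue_on S) p (\<lambda>x. V k x - W x) = Lp_int (lebesgue_on C) p (\<lambda>x. V k x - W x)" for k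
    using sets z p by (simp add: nn_integral_restrict_space) (auto intro!: nn_integral_cong simp: indicator_def)
  moreover have "V k \<in> borel_measurable (lebesgue_on S)" for k
    by (rule m) (use V z(1) in \<open>auto simp: Lp_tendsto_def\<close>)
  moreover have "W \<in> borel_measurable (lebesgue_on S)"
    by (rule m) (use V z(2) in \<open>auto simp: Lp_tendsto_def\<close>)
  ultimately show ?thesis using V unfolding Lp_tendsto_def by presburger
qed

lemma Lp_tendsto_0_uniform:
  fixes V :: "nat \<Rightarrow> real^'n::finite \<Rightarrow> 'b::euclidean_space"
  assumes m: "\<And>k. V k \<in> borel_measurable (lebesgue_on S)" and S: "S \<in> lmeasurable" and p: "0 < p"
    and V: "\<And>k x. norm (V k x) \<le> inverse (Suc k)"
  shows "Lp_tendsto (lebesgue_on S) p V (\<lambda>_. 0)"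
proof -
  have bd: "Lp_int (lebesgue_on S) p (V k) \<le> ennreal (inverse (Suc k) powr p * measure lebesgue S)" for k
  proof -
    have "Lp_int (lebesgue_on S) p (V k) \<le> (\<integral>\<^sup>+x. ennreal (inverse (Suc k) powr p) \<partial>lebesgue_on S)"
      using p V by (intro nn_integral_mono ennreal_leI powr_mono2) auto
    also have "\<dots> = ennreal (inverse (Suc k) powr p) * ennreal (measure lebesgue S)"
      using S by (simp add: space_restrict_space emeasure_restrict_space emeasure_eq_measure2 fmeasurableD)
    finally show ?thesis by (simp add: ennreal_mult)
  qed
  have "(\<lambda>k. ennreal (inverse (real (Suc k)) powr p * measure lebesgue S)) \<longlonglongrightarrow> ennreal (0 * measure lebesgue S)"
    using p by (intro tendsto_ennrealI tendsto_mult tendsto_const tendsto_zero_powrI[where b=p] LIMSEQ_inverse_real_of_nat) auto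
  then have "(\<lambda>k. ennreal (inverse (real (Suc k)) powr p * measure lebesgue S)) \<longlonglongrightarrow> 0" by simp
  then have "(\<lambda>k. \<integral>\<^sup>+x. ennreal (norm (V k x) powr p) \<partial>lebesgue_on S) \<longlonglongrightarrow> 0"
    by (rule ennreal_tendsto_0_le) (rule bd)
  then show ?thesis using m by (simp add: Lp_tendsto_def)
qed

context p_potential
begin

text \<open>Layers of widths \<rho>, 2\<rho> and 3\<rho> surround \<open>K\<close> and the
  complement of \<Omega>. Within 3\<rho>, \<open>E\<close> is above \<open>b\<close> or below
  \<open>a\<close>; within \<rho> its values are replaced by \<open>b\<close> or 0. Averages over
  balls of radius at most \<rho> then respect both levels within 2\<rho>, which confines the values
  strictly between \<open>a\<close> and \<open>b\<close>, of \<open>E\<close> and of every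
  \<open>e k\<close>, to one compact set \<open>C\<close>.\<close>

lemma level_approximation:
  assumes blowup: "\<And>x. x \<in> K \<Longrightarrow> filterlim E at_top (at x within (\<Omega> - K))"
    and boundary: "\<And>x. x \<in> frontier \<Omega> \<Longrightarrow> (E \<longlongrightarrow> \<gamma>) (at x within \<Omega>)"
    and ab: "\<gamma> < a" "0 < a"
  obtains C C0 e De where "compact C" "C \<subseteq> \<Omega> - K" "compact C0" "C0 \<subseteq> \<Omega>"
    "\<And>x. x \<in> \<Omega> - K \<Longrightarrow> x \<notin> C \<Longrightarrow> E x \<le> a \<or> b \<le> E x"
    "\<And>k x. ((e k :: real^'n \<Rightarrow> real) has_derivative (\<lambda>h. De k x \<bullet> h)) (at x)"
    "\<And>k :: nat. continuous_on UNIV (De k)"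
    "Lp_tendsto (lebesgue_on C) p De G" "AE x in lebesgue_on C. (\<lambda>k. e k x) \<longlonglongrightarrow> E x"
    "\<And>k x. x \<notin> C \<Longrightarrow> e k x \<le> a \<or> b \<le> e k x" "\<And>k x. x \<in> K \<Longrightarrow> b \<le> e k x" "\<And>k x. x \<notin> C0 \<Longrightarrow> e k x \<le> a"
proof -
  have fr: "compact (frontier \<Omega>)" "frontier \<Omega> \<inter> \<Omega> = {}"
    using compact_frontier_bounded[OF \<Omega>(2)] by (auto simp: frontier_def interior_open[OF \<Omega>(1)])
  obtain W1 where W1: "open W1" "K \<subseteq> W1" "\<And>x. x \<in> \<Omega> - K \<Longrightarrow> x \<in> W1 \<Longrightarrow> b < E x"
  proof (rule compact_neighbourhood_property[OF K(1), of "\<Omega> - K" "\<lambda>x. b < E x"])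
    show "\<forall>\<^sub>F x in at z within \<Omega> - K. b < E x" if "z \<in> K" for z
      using blowup[OF that] by (simp add: filterlim_at_top_dense)
  qed (use that in auto)
  obtain W2 where W2: "open W2" "frontier \<Omega> \<subseteq> W2" "\<And>x. x \<in> \<Omega> \<Longrightarrow> x \<in> W2 \<Longrightarrow> E x < a"
  proof (rule compact_neighbourhood_property[OF fr, of "\<lambda>x. E x < a"])
    show "\<forall>\<^sub>F x in at z within \<Omega>. E x < a" if "z \<in> frontier \<Omega>" for z
      using order_tendstoD(2)[OF boundary[OF that] ab(1)] .
  qed (use that in auto)
  obtain d1 where d1: "0 < d1" "\<And>x y. x \<in> K \<Longrightarrow> y \<in> - W1 \<Longrightarrow> d1 \<le> dist x y"
    using separate_compact_closed[OF K(1) closed_Compl[OF W1(1)]] W1(2) by blast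
  \<comment> \<open>\<open>W2\<close> covers the frontier, so what remains of \<Omega> is closed and
    keeps a positive distance \<open>d2\<close> from the complement.\<close>
  have "\<Omega> - W2 = closure \<Omega> - W2"
    using W2(2) closure_subset[of \<Omega>] unfolding frontier_def interior_open[OF \<Omega>(1)] by blast
  then have "compact (\<Omega> - W2)"
    using \<Omega>(2) W2(1) by (simp add: compact_diff)
  then obtain d2 where d2: "0 < d2" "\<And>x y. x \<in> \<Omega> - W2 \<Longrightarrow> y \<in> - \<Omega> \<Longrightarrow> d2 \<le> dist x y"
    using separate_compact_closed[OF _ closed_Compl[OF \<Omega>(1)], of "\<Omega> - W2"] by blast
  obtain d3 where d3: "0 < d3" "\<And>x y. x \<in> K \<Longrightarrow> y \<in> - \<Omega> \<Longrightarrow> d3 \<le> dist x y"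
    using separate_compact_closed[OF K(1) closed_Compl[OF \<Omega>(1)]] K(2) by blast
  \<comment> \<open>A quarter of the distances leaves room for three layers on one side and one on
    the other without overlap, as \<open>disj\<close> expresses.\<close>
  define \<rho> where "\<rho> = min d1 (min d2 d3) / 4"
  have \<rho>: "0 < \<rho>" "4 * \<rho> \<le> d1" "4 * \<rho> \<le> d2" "4 * \<rho> \<le> d3"
    using d1(1) d2(1) d3(1) by (auto simp: \<rho>_def)
  define NK where "NK r = (\<Union>z\<in>K. ball z r)" for r
  define NO where "NO r = (\<Union>z\<in>-\<Omega>. ball z r)" for r
  have opn: "open (NK r)" "open (NO r)" for r by (auto simp: NK_def NO_def)
  have NKI: "y \<in> NK (r + \<rho>)" if xN: "x \<in> NK r" and yb: "y \<in> cball x \<rho>" for x y r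
  proof -
    obtain z where z: "z \<in> K" "dist z x < r" using xN by (auto simp: NK_def)
    have "dist z y < r + \<rho>" using z(2) yb dist_triangle[of z y x] by simp
    with z(1) show ?thesis by (auto simp: NK_def)
  qed
  have NOI: "y \<in> NO (r + \<rho>)" if xN: "x \<in> NO r" and yb: "y \<in> cball x \<rho>" for x y r
  proof -
    obtain z where z: "z \<in> - \<Omega>" "dist z x < r" using xN by (auto simp: NO_def)
    have "dist z y < r + \<rho>" using z(2) yb dist_triangle[of z y x] by simp
    with z(1) show ?thesis unfolding NO_def by (intro UN_I[OF z(1)]) simp
  qed
  have big: "b < E x" if xN: "x \<in> NK (3 * \<rho>)" and xU: "x \<in> \<Omega> - K" for x
  proof -
    obtain z where z: "z \<in> K" "dist z x < 3 * \<rho>" using xN by (auto simp: NK_def)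
    have "x \<in> W1" using d1(2)[OF z(1), of x] z(2) \<rho> by fastforce
    then show ?thesis using W1(3) xU by blast
  qed
  have small: "E x < a" if xN: "x \<in> NO (3 * \<rho>)" and xU: "x \<in> \<Omega>" for x
  proof -
    obtain z where z: "z \<in> - \<Omega>" "dist z x < 3 * \<rho>" using xN by (auto simp: NO_def)
    have "x \<in> W2" using d2(2)[of x z] z \<rho> xU by (fastforce simp: dist_commute)
    then show ?thesis using W2(3) xU by blast
  qed
  have disj: "x \<notin> NO s" if xN: "x \<in> NK r" and rs: "r + s \<le> 4 * \<rho>" for x r s
  proof
    assume "x \<in> NO s"
    then obtain y where y: "y \<in> - \<Omega>" "dist y x < s" by (auto simp: NO_def)
    obtain z where z: "z \<in> K" "dist z x < r" using xN by (auto simp: NK_def)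
    have "dist z y < r + s" using y z dist_triangle2[of z y x] by simp
    then show False using d3(2)[OF z(1) y(1)] \<rho>(4) rs by linarith
  qed
  have KNK: "x \<in> NK r" if "x \<in> K" "0 < r" for x r using that by (auto simp: NK_def intro!: bexI[of _ x])
  have ONO: "x \<in> NO r" if "x \<notin> \<Omega>" "0 < r" for x r using that by (auto simp: NO_def intro!: bexI[of _ x])
  define C where "C = - (NK (2 * \<rho>) \<union> NO (2 * \<rho>))"
  define C1 where "C1 = - (NK \<rho> \<union> NO \<rho>)"
  define C0 where "C0 = - NO (2 * \<rho>)"
  have C0\<Omega>: "C0 \<subseteq> \<Omega>" "C1 \<subseteq> \<Omega> - K" "C \<subseteq> \<Omega> - K"
    using ONO[of _ "2 * \<rho>"] ONO[of _ \<rho>] KNK[of _ \<rho>] KNK[of _ "2 * \<rho>"] \<rho>(1) by (auto simp: C0_def C1_def C_def)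
  have cpt: "compact S" if "closed S" "S \<subseteq> \<Omega>" for S
    using that \<Omega>(2) bounded_subset by (auto simp: compact_eq_bounded_closed)
  have cC: "compact C" "compact C1" "compact C0"
    using C0\<Omega> by (intro cpt; auto simp: C_def C1_def C0_def intro!: closed_Compl open_Un opn)+
  have ball: "cball x \<rho> \<subseteq> C1" if "x \<in> C" for x
  proof
    fix y assume y: "y \<in> cball x \<rho>"
    then have yx: "x \<in> cball y \<rho>" by (simp add: dist_commute)
    show "y \<in> C1"
      using NKI[of y \<rho> x] NOI[of y \<rho> x] yx that by (auto simp: C_def C1_def)
  qed
  \<comment> \<open>Besides \<open>E\<close> on \<open>C1\<close>, this takes the level
    \<open>b\<close> near \<open>K\<close> and 0, which lies below \<open>a\<close>, near and beyond
    the boundary.\<close>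
  define g where "g = (\<lambda>x. indicator C1 x *\<^sub>R E x + indicator (NK \<rho>) x *\<^sub>R b)"
  have gE: "g x = E x" if "x \<in> C1" for x using that by (simp add: g_def C1_def)
  have gb: "g x = b" if "x \<in> NK \<rho>" for x using that by (simp add: g_def C1_def)
  have g0: "g x = 0" if "x \<notin> C1" "x \<notin> NK \<rho>" for x using that by (simp add: g_def)
  have NK\<Omega>: "NK \<rho> \<subseteq> \<Omega>" using disj[of _ \<rho> \<rho>] ONO[OF _ \<rho>(1)] \<rho>(1) by fastforce
  then have bNK: "bounded (NK \<rho>)" using \<Omega>(2) bounded_subset by blast
  then have lNK: "NK \<rho> \<in> lmeasurable" by (intro lmeasurable_open opn)
  have gint: "integrable lebesgue g"
    unfolding g_def using lNK
    by (intro Bochner_Integration.integrable_add in_Lp_1_integrable[OF in_Lp_E(3)[OF cC(2) C0\<Omega>(2)]] integrable_scaleR_left integrable_real_indicator)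
      (auto simp: fmeasurable_def)
  have gLp: "Lp_int lebesgue p g < \<infinity>"
    unfolding g_def
  proof (rule Lp_finite_add)
    show "(\<lambda>x. indicator C1 x *\<^sub>R E x) \<in> borel_measurable lebesgue"
      by (rule in_Lp_indicator(1)[OF in_Lp_E(1)[OF cC(2) C0\<Omega>(2)]]) (use p in simp)
    show "Lp_int lebesgue p (\<lambda>x. indicator C1 x *\<^sub>R E x) < \<infinity>"
      by (rule in_Lp_indicator(2)[OF in_Lp_E(1)[OF cC(2) C0\<Omega>(2)]]) (use p in simp)
    show "(\<lambda>x. indicator (NK \<rho>) x *\<^sub>R b) \<in> borel_measurable lebesgue"
      using lNK by (intro borel_measurable_scaleR borel_measurable_indicator) auto
    have "Lp_int lebesgue p (\<lambda>x. indicator (NK \<rho>) x *\<^sub>R b) = (\<integral>\<^sup>+x. ennreal (\<bar>b\<bar> powr p) * indicator (NK \<rho>) x \<partial>lebesgue)"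
      using p by (intro nn_integral_cong) (auto simp: indicator_def)
    also have "\<dots> = ennreal (\<bar>b\<bar> powr p) * emeasure lebesgue (NK \<rho>)"
      using lNK by (intro nn_integral_cmult_indicator) auto
    also have "\<dots> < \<infinity>" using fmeasurableD2[OF lNK] by (simp add: ennreal_mult_less_top top.not_eq_extremum)
    finally show "Lp_int lebesgue p (\<lambda>x. indicator (NK \<rho>) x *\<^sub>R b) < \<infinity>" .
  qed (use p in auto)
  have gsupp: "g x = 0" if "x \<notin> \<Omega>" for x
    using that C0\<Omega>(2) NK\<Omega> by (intro g0) auto
  have Cs: "C \<in> sets lebesgue" using cC(1) by (auto intro: lmeasurable_compact fmeasurableD)
  obtain e De where e: "\<And>k x. ((e k :: real^'n \<Rightarrow> real) has_derivative (\<lambda>h. De k x \<bullet> h)) (at x)"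
    "\<And>k :: nat. continuous_on UNIV (De k)"
    "Lp_tendsto (lebesgue_on C) p De G"
    "AE x in lebesgue. (\<lambda>k. e k x) \<longlonglongrightarrow> g x"
    "\<And>k x b. (\<And>y. y \<in> cball x \<rho> \<Longrightarrow> g y \<le> b) \<Longrightarrow> e k x \<le> b"
    "\<And>k x b. (\<And>y. y \<in> cball x \<rho> \<Longrightarrow> b \<le> g y) \<Longrightarrow> b \<le> e k x"
    by (rule sobolev_approximation[OF weak_gradient_E p cC(2) C0\<Omega>(2) in_Lp_E(2)[OF cC(2) C0\<Omega>(2)] gint gLp \<Omega>(2) gsupp gE Cs \<rho>(1) ball]) blast+
  have ge: "b \<le> e k x" if "x \<in> NK (2 * \<rho>)" for k x
  proof (rule e(6))
    fix y assume "y \<in> cball x \<rho>"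
    then have y: "y \<in> NK (3 * \<rho>)" using NKI[OF that] by (simp add: mult.commute distrib_left[symmetric])
    consider "y \<in> C1" | "y \<in> NK \<rho>" | "y \<in> NO \<rho>" by (auto simp: C1_def)
    then show "b \<le> g y"
    proof cases
      case 1
      then show ?thesis using big[OF y] C0\<Omega>(2) gE by fastforce
    qed (use gb disj[OF y, of \<rho>] in auto)
  qed
  have le: "e k x \<le> a" if "x \<in> NO (2 * \<rho>)" for k x
  proof (rule e(5))
    fix y assume "y \<in> cball x \<rho>"
    then have y: "y \<in> NO (3 * \<rho>)" using NOI[OF that] by (simp add: mult.commute distrib_left[symmetric])
    show "g y \<le> a"
    proof (cases "y \<in> C1")
      case True
      then show ?thesis using small[OF y] C0\<Omega>(2) gE by fastforce
    next
      case False
      moreover have "y \<notin> NK \<rho>" using disj[of y \<rho> "3 * \<rho>"] y by auto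
      ultimately show ?thesis using g0 ab by simp
    qed
  qed
  show thesis
  proof (rule that[OF cC(1) C0\<Omega>(3) cC(3) C0\<Omega>(1) _ e(1-3)])
    show "E x \<le> a \<or> b \<le> E x" if x: "x \<in> \<Omega> - K" "x \<notin> C" for x
    proof -
      have "x \<in> NK (3 * \<rho>) \<or> x \<in> NO (3 * \<rho>)"
        using x(2) NKI[of x "2 * \<rho>" x] NOI[of x "2 * \<rho>" x] \<rho>(1) by (auto simp: C_def)
      then show ?thesis using big small x(1) by fastforce
    qed
    show "AE x in lebesgue_on C. (\<lambda>k. e k x) \<longlonglongrightarrow> E x"
    proof -
      have "g x = E x" if "x \<in> C" for x
        using ball[OF that] \<rho>(1) by (intro gE) auto
      then show ?thesis
        using e(4) Cs by (subst AE_restrict_space_iff) (auto elim!: eventually_mono)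
    qed
    show "e k x \<le> a \<or> b \<le> e k x" if "x \<notin> C" for k x
      using that ge le by (auto simp: C_def)
    show "b \<le> e k x" if "x \<in> K" for k x using ge KNK[OF that] \<rho>(1) by simp
    show "e k x \<le> a" if "x \<notin> C0" for k x using that le by (auto simp: C0_def)
  qed
qed

end

section \<open>The one-dimensional Hardy constant\<close>

text \<open>Profiles for composition with the potential: they vanish up to the level
  \<open>a\<close>, which is exceeded only away from the boundary, and are constant from the level
  \<open>b\<close> on, hence near \<open>K\<close>. The value \<open>f b\<close> is then the
  integral of \<open>df\<close> from \<open>a\<close> to \<open>b\<close>.\<close>

definition level_pair :: "real \<Rightarrow> real \<Rightarrow> (real \<Rightarrow> real) \<Rightarrow> (real \<Rightarrow> real) \<Rightarrow> bool" where
  "level_pair a b f df \<longleftrightarrow> (\<forall>t. (f has_real_derivative df t) (at t)) \<and> continuous_on UNIV df \<and>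
     (\<forall>t\<le>a. f t = 0) \<and> (\<forall>t. t \<le> a \<or> b \<le> t \<longrightarrow> df t = 0)"

lemma antiderivative_from_left:
  fixes h :: "real \<Rightarrow> real"
  assumes h: "continuous_on UNIV h" "\<And>t. t \<le> a \<Longrightarrow> h t = 0"
  obtains F where "\<And>t. (F has_real_derivative h t) (at t)" "\<And>t. t \<le> a \<Longrightarrow> F t = 0"
    "\<And>t. a \<le> t \<Longrightarrow> F t = integral {a..t} h"
proof -
  \<comment> \<open>Starting one unit to the left makes \<open>a\<close> an interior point, so the
    derivative there is two-sided.\<close>
  define F where "F t = integral {a - 1..t} h" for t
  have hI: "h integrable_on {s..t}" for s t
    by (intro integrable_continuous_real continuous_on_subset[OF h(1)]) auto
  have F0: "F t = 0" if "t \<le> a" for t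
  proof -
    have "integral {a - 1..t} h = integral {a - 1..t} (\<lambda>_. 0)"
      using that h(2) by (intro integral_cong) auto
    then show ?thesis by (simp add: F_def)
  qed
  have D: "(F has_real_derivative h t) (at t)" for t
  proof (cases "t < a")
    case True
    have "eventually (\<lambda>s. F s = 0) (nhds t)"
      by (rule eventually_mono[OF eventually_nhds_in_open[of "{..<a}" t]]) (use True F0 in auto)
    from DERIV_cong_ev[OF refl this refl, of 0] show ?thesis using True h(2)[of t] by simp
  next
    case False
    have "(F has_real_derivative h t) (at t within {a - 1..t + 1})"
      unfolding F_def by (rule integral_has_real_derivative) (use False h(1) continuous_on_subset in auto)
    moreover have "at t within {a - 1..t + 1} = at t"
      using False by (intro at_within_interior) auto
    ultimately show ?thesis by simp
  qed
  have eq: "F t = integral {a..t} h" if "a \<le> t" for t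
  proof -
    have "F t = integral {a - 1..a} h + integral {a..t} h"
      unfolding F_def using that by (intro Henstock_Kurzweil_Integration.integral_combine[symmetric] hI) auto
    then show ?thesis using F0[of a] by (simp add: F_def)
  qed
  show thesis by (rule that[OF D F0 eq])
qed

text \<open>Powers and logarithms are handled only for positive arguments. Switching to 0 at
  \<open>a / 2\<close> instead of \<open>a\<close> leaves an interval on which both branches vanish,
  so no one-sided derivatives arise.\<close>

lemma glue_has_derivative:
  fixes k :: "real \<Rightarrow> real"
  assumes a: "0 < a" and k: "\<And>t. a / 2 < t \<Longrightarrow> (k has_real_derivative k' t) (at t)"
    and zero: "\<And>t. a / 2 < t \<Longrightarrow> t \<le> a \<Longrightarrow> k t = 0"
  shows "((\<lambda>t. if t \<le> a / 2 then 0 else k t) has_real_derivative (if t \<le> a / 2 then 0 else k' t)) (at t)"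
proof (cases "t \<le> a / 2")
  case True
  have "eventually (\<lambda>s. (if s \<le> a / 2 then 0 else k s) = 0) (nhds t)"
    by (rule eventually_mono[OF eventually_nhds_in_open[of "{..<a}" t]]) (use True a zero in auto)
  from DERIV_cong_ev[OF refl this refl, of 0] show ?thesis using True by simp
next
  case False
  have "eventually (\<lambda>s. (if s \<le> a / 2 then 0 else k s) = k s) (nhds t)"
    by (rule eventually_mono[OF eventually_nhds_in_open[of "{a / 2<..}" t]]) (use False in auto)
  from DERIV_cong_ev[OF refl this refl, of "k' t"] show ?thesis using False k[of t] by simp
qed

lemma glue_continuous:
  fixes k :: "real \<Rightarrow> real"
  assumes a: "0 < a" and k: "continuous_on {a / 2<..} k" and zero: "\<And>t. a / 2 < t \<Longrightarrow> t \<le> a \<Longrightarrow> k t = 0"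
  shows "continuous_on UNIV (\<lambda>t. if t \<le> a / 2 then 0 else k t)"
proof -
  let ?f = "\<lambda>t. if t \<le> a / 2 then 0 else k t"
  have "continuous_on ({..<a} \<union> {a / 2<..}) ?f"
  proof (rule continuous_on_open_Un)
    show "continuous_on {..<a} ?f"
      by (rule continuous_on_eq[of _ "\<lambda>_. 0"]) (use zero in auto)
    show "continuous_on {a / 2<..} ?f"
      by (rule continuous_on_eq[OF k]) auto
  qed auto
  also have "{..<a} \<union> {a / 2<..} = UNIV" using a by auto
  finally show ?thesis .
qed

text \<open>At \<open>\<tau> = 0\<close> the quotient of the two integrals is exactly
  \<open>\<beta> powr p\<close>, which is below \<open>c\<close>; continuity in \<tau> leaves room
  for a small positive \<tau>.\<close>

lemma bump_ratio:
  fixes p \<beta> c :: real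
  assumes p: "1 < p" and \<beta>: "0 < \<beta>" and c: "\<beta> powr p < c"
  obtains \<tau> g dg where "0 < \<tau>" "\<And>s. (g has_real_derivative dg s) (at s)" "continuous_on UNIV dg"
    "\<And>s. s \<le> 0 \<or> 1 \<le> s \<Longrightarrow> g s = 0" "\<And>s. s \<le> 0 \<or> 1 \<le> s \<Longrightarrow> dg s = (0::real)"
    "0 \<le> integral {0..1} (\<lambda>s. \<bar>g s\<bar> powr p)"
    "integral {0..1} (\<lambda>s. \<bar>\<beta> * g s + \<tau> * dg s\<bar> powr p) < c * integral {0..1} (\<lambda>s. \<bar>g s\<bar> powr p)"
proof -
  define q where "q s = s * (1 - s)" for s :: real
  \<comment> \<open>The square makes the positive part of \<open>q\<close> continuously
    differentiable.\<close>
  define g where "g s = (max 0 (q s))\<^sup>2" for s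
  define dg where "dg s = 2 * max 0 (q s) * (1 - 2 * s)" for s
  have m: "((\<lambda>s. (max 0 s)\<^sup>2) has_real_derivative 2 * max 0 s) (at s)" for s :: real
  proof -
    consider "s > 0" | "s < 0" | "s = 0" by linarith
    then show ?thesis
    proof cases
      case 1
      have ev: "eventually (\<lambda>s. (max 0 s)\<^sup>2 = s\<^sup>2) (nhds s)"
        by (rule eventually_mono[OF eventually_nhds_in_open[of "{0<..}" s]]) (use 1 in auto)
      have "((\<lambda>s. s\<^sup>2) has_real_derivative 2 * s) (at s)"
        by (rule derivative_eq_intros refl | simp)+
      then show ?thesis using DERIV_cong_ev[OF refl ev refl] 1 by simp
    next
      case 2
      have ev: "eventually (\<lambda>s::real. (max 0 s)\<^sup>2 = 0) (nhds s)"
        by (rule eventually_mono[OF eventually_nhds_in_open[of "{..<0}" s]]) (use 2 in auto)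
      show ?thesis using DERIV_cong_ev[OF refl ev refl, of 0] 2 by simp
    next
      case 3
      have "((\<lambda>h::real. (max 0 h)\<^sup>2 / h) \<longlongrightarrow> 0) (at 0)"
      proof (rule Lim_null_comparison)
        show "\<forall>\<^sub>F h in at 0. norm ((max 0 h)\<^sup>2 / h) \<le> \<bar>h::real\<bar>"
          by (intro always_eventually allI) (auto simp: max_def power2_eq_square)
        show "((\<lambda>h. \<bar>h\<bar>) \<longlongrightarrow> 0) (at (0::real))"
          by (rule tendsto_eq_intros refl | simp)+
      qed
      then show ?thesis by (simp add: 3 has_field_derivative_iff)
    qed
  qed
  have qd: "(q has_real_derivative 1 - 2 * s) (at s)" for s
    unfolding q_def by (rule derivative_eq_intros refl | simp)+
  have gd: "(g has_real_derivative dg s) (at s)" for s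
    unfolding g_def dg_def using DERIV_chain[OF m qd, of s] by (simp add: comp_def)
  have dgc: "continuous_on S dg" for S
    unfolding dg_def q_def by (intro continuous_intros)
  have gc: "continuous_on S g" for S
    unfolding g_def q_def by (intro continuous_intros)
  have q0: "q s \<le> 0" if "s \<le> 0 \<or> 1 \<le> s" for s
    using that by (auto simp: q_def mult_nonpos_nonneg mult_nonneg_nonpos)
  have g0: "g s = 0" "dg s = 0" if "s \<le> 0 \<or> 1 \<le> s" for s
    using q0[OF that] by (auto simp: g_def dg_def)
  define J where "J \<tau> = integral {0..1} (\<lambda>s. \<bar>\<beta> * g s + \<tau> * dg s\<bar> powr p)" for \<tau>
  define I where "I = integral {0..1} (\<lambda>s. \<bar>g s\<bar> powr p)"
  have gpc: "continuous_on {0..1} (\<lambda>s. \<bar>g s\<bar> powr p)"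
    using p by (intro continuous_on_powr' continuous_intros gc) auto
  have "0 \<le> I" unfolding I_def
    by (intro Henstock_Kurzweil_Integration.integral_nonneg integrable_continuous_real gpc) auto
  moreover have "I \<noteq> 0"
  proof
    assume "I = 0"
    then have "\<bar>g (1/2)\<bar> powr p = 0"
      using integral_eq_0_iff[OF gpc] by (auto simp: I_def)
    then show False by (simp add: g_def q_def)
  qed
  ultimately have I: "0 < I" by simp
  have "continuous_on {0..1} (\<lambda>\<tau>. integral (cbox 0 1) (\<lambda>s. \<bar>\<beta> * g s + \<tau> * dg s\<bar> powr p))"
  proof (rule integral_continuous_on_param)
    have "continuous_on ({0..1} \<times> cbox 0 1) (\<lambda>z. \<bar>\<beta> * g (snd z) + fst z * dg (snd z)\<bar> powr p)"
      using p by (intro continuous_on_powr' continuous_intros continuous_on_compose2[OF gc[of UNIV]] continuous_on_compose2[OF dgc[of UNIV]]) auto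
    then show "continuous_on ({0..1} \<times> cbox 0 1) (\<lambda>(\<tau>, s). \<bar>\<beta> * g s + \<tau> * dg s\<bar> powr p)"
      by (simp add: case_prod_unfold)
  qed
  then have "continuous_on {0..1} J" by (simp add: J_def[abs_def])
  then have "(J \<longlongrightarrow> J 0) (at 0 within {0..1})" by (simp add: continuous_on_def)
  moreover have "J 0 = \<beta> powr p * I"
    using \<beta> by (simp add: J_def I_def abs_mult powr_mult)
  moreover have "\<beta> powr p * I < c * I" using c I by simp
  ultimately have "\<forall>\<^sub>F \<tau> in at 0 within {0..1}. J \<tau> < c * I"
    by (intro order_tendstoD(2)) auto
  then obtain d where d: "0 < d" "\<And>\<tau>. \<tau> \<in> {0..1} \<Longrightarrow> \<tau> \<noteq> 0 \<Longrightarrow> dist \<tau> 0 < d \<Longrightarrow> J \<tau> < c * I"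
    unfolding eventually_at by blast
  define \<tau> where "\<tau> = min 1 (d / 2)"
  have \<tau>: "0 < \<tau>" "J \<tau> < c * I" using d(1) by (auto simp: \<tau>_def intro!: d(2))
  show thesis
    by (rule that[OF \<tau>(1) gd dgc g0]) (use \<tau>(2) I in \<open>auto simp: J_def I_def\<close>)
qed

text \<open>Put \<open>f t = t powr \<beta> * g s\<close> with
  \<open>s = \<tau> * ln (t / a)\<close>. Then \<open>df t = t powr (\<beta> - 1) * (\<beta> * g s +
  \<tau> * dg s)\<close>; since \<open>(\<beta> - 1) * p = - 1\<close>, p-th powers produce
  \<open>1 / t\<close>, and \<open>dt / t = ds / \<tau>\<close> turns both integrals into those of
  \<open>bump_ratio\<close>. The term \<open>max t a\<close> agrees with \<open>t\<close> where
  \<open>f\<close> is nonzero and keeps the weight continuous.\<close>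

lemma level_pair_near_optimal:
  fixes p c a :: real
  assumes p: "1 < p" and c: "((p - 1) / p) powr p < c" and a: "0 < a"
  obtains b f df F1 F2 where "level_pair a b f df" "\<And>t. b \<le> t \<Longrightarrow> f t = 0"
    "level_pair a b F1 (\<lambda>t. \<bar>df t\<bar> powr p)" "level_pair a b F2 (\<lambda>t. (\<bar>f t\<bar> / max t a) powr p)"
    "0 \<le> F1 b" "0 \<le> F2 b" "F1 b < c * F2 b"
proof -
  define \<beta> where "\<beta> = (p - 1) / p"
  have \<beta>: "0 < \<beta>" "(\<beta> - 1) * p = - 1" using p by (auto simp: \<beta>_def field_simps)
  obtain \<tau> g dg where \<tau>: "0 < \<tau>" and g: "\<And>s. (g has_real_derivative dg s) (at s)" "continuous_on UNIV dg"
    and g0: "\<And>s. s \<le> 0 \<or> 1 \<le> s \<Longrightarrow> g s = 0" "\<And>s. s \<le> 0 \<or> 1 \<le> s \<Longrightarrow> dg s = (0::real)"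
    and nonneg: "0 \<le> integral {0..1} (\<lambda>s. \<bar>g s\<bar> powr p)"
    and less: "integral {0..1} (\<lambda>s. \<bar>\<beta> * g s + \<tau> * dg s\<bar> powr p) < c * integral {0..1} (\<lambda>s. \<bar>g s\<bar> powr p)"
    by (rule bump_ratio[OF p \<beta>(1) c[folded \<beta>_def]]) blast
  have gc: "continuous_on UNIV g"
    by (auto intro!: continuous_at_imp_continuous_on DERIV_isCont g)
  define \<psi>1 where "\<psi>1 s = \<bar>\<beta> * g s + \<tau> * dg s\<bar> powr p" for s
  define \<psi>2 where "\<psi>2 s = \<bar>g s\<bar> powr p" for s
  have "continuous_on UNIV \<psi>1"
    unfolding \<psi>1_def using p by (intro continuous_on_powr' continuous_intros gc g(2)) auto
  moreover have "continuous_on UNIV \<psi>2"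
    unfolding \<psi>2_def using p by (intro continuous_on_powr' continuous_intros gc) auto
  ultimately have \<psi>c: "continuous_on UNIV \<psi>1" "continuous_on UNIV \<psi>2" .
  have \<psi>0: "\<psi>1 s = 0" "\<psi>2 s = 0" if "s \<le> 0 \<or> 1 \<le> s" for s
    using g0[OF that] p by (auto simp: \<psi>1_def \<psi>2_def)
  obtain P1 where P1: "\<And>t. (P1 has_real_derivative \<psi>1 t) (at t)" "\<And>t. t \<le> 0 \<Longrightarrow> P1 t = 0" "\<And>t. 0 \<le> t \<Longrightarrow> P1 t = integral {0..t} \<psi>1"
    by (rule antiderivative_from_left[OF \<psi>c(1), of 0]) (use \<psi>0 in blast)+
  obtain P2 where P2: "\<And>t. (P2 has_real_derivative \<psi>2 t) (at t)" "\<And>t. t \<le> 0 \<Longrightarrow> P2 t = 0" "\<And>t. 0 \<le> t \<Longrightarrow> P2 t = integral {0..t} \<psi>2"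
    by (rule antiderivative_from_left[OF \<psi>c(2), of 0]) (use \<psi>0 in blast)+
  define S where "S t = \<tau> * ln (t / a)" for t
  have Sd: "(S has_real_derivative \<tau> / t) (at t)" if "0 < t" for t
    unfolding S_def using that a by (auto intro!: derivative_eq_intros)
  have Sc: "continuous_on {a / 2<..} S"
    unfolding S_def using a by (intro continuous_intros) auto
  \<comment> \<open>The level at which \<open>S\<close> reaches 1 and the bump ends.\<close>
  define b where "b = a * exp (1 / \<tau>)"
  have ba: "a < b" using a \<tau> by (simp add: b_def)
  have S0: "S t \<le> 0" if "0 < t" "t \<le> a" for t
    using that a \<tau> by (simp add: S_def mult_nonneg_nonpos)
  have S1: "1 \<le> S t" if "b \<le> t" for t
  proof -
    have "exp (1 / \<tau>) \<le> t / a" using that a by (simp add: b_def field_simps)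
    then have "1 / \<tau> \<le> ln (t / a)" by (metis exp_gt_zero ln_exp ln_mono)
    then show ?thesis using \<tau> by (simp add: S_def field_simps)
  qed
  have Sb: "S b = 1" using a \<tau> by (simp add: S_def b_def)
  have S01: "S t \<le> 0 \<or> 1 \<le> S t" if "0 < t" "t \<le> a \<or> b \<le> t" for t
    using that S0 S1 by blast
  define f where "f t = (if t \<le> a / 2 then 0 else t powr \<beta> * g (S t))" for t
  define df where "df t = (if t \<le> a / 2 then 0 else t powr (\<beta> - 1) * (\<beta> * g (S t) + \<tau> * dg (S t)))" for t
  define F1 where "F1 t = (if t \<le> a / 2 then 0 else inverse \<tau> * P1 (S t))" for t
  define F2 where "F2 t = (if t \<le> a / 2 then 0 else inverse \<tau> * P2 (S t))" for t
  have f0: "f t = 0" "df t = 0" if "t \<le> a \<or> b \<le> t" for t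
    using g0[OF S01[OF _ that]] a by (auto simp: f_def df_def)
  have fl: "level_pair a b f df"
    unfolding level_pair_def
  proof (intro conjI allI impI)
    show "(f has_real_derivative df t) (at t)" for t
      unfolding f_def df_def
    proof (rule glue_has_derivative[OF a])
      fix t assume "a / 2 < t"
      then have t: "0 < t" using a by linarith
      have "((\<lambda>t. t powr \<beta> * g (S t)) has_real_derivative \<beta> * t powr (\<beta> - 1) * g (S t) + dg (S t) * (\<tau> / t) * t powr \<beta>) (at t)"
        by (intro DERIV_mult DERIV_chain2[OF g(1) Sd[OF t]] has_real_derivative_powr t)
      moreover have "t powr \<beta> = t * t powr (\<beta> - 1)" using t by (simp add: powr_diff)
      ultimately show "((\<lambda>t. t powr \<beta> * g (S t)) has_real_derivative t powr (\<beta> - 1) * (\<beta> * g (S t) + \<tau> * dg (S t))) (at t)"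
        using t by (simp add: algebra_simps)
    qed (use g0 S0 a in auto)
    show "continuous_on UNIV df"
      unfolding df_def
    proof (rule glue_continuous[OF a])
      show "continuous_on {a / 2<..} (\<lambda>t. t powr (\<beta> - 1) * (\<beta> * g (S t) + \<tau> * dg (S t)))"
        using a by (intro continuous_intros continuous_on_compose2[OF gc Sc] continuous_on_compose2[OF g(2) Sc]) auto
      show "t powr (\<beta> - 1) * (\<beta> * g (S t) + \<tau> * dg (S t)) = 0" if "a / 2 < t" "t \<le> a" for t
        using g0[OF S01] that a by simp
    qed
  qed (use f0 in auto)
  have scale: "(t powr (\<beta> - 1)) powr p = 1 / t" if "0 < t" for t
    using that \<beta>(2) by (simp add: powr_powr powr_minus_divide)
  \<comment> \<open>The common pattern of \<open>F1\<close> and \<open>F2\<close>: because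
    \<open>S\<close> has derivative \<open>\<tau> / t\<close>, an antiderivative \<open>P\<close> of
    \<psi> turns \<open>P (S t) / \<tau>\<close> into an antiderivative of
    \<open>\<psi> (S t) / t\<close>.\<close>
  have P: "level_pair a b (\<lambda>t. if t \<le> a / 2 then 0 else inverse \<tau> * P (S t)) h"
    if P: "\<And>t. (P has_real_derivative \<psi> t) (at t)" "\<And>t. t \<le> 0 \<Longrightarrow> P t = 0"
      and \<psi>: "\<And>s. s \<le> 0 \<or> 1 \<le> s \<Longrightarrow> \<psi> s = 0" and h: "\<And>t. h t = (if t \<le> a / 2 then 0 else \<psi> (S t) / t)"
      and \<psi>c: "continuous_on UNIV \<psi>"
    for P \<psi> :: "real \<Rightarrow> real" and h
    unfolding level_pair_def
  proof (intro conjI allI impI)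
    show "((\<lambda>t. if t \<le> a / 2 then 0 else inverse \<tau> * P (S t)) has_real_derivative h t) (at t)" for t
      unfolding h
    proof (rule glue_has_derivative[OF a])
      fix t assume "a / 2 < t"
      then have t: "0 < t" using a by linarith
      show "((\<lambda>t. inverse \<tau> * P (S t)) has_real_derivative \<psi> (S t) / t) (at t)"
        using DERIV_cmult[OF DERIV_chain2[OF P(1) Sd[OF t]], of "inverse \<tau>"] \<tau> by (simp add: field_simps)
    qed (use P(2) S0 a in auto)
    have "continuous_on UNIV (\<lambda>t. if t \<le> a / 2 then 0 else \<psi> (S t) / t)"
    proof (rule glue_continuous[OF a])
      show "continuous_on {a / 2<..} (\<lambda>t. \<psi> (S t) / t)"
        using a by (intro continuous_intros continuous_on_compose2[OF \<psi>c Sc]) auto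
      show "\<psi> (S t) / t = 0" if "a / 2 < t" "t \<le> a" for t
        using \<psi>[OF S01] that a by simp
    qed
    then show "continuous_on UNIV h" by (simp add: h[abs_def])
    show "h t = 0" if "t \<le> a \<or> b \<le> t" for t using \<psi>[OF S01[OF _ that]] a by (auto simp: h)
    show "(if t \<le> a / 2 then 0 else inverse \<tau> * P (S t)) = 0" if "t \<le> a" for t
      using P(2)[OF S0] that a by auto
  qed
  have F1l: "level_pair a b F1 (\<lambda>t. \<bar>df t\<bar> powr p)"
    unfolding F1_def
  proof (rule P[OF P1(1,2) \<psi>0(1) _ \<psi>c(1)])
    show "\<bar>df t\<bar> powr p = (if t \<le> a / 2 then 0 else \<psi>1 (S t) / t)" for t
      using a p scale[of t] by (auto simp: df_def \<psi>1_def abs_mult powr_mult)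
  qed
  have F2l: "level_pair a b F2 (\<lambda>t. (\<bar>f t\<bar> / max t a) powr p)"
    unfolding F2_def
  proof (rule P[OF P2(1,2) \<psi>0(2) _ \<psi>c(2)])
    show "(\<bar>f t\<bar> / max t a) powr p = (if t \<le> a / 2 then 0 else \<psi>2 (S t) / t)" for t
    proof (cases "t \<le> a")
      case True
      then show ?thesis using f0[of t] \<psi>0(2)[OF S01, of t] a p by auto
    next
      case False
      then have t: "0 < t" "a < t" using a by auto
      have "\<bar>f t\<bar> / max t a = t powr (\<beta> - 1) * \<bar>g (S t)\<bar>"
        using t a by (simp add: f_def abs_mult powr_diff max_def)
      then show ?thesis using t a scale[of t] by (simp add: powr_mult \<psi>2_def)
    qed
  qed
  have F1b: "F1 b = inverse \<tau> * integral {0..1} \<psi>1" and F2b: "F2 b = inverse \<tau> * integral {0..1} \<psi>2"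
    using ba a Sb P1(3)[of 1] P2(3)[of 1] by (auto simp: F1_def F2_def)
  have "0 \<le> integral {0..1} \<psi>1"
    by (intro Henstock_Kurzweil_Integration.integral_nonneg integrable_continuous_real continuous_on_subset[OF \<psi>c(1)]) (auto simp: \<psi>1_def)
  then have "0 \<le> F1 b" "0 \<le> F2 b"
    using \<tau> nonneg by (auto simp: F1b F2b \<psi>2_def[abs_def])
  moreover have "integral {0..1} \<psi>1 < c * integral {0..1} \<psi>2"
    using less by (simp add: \<psi>1_def[abs_def] \<psi>2_def[abs_def])
  then have "F1 b < c * F2 b"
    using \<tau> by (simp add: F1b F2b)
  ultimately show thesis
    using that[OF fl _ F1l F2l] f0(1) by blast
qed

section \<open>Optimality\<close>

lemma level_pair_const:
  assumes "level_pair a b f df" "b \<le> t"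
  shows "f t = f b"
proof (cases "b = t")
  case False
  then have "b < t" using assms(2) by simp
  then show ?thesis
  proof (rule DERIV_isconst_end[of b t f])
    show "continuous_on {b..t} f"
      using assms(1) by (auto simp: level_pair_def intro!: continuous_at_imp_continuous_on DERIV_isCont)
    show "(f has_real_derivative 0) (at x)" if "b < x" "x < t" for x
    proof -
      have "df x = 0" using assms(1) that unfolding level_pair_def by auto
      then show ?thesis using assms(1) unfolding level_pair_def by metis
    qed
  qed
qed simp

lemma Lp_tendsto_cong:
  assumes V: "Lp_tendsto M p V W" and eq: "\<And>k x. x \<in> space M \<Longrightarrow> V' k x = V k x" "\<And>x. x \<in> space M \<Longrightarrow> W' x = W x"
  shows "Lp_tendsto M p V' W'"
proof -
  have "V' k \<in> borel_measurable M" for k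
    using V eq(1) measurable_cong[of M "V' k" "V k"] by (auto simp: Lp_tendsto_def)
  moreover have "W' \<in> borel_measurable M"
    using V eq(2) measurable_cong[of M W' W] by (auto simp: Lp_tendsto_def)
  moreover have "Lp_int M p (\<lambda>x. V' k x - W' x) = Lp_int M p (\<lambda>x. V k x - W x)" for k
    by (intro nn_integral_cong) (simp add: eq)
  ultimately show ?thesis using V unfolding Lp_tendsto_def by presburger
qed

context p_potential
begin

lemma nA_scaleR_powr: "norm_A (A x) (c *\<^sub>R \<xi>) powr p = \<bar>c\<bar> powr p * norm_A (A x) \<xi> powr p"
  by (simp add: norm_A_scaleR powr_mult)

text \<open>The gradients \<open>h (e k x) *\<^sub>R De k x\<close> vanish off \<open>C\<close>,
  whereas \<open>F (e k x)\<close> has its support in the larger set \<open>C0\<close>, which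
  contains \<open>K\<close>. There it equals \<open>F b\<close>, and \<mu> is carried by
  \<open>K\<close>; hence the right-hand side does not depend on \<open>k\<close>, as
  \<open>equation_limit\<close> requires.\<close>

lemma level_integral:
  assumes blowup: "\<And>x. x \<in> K \<Longrightarrow> filterlim E at_top (at x within (\<Omega> - K))"
    and boundary: "\<And>x. x \<in> frontier \<Omega> \<Longrightarrow> (E \<longlongrightarrow> \<gamma>) (at x within \<Omega>)"
    and ab: "\<gamma> < a" "0 < a"
    and F: "level_pair a b F h" and h: "\<And>t. 0 \<le> h t"
  shows "(\<integral>\<^sup>+x. ennreal (h (E x) * norm_A (A x) (G x) powr p) \<partial>M) = ennreal (F b * measure \<mu> UNIV)"
proof -
  interpret finite_measure \<mu> by (rule mu(2))
  have Fder: "(F has_real_derivative h t) (at t)" and hcont: "continuous_on UNIV h"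
    and F0: "t \<le> a \<Longrightarrow> F t = 0" and h0: "t \<le> a \<or> b \<le> t \<Longrightarrow> h t = 0" for t
    using F by (auto simp: level_pair_def)
  obtain C C0 e De where C: "compact C" "C \<subseteq> \<Omega> - K" and C0: "compact C0" "C0 \<subseteq> \<Omega>"
    and EC: "\<And>x. x \<in> \<Omega> - K \<Longrightarrow> x \<notin> C \<Longrightarrow> E x \<le> a \<or> b \<le> E x"
    and e: "\<And>k x. ((e k :: real^'n \<Rightarrow> real) has_derivative (\<lambda>h. De k x \<bullet> h)) (at x)"
      "\<And>k :: nat. continuous_on UNIV (De k)"
      "Lp_tendsto (lebesgue_on C) p De G" "AE x in lebesgue_on C. (\<lambda>k. e k x) \<longlonglongrightarrow> E x"
      "\<And>k x. x \<notin> C \<Longrightarrow> e k x \<le> a \<or> b \<le> e k x" "\<And>k x. x \<in> K \<Longrightarrow> b \<le> e k x" "\<And>k x. x \<notin> C0 \<Longrightarrow> e k x \<le> a"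
    by (rule level_approximation[OF blowup boundary ab, of b]) blast+
  have Cs: "C \<in> sets lebesgue" "C \<subseteq> \<Omega>"
    using C by (auto intro: lmeasurable_compact fmeasurableD)
  have econt: "continuous_on UNIV (e k)" for k
    by (meson continuous_at_imp_continuous_on e(1) has_derivative_continuous)
  have hecont: "continuous_on UNIV (\<lambda>x. h (e k x))" for k
    by (rule continuous_on_compose2[OF hcont econt]) simp
  obtain B where B: "0 < B" "\<And>t. norm (h t) \<le> B"
    using compact_support_bounded[OF hcont compact_Icc[of a b]] h0 by force
  let ?N = "lebesgue_on C"
  have sp: "space ?N = C" by (simp add: space_restrict_space)
  have [measurable]: "G \<in> borel_measurable ?N" "E \<in> borel_measurable ?N"
    and GLp: "Lp_int ?N p G < \<infinity>"
    using in_Lp_E(1,2)[OF C] Cs by (auto simp: in_Lp_iff)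
  have [measurable]: "h \<in> borel_measurable borel" by (rule borel_measurable_continuous_onI[OF hcont])
  have hE[measurable]: "(\<lambda>x. h (E x)) \<in> borel_measurable ?N" by measurable
  define m where "m = measure \<mu> UNIV"
  have spmu: "space \<mu> = UNIV" using sets_eq_imp_space_eq[OF mu(1)] by simp
  have "(\<integral>x. flux p A G x \<bullet> (h (E x) *\<^sub>R G x) \<partial>?N) = F b * m"
  proof (rule equation_limit[OF C])
    show "C1c \<Omega> (\<lambda>x. F (e k x)) (\<lambda>x. h (e k x) *\<^sub>R De k x)" for k
    proof (rule C1cI[OF _ _ C0])
      show "((\<lambda>x. F (e k x)) has_derivative (\<lambda>y. (h (e k x) *\<^sub>R De k x) \<bullet> y)) (at x)" for x
        using has_derivative_compose[OF e(1) Fder[unfolded has_field_derivative_def]] by (simp add: mult.commute)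
      show "continuous_on UNIV (\<lambda>x. h (e k x) *\<^sub>R De k x)"
        by (intro continuous_on_scaleR hecont e(2))
      show "F (e k x) = 0" if "x \<notin> C0" for x using F0[OF e(7)[OF that]] .
    qed
    show "h (e k x) *\<^sub>R De k x = 0" if "x \<notin> C" for k x
      using h0[OF e(5)[OF that]] by simp
    show "(\<integral>x. F (e k x) \<partial>\<mu>) = F b * m" for k
    proof -
      have ae: "AE x in \<mu>. F (e k x) = F b"
        using AE_mu_K
      proof eventually_elim
        fix x assume "x \<in> K"
        then show "F (e k x) = F b" by (intro level_pair_const[OF F] e(6))
      qed
      have "continuous_on UNIV (\<lambda>x. F (e k x))"
        by (rule continuous_on_compose2[OF _ econt, of UNIV]) (auto intro!: continuous_at_imp_continuous_on DERIV_isCont Fder)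
      then have "(\<lambda>x. F (e k x)) \<in> borel_measurable \<mu>"
        using borel_measurable_continuous_onI measurable_cong_sets[OF mu(1) refl] by blast
      then have "(\<integral>x. F (e k x) \<partial>\<mu>) = (\<integral>x. F b \<partial>\<mu>)"
        using ae by (intro integral_cong_AE) auto
      then show ?thesis by (simp add: m_def spmu mult.commute)
    qed
    show "Lp_tendsto ?N p (\<lambda>k x. h (e k x) *\<^sub>R De k x) (\<lambda>x. h (E x) *\<^sub>R G x)"
    proof (rule Lp_tendsto_scaleR[OF e(3) p GLp _ hE, where B=B])
      show "(\<lambda>x. h (e k x)) \<in> borel_measurable ?N" for k
        by (intro measurable_restrict_space1 lebesgue_measurable_continuous hecont)
      show "AE x in ?N. (\<lambda>k. h (e k x)) \<longlonglongrightarrow> h (E x)"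
        using e(4) by eventually_elim (rule continuous_on_tendsto_compose[OF hcont], auto)
    qed (use B(2) in auto)
    show "Lp_int ?N p (\<lambda>x. h (E x) *\<^sub>R G x) < \<infinity>"
      by (rule Lp_finite_scaleR[OF _ _ GLp, where B=B]) (use B p in \<open>auto intro!: mult_right_mono\<close>)
  qed
  moreover have "flux p A G x \<bullet> (h (E x) *\<^sub>R G x) = h (E x) * norm_A (A x) (G x) powr p" if "x \<in> C" for x
    using flux_inner_self[of x G] that Cs(2) by auto
  ultimately have eq: "(\<integral>x. h (E x) * norm_A (A x) (G x) powr p \<partial>?N) = F b * m"
    by (subst (asm) Bochner_Integration.integral_cong[OF refl]) (auto simp: sp)
  have int: "integrable ?N (\<lambda>x. h (E x) * norm_A (A x) (G x) powr p)"
  proof (rule Bochner_Integration.integrable_bound)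
    have [measurable]: "(\<lambda>x. norm_A (A x) (G x)) \<in> borel_measurable ?N"
      by (rule admissible_matrix_measurable(2)[OF A Cs]) measurable
    have "integrable ?N (\<lambda>x. norm_A (A x) (G x) powr p)"
      using nA_Lp_finite[OF Cs _ GLp] by (auto simp: integrable_iff_bounded)
    then show "integrable ?N (\<lambda>x. B * norm_A (A x) (G x) powr p)" by simp
    show "(\<lambda>x. h (E x) * norm_A (A x) (G x) powr p) \<in> borel_measurable ?N" by measurable
    show "AE x in ?N. norm (h (E x) * norm_A (A x) (G x) powr p) \<le> norm (B * norm_A (A x) (G x) powr p)"
      using B by (intro AE_I2) (auto simp: abs_mult intro!: mult_right_mono)
  qed
  \<comment> \<open>Off \<open>C\<close> the potential takes no value strictly between
    \<open>a\<close> and \<open>b\<close>, so the weight \<open>h (E x)\<close> vanishes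
    there.\<close>
  have "(\<integral>\<^sup>+x. ennreal (h (E x) * norm_A (A x) (G x) powr p) \<partial>M) = (\<integral>\<^sup>+x. ennreal (h (E x) * norm_A (A x) (G x) powr p) \<partial>?N)"
    using U_sets Cs C(2) h0 EC
    by (simp add: nn_integral_restrict_space) (intro nn_integral_cong, auto simp: indicator_def)
  also have "\<dots> = ennreal (\<integral>x. h (E x) * norm_A (A x) (G x) powr p \<partial>?N)"
    using int h by (intro nn_integral_eq_integral) auto
  finally show ?thesis by (simp add: eq m_def)
qed

text \<open>Here \<open>f\<close> also vanishes above \<open>b\<close>, so \<open>f (E x)\<close>
  has compact support in \<Omega> - K. It is the limit in Lp, together with the gradients, of the C1
  functions \<open>\<Phi> k\<close>; its weak gradient arises by passing to the limit in their
  integration by parts.\<close>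

lemma level_function_in_W1p_0:
  assumes blowup: "\<And>x. x \<in> K \<Longrightarrow> filterlim E at_top (at x within (\<Omega> - K))"
    and boundary: "\<And>x. x \<in> frontier \<Omega> \<Longrightarrow> (E \<longlongrightarrow> \<gamma>) (at x within \<Omega>)"
    and ab: "\<gamma> < a" "0 < a"
    and f: "level_pair a b f df" "\<And>t. b \<le> t \<Longrightarrow> f t = 0"
  obtains u Du where "in_W1p_0 p \<Omega> u Du" "\<And>x. x \<in> \<Omega> - K \<Longrightarrow> u x = f (E x)" "\<And>x. x \<in> \<Omega> - K \<Longrightarrow> Du x = df (E x) *\<^sub>R G x"
proof -
  have fder: "(f has_real_derivative df t) (at t)" and dcont: "continuous_on UNIV df"
    and f0: "t \<le> a \<or> b \<le> t \<Longrightarrow> f t = 0" and d0: "t \<le> a \<or> b \<le> t \<Longrightarrow> df t = 0" for t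
    using f by (auto simp: level_pair_def)
  have fcont: "continuous_on UNIV f"
    by (auto intro!: continuous_at_imp_continuous_on DERIV_isCont fder)
  obtain C C0 e De where C: "compact C" "C \<subseteq> \<Omega> - K" and C0: "compact C0" "C0 \<subseteq> \<Omega>"
    and EC: "\<And>x. x \<in> \<Omega> - K \<Longrightarrow> x \<notin> C \<Longrightarrow> E x \<le> a \<or> b \<le> E x"
    and e: "\<And>k x. ((e k :: real^'n \<Rightarrow> real) has_derivative (\<lambda>h. De k x \<bullet> h)) (at x)"
      "\<And>k :: nat. continuous_on UNIV (De k)"
      "Lp_tendsto (lebesgue_on C) p De G" "AE x in lebesgue_on C. (\<lambda>k. e k x) \<longlonglongrightarrow> E x"
      "\<And>k x. x \<notin> C \<Longrightarrow> e k x \<le> a \<or> b \<le> e k x" "\<And>k x. x \<in> K \<Longrightarrow> b \<le> e k x" "\<And>k x. x \<notin> C0 \<Longrightarrow> e k x \<le> a"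
    by (rule level_approximation[OF blowup boundary ab, of b]) blast+
  have Cs: "C \<in> sets lebesgue" "C \<subseteq> \<Omega>"
    using C by (auto intro: lmeasurable_compact fmeasurableD)
  have econt: "continuous_on UNIV (e k)" for k
    by (meson continuous_at_imp_continuous_on e(1) has_derivative_continuous)
  have fecont: "continuous_on UNIV (\<lambda>x. f (e k x))" for k
    by (rule continuous_on_compose2[OF fcont econt]) simp
  have decont: "continuous_on UNIV (\<lambda>x. df (e k x))" for k
    by (rule continuous_on_compose2[OF dcont econt]) simp
  obtain B where B: "0 < B" "\<And>t. norm (f t) \<le> B"
    using compact_support_bounded[OF fcont compact_Icc[of a b]] f0 by force
  obtain B' where B': "0 < B'" "\<And>t. norm (df t) \<le> B'"
    using compact_support_bounded[OF dcont compact_Icc[of a b]] d0 by force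
  let ?N = "lebesgue_on C"
  have sp: "space ?N = C" by (simp add: space_restrict_space)
  have [measurable]: "G \<in> borel_measurable ?N" "E \<in> borel_measurable ?N"
    and GLp: "Lp_int ?N p G < \<infinity>"
    using in_Lp_E(1,2)[OF C] Cs by (auto simp: in_Lp_iff)
  have [measurable]: "f \<in> borel_measurable borel" "df \<in> borel_measurable borel"
    by (auto intro: borel_measurable_continuous_onI fcont dcont)
  have fE: "(\<lambda>x. f (E x)) \<in> borel_measurable ?N" and dE: "(\<lambda>x. df (E x)) \<in> borel_measurable ?N" by measurable
  \<comment> \<open>On \<Omega> - K this agrees with \<open>f (E x)\<close>. The case distinction
    matters on \<open>K\<close> and outside \<Omega>, where the values of \<open>E\<close> are
    uncontrolled.\<close>
  define u where "u x = (if x \<in> C then f (E x) else 0)" for x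
  define Du where "Du x = (if x \<in> C then df (E x) *\<^sub>R G x else 0)" for x
  define \<Phi> where "\<Phi> k x = f (e k x)" for k x
  define D\<Phi> where "D\<Phi> k x = df (e k x) *\<^sub>R De k x" for k x
  have \<Phi>0: "\<Phi> k x = 0" "D\<Phi> k x = 0" if "x \<notin> C" for k x
    using e(5)[OF that] f0 d0 by (auto simp: \<Phi>_def D\<Phi>_def)
  have \<Phi>O: "\<Phi> k x = 0" "D\<Phi> k x = 0" if "x \<notin> \<Omega>" for k x
    using \<Phi>0[of x k] Cs(2) that by blast+
  have \<Phi>: "C1c \<Omega> (\<Phi> k) (D\<Phi> k)" for k
  proof (rule C1cI[OF _ _ C(1) Cs(2)])
    show "(\<Phi> k has_derivative (\<lambda>y. D\<Phi> k x \<bullet> y)) (at x)" for x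
      unfolding \<Phi>_def D\<Phi>_def
      using has_derivative_compose[OF e(1) fder[unfolded has_field_derivative_def]] by (simp add: mult.commute)
    show "continuous_on UNIV (D\<Phi> k)"
      unfolding D\<Phi>_def by (intro continuous_on_scaleR decont e(2))
  qed (use \<Phi>0 in auto)
  let ?O = "lebesgue_on \<Omega>"
  have \<Omega>m: "\<Omega> \<in> lmeasurable" using \<Omega> by (intro lmeasurable_open)
  have contO: "v \<in> borel_measurable ?O" if "continuous_on UNIV v" for v :: "real^'n \<Rightarrow> 'c::euclidean_space"
    by (intro measurable_restrict_space1 lebesgue_measurable_continuous that)
  have oneC: "Lp_int ?N p (\<lambda>x. 1::real) < \<infinity>"
    using Lp_finite_bounded[OF _ compact_imp_bounded[OF C(1)] Cs(1), of "\<lambda>_. 1 :: real" 1 p] p by simp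
  have "Lp_tendsto ?N p (\<lambda>k x. f (e k x) *\<^sub>R (1::real)) (\<lambda>x. f (E x) *\<^sub>R 1)"
  proof (rule Lp_tendsto_scaleR[OF _ p oneC _ fE, where B=B])
    show "Lp_tendsto ?N p (\<lambda>_ _. 1 :: real) (\<lambda>_. 1)" using p by (simp add: Lp_tendsto_def)
    show "(\<lambda>x. f (e k x)) \<in> borel_measurable ?N" for k
      by (intro measurable_restrict_space1 lebesgue_measurable_continuous fecont)
    show "AE x in ?N. (\<lambda>k. f (e k x)) \<longlonglongrightarrow> f (E x)"
      using e(4) by eventually_elim (rule continuous_on_tendsto_compose[OF fcont], auto)
  qed (use B(2) in auto)
  then have "Lp_tendsto ?N p \<Phi> u"
    by (rule Lp_tendsto_cong) (auto simp: sp \<Phi>_def u_def)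
  then have L\<Phi>: "Lp_tendsto ?O p \<Phi> u"
    using \<Phi>0 p by (intro Lp_tendsto_extend[OF _ Cs(1) Omega_sets Cs(2)]) (auto simp: u_def)
  have "Lp_tendsto ?N p D\<Phi> (\<lambda>x. df (E x) *\<^sub>R G x)"
    unfolding D\<Phi>_def
  proof (rule Lp_tendsto_scaleR[OF e(3) p GLp _ dE, where B=B'])
    show "(\<lambda>x. df (e k x)) \<in> borel_measurable ?N" for k
      by (intro measurable_restrict_space1 lebesgue_measurable_continuous decont)
    show "AE x in ?N. (\<lambda>k. df (e k x)) \<longlonglongrightarrow> df (E x)"
      using e(4) by eventually_elim (rule continuous_on_tendsto_compose[OF dcont], auto)
  qed (use B'(2) in auto)
  then have "Lp_tendsto ?N p D\<Phi> Du"
    by (rule Lp_tendsto_cong) (auto simp: sp Du_def)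
  then have LD\<Phi>: "Lp_tendsto ?O p D\<Phi> Du"
    using \<Phi>0 p by (intro Lp_tendsto_extend[OF _ Cs(1) Omega_sets Cs(2)]) (auto simp: Du_def)
  have um: "u \<in> borel_measurable ?O" "Du \<in> borel_measurable ?O"
    using L\<Phi> LD\<Phi> by (auto simp: Lp_tendsto_def)
  have uB: "\<bar>u x\<bar> \<le> B" for x using B by (auto simp: u_def)
  have Lp_sub: "in_Lp q S v" if "in_Lp q \<Omega> v" "S \<in> sets lebesgue" "S \<subseteq> \<Omega>" for q S and v :: "real^'n \<Rightarrow> 'c::euclidean_space"
  proof -
    have "v \<in> borel_measurable (lebesgue_on S)"
      by (rule measurable_restrict_mono[OF _ that(3)]) (use that(1) in \<open>auto simp: in_Lp_iff\<close>)
    moreover have "Lp_int (lebesgue_on S) q v \<le> Lp_int ?O q v"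
      using that(2,3) by (simp add: nn_integral_restrict_space) (auto intro!: nn_integral_mono simp: indicator_def)
    ultimately show ?thesis using that by (auto simp: in_Lp_iff)
  qed
  have uLp: "in_Lp q \<Omega> u" if "0 \<le> q" for q
    using um(1) Lp_finite_bounded[OF _ \<Omega>(2) Omega_sets, of u B q] uB that by (simp add: in_Lp_iff)
  have DuLp: "in_Lp q \<Omega> Du" if q: "0 < q" "in_Lp q C G" for q
  proof -
    have "Lp_int ?N q Du < \<infinity>"
    proof (rule Lp_finite_scaleR[where W=G and B=B'])
      show "Lp_int ?N q G < \<infinity>"
        using q(2) by (simp add: in_Lp_iff[OF Cs(1)])
      show "norm (Du x) \<le> B' * norm (G x)" if "x \<in> space ?N" for x
        using that B'(2)[of "E x"] by (simp add: sp Du_def mult_right_mono)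
    qed (use B' q in auto)
    also have "Lp_int ?N q Du = Lp_int ?O q Du"
    proof -
      have "ennreal (norm (Du x) powr q) * indicator C x = ennreal (norm (Du x) powr q) * indicator \<Omega> x" for x
        using Cs(2) q(1) by (cases "x \<in> C") (auto simp: Du_def)
      then show ?thesis using Cs(1) by (simp add: nn_integral_restrict_space)
    qed
    finally show ?thesis using um(2) by (simp add: in_Lp_iff)
  qed
  have Dp: "in_Lp p \<Omega> Du" "in_Lp 1 \<Omega> Du"
    using DuLp p in_Lp_E(2,4)[OF C] by auto
  have weak: "has_weak_gradient \<Omega> u Du"
    unfolding has_weak_gradient_def in_Lp_loc_def
  proof (intro conjI allI impI)
    show "in_Lp 1 S u" if "compact S \<and> S \<subseteq> \<Omega>" for S
      using that fmeasurableD[OF lmeasurable_compact[of S]] by (intro Lp_sub[OF uLp]) auto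
    show "in_Lp 1 S Du" if "compact S \<and> S \<subseteq> \<Omega>" for S
      using that fmeasurableD[OF lmeasurable_compact[of S]] by (intro Lp_sub[OF Dp(2)]) auto
    fix \<theta> assume \<theta>: "test_function \<Omega> \<theta>"
    note c\<theta> = test_function_C1c[OF \<theta>]
    obtain S where S: "compact S" "\<And>x. x \<notin> S \<Longrightarrow> \<theta> x = 0" "\<And>x. x \<notin> S \<Longrightarrow> grad \<theta> x = 0"
      using c\<theta> by (rule C1c_support) blast
    obtain B1 where B1: "0 < B1" "\<And>x. norm (\<theta> x) \<le> B1"
      using compact_support_bounded[OF C1cD(3)[OF c\<theta>] S(1,2)] by blast
    obtain B2 where B2: "0 < B2" "\<And>x. norm (grad \<theta> x) \<le> B2"
      using compact_support_bounded[OF C1cD(2)[OF c\<theta>] S(1,3)] by blast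
    have one: "(\<integral>\<^sup>+x. ennreal ((1::real) powr p) \<partial>?O) < \<infinity>"
      using Lp_finite_bounded[OF _ \<Omega>(2) Omega_sets, of "\<lambda>_. 1 :: real" 1 p] p by simp
    have [measurable]: "\<theta> \<in> borel_measurable ?O" "grad \<theta> \<in> borel_measurable ?O"
      by (intro contO C1cD[OF c\<theta>])+
    \<comment> \<open>The identity is proved by components, each of which is a pairing to which
      \<open>Lp_tendsto_integral_inner\<close> applies.\<close>
    have "(\<integral>x. u x *\<^sub>R grad \<theta> x \<partial>?O) \<bullet> axis i 1 = (- (\<integral>x. \<theta> x *\<^sub>R Du x \<partial>?O)) \<bullet> axis i 1" for i
    proof -
      have l1: "(\<lambda>k. \<integral>x. (grad \<theta> x $ i) \<bullet> \<Phi> k x \<partial>?O) \<longlonglongrightarrow> (\<integral>x. (grad \<theta> x $ i) \<bullet> u x \<partial>?O)"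
      proof (rule Lp_tendsto_integral_inner[OF p L\<Phi> _ _ _ _ one, where C=B2])
        show "norm (grad \<theta> x $ i) \<le> B2 * 1 powr (p - 1)" for x
          using B2(2)[of x] component_le_norm_cart[of "grad \<theta> x" i] by simp
        show "(\<lambda>x. grad \<theta> x $ i) \<in> borel_measurable ?O"
          by (intro contO continuous_on_component C1cD[OF c\<theta>])
        show "Lp_int ?O p u < \<infinity>"
          using uLp[of p] p by (simp add: in_Lp_iff)
      qed auto
      have l2: "(\<lambda>k. \<integral>x. (\<theta> x *\<^sub>R axis i 1) \<bullet> D\<Phi> k x \<partial>?O) \<longlonglongrightarrow> (\<integral>x. (\<theta> x *\<^sub>R axis i 1) \<bullet> Du x \<partial>?O)"
      proof (rule Lp_tendsto_integral_inner[OF p LD\<Phi> _ _ _ _ one, where C=B1])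
        show "norm (\<theta> x *\<^sub>R axis i (1::real)) \<le> B1 * 1 powr (p - 1)" for x
          using B1(2)[of x] by simp
        show "(\<lambda>x. \<theta> x *\<^sub>R axis i (1::real)) \<in> borel_measurable ?O"
          by (intro contO continuous_on_scaleR C1cD(3)[OF c\<theta>] continuous_on_const)
        show "Lp_int ?O p Du < \<infinity>"
          using Dp(1) by (simp add: in_Lp_iff)
      qed auto
      have ibp: "(\<integral>x. (grad \<theta> x $ i) \<bullet> \<Phi> k x \<partial>?O) = - (\<integral>x. (\<theta> x *\<^sub>R axis i 1) \<bullet> D\<Phi> k x \<partial>?O)" for k
      proof -
        \<comment> \<open>The integral of the gradient of this product vanishes, which is
          integration by parts for \<open>\<Phi> k\<close>.\<close>
        have prod: "C1c \<Omega> (\<lambda>x. \<theta> x * \<Phi> k x) (\<lambda>x. \<theta> x *\<^sub>R D\<Phi> k x + \<Phi> k x *\<^sub>R grad \<theta> x)"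
        proof (rule C1cI[OF _ _ C(1) Cs(2)])
          show "((\<lambda>x. \<theta> x * \<Phi> k x) has_derivative (\<lambda>h. (\<theta> x *\<^sub>R D\<Phi> k x + \<Phi> k x *\<^sub>R grad \<theta> x) \<bullet> h)) (at x)" for x
            by (rule has_derivative_eq_rhs[OF has_derivative_mult[OF C1cD(1)[OF c\<theta>] C1cD(1)[OF \<Phi>]]])
              (auto simp: inner_add_left algebra_simps)
          show "continuous_on UNIV (\<lambda>x. \<theta> x *\<^sub>R D\<Phi> k x + \<Phi> k x *\<^sub>R grad \<theta> x)"
            by (intro continuous_intros C1cD[OF c\<theta>] C1cD[OF \<Phi>])
        qed (use \<Phi>0 in auto)
        have i1: "integrable lebesgue (\<lambda>x. (\<theta> x *\<^sub>R axis i 1) \<bullet> D\<Phi> k x)"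
          by (rule compact_support_integrable[OF _ C(1)])
            (use \<Phi>0 in \<open>auto intro!: continuous_intros C1cD[OF c\<theta>] C1cD[OF \<Phi>]\<close>)
        have i2: "integrable lebesgue (\<lambda>x. (grad \<theta> x $ i) \<bullet> \<Phi> k x)"
          by (rule compact_support_integrable[OF _ C(1)])
            (use \<Phi>0 in \<open>auto intro!: continuous_intros C1cD[OF c\<theta>] C1cD[OF \<Phi>]\<close>)
        have i3: "integrable lebesgue (\<lambda>x. \<theta> x *\<^sub>R D\<Phi> k x + \<Phi> k x *\<^sub>R grad \<theta> x)"
          by (rule compact_support_integrable[OF C1cD(2)[OF prod] C(1)]) (use \<Phi>0 in auto)
        have "0 = (\<integral>x. \<theta> x *\<^sub>R D\<Phi> k x + \<Phi> k x *\<^sub>R grad \<theta> x \<partial>lebesgue) \<bullet> axis i 1"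
          by (simp add: C1c_integral_grad_eq_0[OF prod])
        also have "\<dots> = (\<integral>x. (\<theta> x *\<^sub>R D\<Phi> k x + \<Phi> k x *\<^sub>R grad \<theta> x) \<bullet> axis i 1 \<partial>lebesgue)"
          by (rule integral_inner_left[symmetric]) (use i3 in auto)
        also have "\<dots> = (\<integral>x. (\<theta> x *\<^sub>R axis i 1) \<bullet> D\<Phi> k x + (grad \<theta> x $ i) \<bullet> \<Phi> k x \<partial>lebesgue)"
          by (intro Bochner_Integration.integral_cong refl) (simp add: inner_add_left inner_axis inner_axis' mult.commute)
        also have "\<dots> = (\<integral>x. (\<theta> x *\<^sub>R axis i 1) \<bullet> D\<Phi> k x \<partial>lebesgue) + (\<integral>x. (grad \<theta> x $ i) \<bullet> \<Phi> k x \<partial>lebesgue)"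
          by (rule Bochner_Integration.integral_add[OF i1 i2])
        also have "(\<integral>x. (\<theta> x *\<^sub>R axis i 1) \<bullet> D\<Phi> k x \<partial>lebesgue) = (\<integral>x. (\<theta> x *\<^sub>R axis i 1) \<bullet> D\<Phi> k x \<partial>?O)"
          using \<Phi>O Omega_sets by (subst integral_restrict_space) (auto intro!: Bochner_Integration.integral_cong simp: indicator_def)
        also have "(\<integral>x. (grad \<theta> x $ i) \<bullet> \<Phi> k x \<partial>lebesgue) = (\<integral>x. (grad \<theta> x $ i) \<bullet> \<Phi> k x \<partial>?O)"
          using \<Phi>O Omega_sets by (subst integral_restrict_space) (auto intro!: Bochner_Integration.integral_cong simp: indicator_def)
        finally show ?thesis by simp
      qed
      have lim: "(\<integral>x. (grad \<theta> x $ i) \<bullet> u x \<partial>?O) = - (\<integral>x. (\<theta> x *\<^sub>R axis i 1) \<bullet> Du x \<partial>?O)"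
        by (rule LIMSEQ_unique[OF l1]) (use tendsto_minus[OF l2] ibp in simp)
      have iDu: "integrable ?O Du" using Dp(2) by (simp add: in_Lp_iff integrable_iff_bounded)
      have iu: "integrable ?O u" using uLp[of 1] by (simp add: in_Lp_iff integrable_iff_bounded)
      have j1: "integrable ?O (\<lambda>x. u x *\<^sub>R grad \<theta> x)"
        by (rule Bochner_Integration.integrable_bound[of _ "\<lambda>x. B2 * u x"])
          (use iu um B2 in \<open>auto intro!: AE_I2 mult_left_mono simp: abs_mult mult.commute[of B2]\<close>)
      have j2: "integrable ?O (\<lambda>x. \<theta> x *\<^sub>R Du x)"
        by (rule Bochner_Integration.integrable_bound[of _ "\<lambda>x. B1 *\<^sub>R Du x"])
          (use iDu um B1 in \<open>auto intro!: AE_I2 mult_right_mono\<close>)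
      have "(\<integral>x. u x *\<^sub>R grad \<theta> x \<partial>?O) \<bullet> axis i 1 = (\<integral>x. (u x *\<^sub>R grad \<theta> x) \<bullet> axis i 1 \<partial>?O)"
        by (rule integral_inner_left[symmetric]) (use j1 in auto)
      also have "\<dots> = (\<integral>x. (grad \<theta> x $ i) \<bullet> u x \<partial>?O)"
        by (intro Bochner_Integration.integral_cong refl) (simp add: inner_axis mult.commute)
      also note lim
      also have "(\<integral>x. (\<theta> x *\<^sub>R axis i 1) \<bullet> Du x \<partial>?O) = (\<integral>x. (\<theta> x *\<^sub>R Du x) \<bullet> axis i 1 \<partial>?O)"
        by (intro Bochner_Integration.integral_cong refl) (simp add: inner_axis inner_axis')
      also have "\<dots> = (\<integral>x. \<theta> x *\<^sub>R Du x \<partial>?O) \<bullet> axis i 1"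
        by (rule integral_inner_left) (use j2 in auto)
      finally show ?thesis by simp
    qed
    then have "(\<integral>x. u x *\<^sub>R grad \<theta> x \<partial>?O) = - (\<integral>x. \<theta> x *\<^sub>R Du x \<partial>?O)"
      by (simp add: vec_eq_iff inner_axis)
    then show "set_lebesgue_integral lebesgue \<Omega> (\<lambda>x. u x *\<^sub>R grad \<theta> x) = - set_lebesgue_integral lebesgue \<Omega> (\<lambda>x. \<theta> x *\<^sub>R Du x)"
      by (simp add: set_lebesgue_integral_def integral_restrict_space)
  qed
  \<comment> \<open>\<open>in_W1p_0\<close> asks for smooth approximants, while
    \<open>\<Phi> k\<close> is only C1; a uniform error tending to 0 is harmless on the bounded set
    \<Omega>.\<close>
  have "\<exists>\<phi>. test_function \<Omega> \<phi> \<and> (\<forall>x. \<bar>\<phi> x - \<Phi> k x\<bar> \<le> inverse (Suc k) \<and> norm (grad \<phi> x - D\<Phi> k x) \<le> inverse (Suc k))" for k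
  proof (rule C1c_dense[OF \<Phi>[of k] \<Omega>(1)])
    fix S assume "\<And>e. 0 < e \<Longrightarrow> \<exists>\<phi>. test_function \<Omega> \<phi> \<and> (\<forall>x. x \<notin> S \<longrightarrow> \<phi> x = 0 \<and> grad \<phi> x = 0) \<and>
       (\<forall>x. \<bar>\<phi> x - \<Phi> k x\<bar> \<le> e \<and> norm (grad \<phi> x - D\<Phi> k x) \<le> e)"
    from this[of "inverse (Suc k)"] show ?thesis by auto
  qed
  then obtain \<phi> where \<phi>: "\<And>k. test_function \<Omega> (\<phi> k)"
    "\<And>k x. \<bar>\<phi> k x - \<Phi> k x\<bar> \<le> inverse (Suc k)" "\<And>k x. norm (grad (\<phi> k) x - D\<Phi> k x) \<le> inverse (Suc k)" by metis
  note c\<phi> = test_function_C1c[OF \<phi>(1)]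
  have "Lp_tendsto ?O p (\<lambda>k x. \<phi> k x - \<Phi> k x) (\<lambda>_. 0)"
    using \<phi>(2) p by (intro Lp_tendsto_0_uniform \<Omega>m contO continuous_on_diff C1cD(3)[OF c\<phi>] C1cD(3)[OF \<Phi>]) auto
  from Lp_tendsto_add[OF L\<Phi> this] have A1: "Lp_tendsto ?O p \<phi> u" using p by simp
  have "Lp_tendsto ?O p (\<lambda>k x. grad (\<phi> k) x - D\<Phi> k x) (\<lambda>_. 0)"
    using \<phi>(3) p by (intro Lp_tendsto_0_uniform \<Omega>m contO continuous_on_diff C1cD(2)[OF c\<phi>] C1cD(2)[OF \<Phi>]) auto
  from Lp_tendsto_add[OF LD\<Phi> this] have A2: "Lp_tendsto ?O p (\<lambda>k. grad (\<phi> k)) Du" using p by simp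
  have [measurable]: "\<phi> k \<in> borel_measurable ?O" "grad (\<phi> k) \<in> borel_measurable ?O" "u \<in> borel_measurable ?O" "Du \<in> borel_measurable ?O" for k
    using A1 A2 by (auto simp: Lp_tendsto_def)
  have "(\<lambda>k. (\<integral>\<^sup>+x. ennreal (\<bar>\<phi> k x - u x\<bar> powr p) \<partial>?O) + Lp_int ?O p (\<lambda>x. grad (\<phi> k) x - Du x)) \<longlonglongrightarrow> 0 + 0"
    using A1 A2 by (intro tendsto_add) (auto simp: Lp_tendsto_def)
  also have "(\<lambda>k. (\<integral>\<^sup>+x. ennreal (\<bar>\<phi> k x - u x\<bar> powr p) \<partial>?O) + Lp_int ?O p (\<lambda>x. grad (\<phi> k) x - Du x)) =
      (\<lambda>k. \<integral>\<^sup>+x\<in>\<Omega>. ennreal (\<bar>\<phi> k x - u x\<bar> powr p + norm (grad (\<phi> k) x - Du x) powr p) \<partial>lebesgue)"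
  proof
    fix k
    have "(\<integral>\<^sup>+x\<in>\<Omega>. ennreal (\<bar>\<phi> k x - u x\<bar> powr p + norm (grad (\<phi> k) x - Du x) powr p) \<partial>lebesgue) =
       (\<integral>\<^sup>+x. ennreal (\<bar>\<phi> k x - u x\<bar> powr p) + ennreal (norm (grad (\<phi> k) x - Du x) powr p) \<partial>?O)"
      by (simp add: nn_integral_restrict_space)
    then show "(\<integral>\<^sup>+x. ennreal (\<bar>\<phi> k x - u x\<bar> powr p) \<partial>?O) + Lp_int ?O p (\<lambda>x. grad (\<phi> k) x - Du x) =
      (\<integral>\<^sup>+x\<in>\<Omega>. ennreal (\<bar>\<phi> k x - u x\<bar> powr p + norm (grad (\<phi> k) x - Du x) powr p) \<partial>lebesgue)"
      by (simp add: nn_integral_add)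
  qed
  finally have "in_W1p_0 p \<Omega> u Du"
    unfolding in_W1p_0_def in_W1p_def using weak uLp[of p] Dp(1) p \<phi>(1) by (auto intro!: exI[of _ \<phi>])
  then show thesis
  proof (rule that)
    show "u x = f (E x)" if "x \<in> \<Omega> - K" for x
      using EC[OF that] f0[of "E x"] by (auto simp: u_def)
    show "Du x = df (E x) *\<^sub>R G x" if "x \<in> \<Omega> - K" for x
      using EC[OF that] d0[of "E x"] by (auto simp: Du_def)
  qed
qed

text \<open>For \<open>u = f (E x)\<close>, \<open>level_integral\<close> gives both sides the
  common factor \<open>measure \<mu> UNIV\<close>. It is positive and finite, so cancelling it
  leaves the one-dimensional inequality that \<open>F1 b < c * F2 b\<close> contradicts.\<close>

lemma not_hardy:
  assumes blowup: "\<And>x. x \<in> K \<Longrightarrow> filterlim E at_top (at x within (\<Omega> - K))"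
    and boundary: "\<And>x. x \<in> frontier \<Omega> \<Longrightarrow> (E \<longlongrightarrow> \<gamma>) (at x within \<Omega>)"
    and ab: "\<gamma> < a" "0 < a"
    and f: "level_pair a b f df" "\<And>t. b \<le> t \<Longrightarrow> f t = 0"
    and F1: "level_pair a b F1 (\<lambda>t. \<bar>df t\<bar> powr p)"
    and F2: "level_pair a b F2 (\<lambda>t. (\<bar>f t\<bar> / max t a) powr p)"
    and c: "0 \<le> c" "0 \<le> F1 b" "0 \<le> F2 b" "F1 b < c * F2 b" and m: "0 < measure \<mu> UNIV"
  shows "\<not> hardy_inequality p A \<Omega> E G c"
proof
  assume hardy: "hardy_inequality p A \<Omega> E G c"
  obtain u Du where u: "in_W1p_0 p \<Omega> u Du" "\<And>x. x \<in> \<Omega> - K \<Longrightarrow> u x = f (E x)" "\<And>x. x \<in> \<Omega> - K \<Longrightarrow> Du x = df (E x) *\<^sub>R G x"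
    by (rule level_function_in_W1p_0[OF blowup boundary ab f]) blast+
  have sp: "space M = \<Omega> - K" by (simp add: space_restrict_space)
  have "(\<integral>\<^sup>+x. ennreal (norm_A (A x) (Du x) powr p) \<partial>M) = (\<integral>\<^sup>+x. ennreal (\<bar>df (E x)\<bar> powr p * norm_A (A x) (G x) powr p) \<partial>M)"
    by (intro nn_integral_cong) (simp add: sp u(3) nA_scaleR_powr)
  also have "\<dots> = ennreal (F1 b * measure \<mu> UNIV)"
    by (rule level_integral[OF blowup boundary ab F1]) auto
  finally have lhs: "(\<integral>\<^sup>+x. ennreal (norm_A (A x) (Du x) powr p) \<partial>M) = ennreal (F1 b * measure \<mu> UNIV)" .
  have "(\<integral>\<^sup>+x. ennreal (norm_A (A x) (G x) powr p / E x powr p * \<bar>u x\<bar> powr p) \<partial>M) =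
      (\<integral>\<^sup>+x. ennreal ((\<bar>f (E x)\<bar> / max (E x) a) powr p * norm_A (A x) (G x) powr p) \<partial>M)"
  proof (intro nn_integral_cong)
    fix x assume x: "x \<in> space M"
    show "ennreal (norm_A (A x) (G x) powr p / E x powr p * \<bar>u x\<bar> powr p) = ennreal ((\<bar>f (E x)\<bar> / max (E x) a) powr p * norm_A (A x) (G x) powr p)"
    \<comment> \<open>Below \<open>a\<close> the factor \<open>f (E x)\<close> vanishes; above it
      the maximum is \<open>E x\<close>.\<close>
    proof (cases "E x \<le> a")
      case True
      then have "f (E x) = 0" using f(1) by (simp add: level_pair_def)
      then show ?thesis using x p by (simp add: sp u(2))
    next
      case False
      then show ?thesis using x ab by (simp add: sp u(2) powr_divide max_def)
    qed
  qed
  also have "\<dots> = ennreal (F2 b * measure \<mu> UNIV)"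
    by (rule level_integral[OF blowup boundary ab F2]) auto
  finally have rhs: "(\<integral>\<^sup>+x. ennreal (norm_A (A x) (G x) powr p / E x powr p * \<bar>u x\<bar> powr p) \<partial>M) = ennreal (F2 b * measure \<mu> UNIV)" .
  have "ennreal c * ennreal (F2 b * measure \<mu> UNIV) \<le> ennreal (F1 b * measure \<mu> UNIV)"
    using hardy u(1) unfolding hardy_inequality_def nn_integral_Omega lhs[symmetric] rhs[symmetric] by blast
  then have "ennreal (c * (F2 b * measure \<mu> UNIV)) \<le> ennreal (F1 b * measure \<mu> UNIV)"
    using c m by (simp add: ennreal_mult)
  then have "c * (F2 b * measure \<mu> UNIV) \<le> F1 b * measure \<mu> UNIV"
    using c m by (subst (asm) ennreal_le_iff) auto
  then have "c * F2 b \<le> F1 b"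
    using m by (simp add: mult.assoc[symmetric] del: mult.assoc)
  with c(4) show False by simp
qed

end

section \<open>Box dimension\<close>

text \<open>A set of diameter \<open>d\<close> lies in a ball of radius \<open>d\<close> about any
  of its points. Compared with the isodiametric inequality this loses the factor
  \<open>2 ^ CARD('n)\<close>, which is harmless in \<open>box_dim_thin\<close>. One scale is
  enough, because the Hausdorff measure is a supremum over scales.\<close>

lemma emeasure_le_hausdorff_measure:
  fixes S :: "(real^'n::finite) set"
  shows "ennreal (1 / 2 ^ CARD('n)) * emeasure lebesgue S \<le> hausdorff_measure (real CARD('n)) S"
proof -
  let ?n = "CARD('n)"
  have "ennreal (1 / 2 ^ ?n) * emeasure lebesgue S \<le> hausdorff_premeasure (real ?n) 1 S"
    unfolding hausdorff_premeasure_def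
  proof (rule INF_greatest)
    fix C :: "nat \<Rightarrow> (real^'n) set"
    assume "C \<in> {C. S \<subseteq> (\<Union>i. C i) \<and> (\<forall>i. bounded (C i) \<and> diameter (C i) \<le> 1)}"
    then have C: "S \<subseteq> (\<Union>i. C i)" "\<And>i. bounded (C i)" by auto
    have "\<exists>x. C i \<subseteq> cball x (diameter (C i))" for i
    proof (cases "C i = {}")
      case False
      then obtain x where "x \<in> C i" by blast
      then show ?thesis using diameter_bounded_bound[OF C(2)] by (intro exI[of _ x]) auto
    qed auto
    then obtain x where x: "\<And>i. C i \<subseteq> cball (x i) (diameter (C i))" by metis
    have "emeasure lebesgue S \<le> emeasure lebesgue (\<Union>i. cball (x i) (diameter (C i)))"
    proof (rule emeasure_mono)
      have "(\<Union>i. C i) \<subseteq> (\<Union>i. cball (x i) (diameter (C i)))" by (rule UN_mono[OF subset_refl x])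
      with C(1) show "S \<subseteq> (\<Union>i. cball (x i) (diameter (C i)))" by (rule subset_trans)
    qed auto
    also have "\<dots> \<le> (\<Sum>i. emeasure lebesgue (cball (x i) (diameter (C i))))"
      by (intro emeasure_subadditive_countably) auto
    also have "\<dots> = (\<Sum>i. ennreal (2 ^ ?n) * ennreal (unit_ball_vol (real ?n) * (diameter (C i) / 2) powr real ?n))"
    proof (intro suminf_cong)
      fix i
      have d: "0 \<le> diameter (C i)" by (rule diameter_ge_0[OF C(2)])
      have "(diameter (C i) / 2) powr real ?n = diameter (C i) ^ ?n / 2 ^ ?n"
        using d by (cases "diameter (C i) = 0") (auto simp: powr_realpow power_divide)
      then show "emeasure lebesgue (cball (x i) (diameter (C i))) = ennreal (2 ^ ?n) * ennreal (unit_ball_vol (real ?n) * (diameter (C i) / 2) powr real ?n)"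
        using d by (simp add: emeasure_cball flip: ennreal_mult)
    qed
    also have "\<dots> = ennreal (2 ^ ?n) * (\<Sum>i. ennreal (unit_ball_vol (real ?n) * (diameter (C i) / 2) powr real ?n))"
      by (rule ennreal_suminf_cmult)
    finally have "ennreal (1 / 2 ^ ?n) * emeasure lebesgue S \<le>
       ennreal (1 / 2 ^ ?n) * (ennreal (2 ^ ?n) * (\<Sum>i. ennreal (unit_ball_vol (real ?n) * (diameter (C i) / 2) powr real ?n)))"
      by (intro mult_left_mono) auto
    also have "\<dots> = (\<Sum>i. ennreal (unit_ball_vol (real ?n) * (diameter (C i) / 2) powr real ?n))"
      by (simp add: mult.assoc[symmetric] ennreal_mult[symmetric])
    finally show "ennreal (1 / 2 ^ ?n) * emeasure lebesgue S \<le> (\<Sum>i. ennreal (unit_ball_vol (real ?n) * (diameter (C i) / 2) powr real ?n))" .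
  qed
  also have "\<dots> \<le> hausdorff_measure (real ?n) S"
    unfolding hausdorff_measure_def by (intro SUP_upper) auto
  finally show ?thesis .
qed

text \<open>The logarithmic quotient tends to \<open>l > p\<close>. For \<open>q\<close> strictly
  between, and because \<open>ln r\<close> is negative, the volume is eventually below
  \<open>r powr q\<close>; the gained factor \<open>r powr (q - p)\<close> absorbs \<open>e\<close>
  and all constants.\<close>

lemma box_dim_thin:
  fixes \<Omega> K :: "(real^'n::finite) set"
  assumes dim: "has_box_dim \<Omega> K d" "d < real CARD('n) - p" and p: "0 < p"
    and \<Omega>: "open \<Omega>" and K: "compact K" "K \<subseteq> \<Omega>" "K \<noteq> {}" and e: "0 < e"
  shows "\<exists>r. 0 < r \<and> r < e \<and> emeasure lebesgue {x. infdist x K < r} \<le> ennreal (e * r powr p)"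
proof -
  let ?H = "\<lambda>r. hausdorff_measure (real CARD('n)) {x\<in>\<Omega>. infdist x K < r}"
  obtain l where l: "((\<lambda>r. ln (enn2real (?H r)) / ln r) \<longlongrightarrow> l) (at_right 0)" "d = real CARD('n) - l"
    using dim(1) unfolding has_box_dim_def by blast
  have "p < l" using l(2) dim(2) by simp
  then obtain q where q: "p < q" "q < l" using dense by blast
  \<comment> \<open>Below this radius the neighbourhood of \<open>K\<close> lies in \<Omega>, so the
    restriction to \<Omega> in the box dimension disappears.\<close>
  obtain \<rho> where \<rho>: "0 < \<rho>" "{x. infdist x K \<le> \<rho>} \<subseteq> \<Omega>"
    using compact_in_open_separated[OF K(3,1) \<Omega> K(2)] by blast
  have "((\<lambda>r::real. 2 ^ CARD('n) * r powr (q - p)) \<longlongrightarrow> 2 ^ CARD('n) * 0) (at_right 0)"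
    using q(1) by (intro tendsto_mult tendsto_const tendsto_zero_powrI[where b="q - p"])
      (auto intro: tendsto_ident_at simp: eventually_at_filter)
  then have ev: "\<forall>\<^sub>F r in at_right 0. 2 ^ CARD('n) * r powr (q - p) < e"
    using e by (intro order_tendstoD(2)) auto
  have "\<forall>\<^sub>F r in at_right 0. 0 < r \<and> r < min e (min 1 \<rho>)"
    unfolding eventually_at_right_field using e \<rho>(1) by (intro exI[of _ "min e (min 1 \<rho>)"]) auto
  then have "\<forall>\<^sub>F r in at_right 0. 0 < r \<and> r < min e (min 1 \<rho>) \<and> q < ln (enn2real (?H r)) / ln r \<and> 2 ^ CARD('n) * r powr (q - p) < e"
    using order_tendstoD(1)[OF l(1) q(2)] ev by eventually_elim auto
  from eventually_happens'[OF _ this]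
  obtain r where r: "0 < r" "r < e" "r < 1" "r < \<rho>" "q < ln (enn2real (?H r)) / ln r" "2 ^ CARD('n) * r powr (q - p) < e"
    by auto
  define h where "h = enn2real (?H r)"
  have lnr: "ln r < 0" using r by simp
  have lnh: "ln h < q * ln r" using r(5) lnr by (simp add: h_def less_divide_eq)
  moreover have "q * ln r < 0" using q p lnr by (simp add: mult_pos_neg)
  \<comment> \<open>By convention \<open>ln 0 = 0\<close>, which is not negative. This also excludes
    infinite Hausdorff measure, which \<open>enn2real\<close> sends to 0.\<close>
  ultimately have "h \<noteq> 0" by auto
  then have h: "0 < h" "?H r = ennreal h"
    using enn2real_nonneg[of "?H r"] unfolding h_def
    by (auto simp: less_le intro!: ennreal_enn2real[symmetric] elim: enn2real_positive_iff[THEN iffD1, THEN conjunct2])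
  have "h < r powr q"
    using lnh h(1) r(1) by (metis exp_ln exp_less_mono mult.commute powr_def less_irrefl)
  have eq: "{x. infdist x K < r} = {x\<in>\<Omega>. infdist x K < r}"
    using \<rho>(2) r(4) by (auto simp: subset_iff)
  have "emeasure lebesgue {x. infdist x K < r} = ennreal (2 ^ CARD('n)) * (ennreal (1 / 2 ^ CARD('n)) * emeasure lebesgue {x. infdist x K < r})"
    by (simp add: mult.assoc[symmetric] ennreal_mult[symmetric])
  also have "\<dots> \<le> ennreal (2 ^ CARD('n)) * ?H r"
    unfolding eq by (intro mult_left_mono emeasure_le_hausdorff_measure) auto
  also have "\<dots> = ennreal (2 ^ CARD('n) * h)"
    using h by (simp add: ennreal_mult)
  also have "\<dots> \<le> ennreal (e * r powr p)"
  proof (rule ennreal_leI)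
    have "2 ^ CARD('n) * h \<le> 2 ^ CARD('n) * r powr q" using \<open>h < r powr q\<close> by simp
    also have "\<dots> = (2 ^ CARD('n) * r powr (q - p)) * r powr p"
      by (simp add: mult.assoc flip: powr_add)
    also have "\<dots> \<le> e * r powr p" using r(6) by (intro mult_right_mono) auto
    finally show "2 ^ CARD('n) * h \<le> e * r powr p" .
  qed
  finally show ?thesis using r by blast
qed

text \<open>For radii below 1 the bound \<open>e * r powr p\<close> is at most
  \<open>e\<close>.\<close>

lemma thin_null_set:
  fixes K :: "(real^'n::finite) set"
  assumes K: "compact K" and p: "0 < p"
    and thin: "\<And>e. 0 < e \<Longrightarrow> \<exists>r. 0 < r \<and> r < e \<and> emeasure lebesgue {x. infdist x K < r} \<le> ennreal (e * r powr p)"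
  shows "K \<in> null_sets lebesgue"
proof (rule null_setsI)
  show "K \<in> sets lebesgue" using K by (auto intro: lmeasurable_compact fmeasurableD)
  have "emeasure lebesgue K \<le> ennreal e" if e: "0 < e" "e < 1" for e
  proof -
    obtain r where r: "0 < r" "r < e" "emeasure lebesgue {x. infdist x K < r} \<le> ennreal (e * r powr p)"
      using thin[OF e(1)] by blast
    have "open {x. infdist x K < r}" by (intro open_Collect_less continuous_intros)
    then have "emeasure lebesgue K \<le> emeasure lebesgue {x. infdist x K < r}"
      using r(1) by (intro emeasure_mono) auto
    also note r(3)
    also have "ennreal (e * r powr p) \<le> ennreal e"
      using e r p powr_le1[of p r] by (intro ennreal_leI mult_left_le) auto
    finally show ?thesis .
  qed
  note le = this
  have "emeasure lebesgue K \<le> ennreal e" if "0 < e" for e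
  proof -
    have "emeasure lebesgue K \<le> ennreal (min e (1 / 2))" by (rule le) (use that in auto)
    also have "\<dots> \<le> ennreal e" by (rule ennreal_leI) simp
    finally show ?thesis .
  qed
  then have "emeasure lebesgue K \<le> 0 + ennreal e" if "0 < e" for e
    using that by simp
  then have "emeasure lebesgue K \<le> 0"
    by (rule ennreal_le_epsilon)
  then show "emeasure lebesgue K = 0" by simp
qed

theorem theorem2p18:
  fixes \<Omega> K :: "(real^'n::finite) set"
    and A :: "real^'n \<Rightarrow> real^'n^'n"
    and p d :: real
    and \<mu> :: "(real^'n) measure"
    and E :: "real^'n \<Rightarrow> real"
    and G :: "real^'n \<Rightarrow> real^'n"
  assumes domain: "smooth_bounded_domain \<Omega>"
    and A: "admissible_matrix \<Omega> A"
    and p: "1 < p" "p \<le> real CARD('n)"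
    and K: "compact K" "K \<subseteq> \<Omega>"
    and dim: "has_box_dim \<Omega> K d" "d < real CARD('n) - p"
    and mu: "sets \<mu> = sets borel" "finite_measure \<mu>" "emeasure \<mu> UNIV \<noteq> 0"
    and supp: "emeasure \<mu> (- K) = 0"
    and E_pos: "\<forall>x\<in>\<Omega> - K. 0 < E x"
    and E_sol: "solves_measure_equation p A \<Omega> K \<mu> E G"
  shows "hardy_inequality p A \<Omega> E G (((p - 1) / p) powr p)
    \<and> (\<forall>\<gamma>\<ge>0.
          (\<forall>x\<in>K. filterlim E at_top (at x within (\<Omega> - K))) \<and>
          (\<forall>x\<in>frontier \<Omega>. (E \<longlongrightarrow> \<gamma>) (at x within \<Omega>)) \<longrightarrow>
          (\<forall>c > ((p - 1) / p) powr p. \<not> hardy_inequality p A \<Omega> E G c))"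
proof -
  \<comment> \<open>An empty \<open>K\<close> would make the complement the whole space and \<mu>
    the zero measure.\<close>
  have K_nonempty: "K \<noteq> {}" using supp mu(3) by auto
  have \<Omega>: "open \<Omega>" "bounded \<Omega>" using domain by (auto simp: smooth_bounded_domain_def)
  have thin: "\<exists>r. 0 < r \<and> r < e \<and> emeasure lebesgue {x. infdist x K < r} \<le> ennreal (e * r powr p)" if "0 < e" for e
    by (rule box_dim_thin[OF dim _ \<Omega>(1) K K_nonempty that]) (use p in simp)
  have null: "K \<in> null_sets lebesgue"
    by (rule thin_null_set[OF K(1) _ thin]) (use p in simp_all)
  have m: "0 < measure \<mu> UNIV"
    using finite_measure.emeasure_eq_measure[OF mu(2), of UNIV] mu(3) by (simp add: zero_less_measure_iff)
  interpret p_potential_null_capacity \<Omega> K A p \<mu> E G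
    by (intro p_potential_null_capacity.intro p_potential.intro p_potential_null_capacity_axioms.intro
        \<Omega> A p K null mu supp E_sol K_nonempty thin) (use E_pos in auto)
  have "\<not> hardy_inequality p A \<Omega> E G c"
    if "0 \<le> \<gamma>" and blowup: "\<forall>x\<in>K. filterlim E at_top (at x within (\<Omega> - K))"
      and boundary: "\<forall>x\<in>frontier \<Omega>. (E \<longlongrightarrow> \<gamma>) (at x within \<Omega>)" and c: "((p - 1) / p) powr p < c" for \<gamma> c
  proof -
    \<comment> \<open>The level lies above the boundary value, so \<open>E\<close> stays below it
      near the boundary, and it is positive even for \<open>\<gamma> = 0\<close>, so that
      \<open>ln (t / a)\<close> makes sense.\<close>
    have a: "\<gamma> < \<gamma> + 1" "0 < \<gamma> + 1" using \<open>0 \<le> \<gamma>\<close> by auto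
    obtain b f df F1 F2 where f: "level_pair (\<gamma> + 1) b f df" "\<And>t. b \<le> t \<Longrightarrow> f t = 0"
      and F: "level_pair (\<gamma> + 1) b F1 (\<lambda>t. \<bar>df t\<bar> powr p)"
        "level_pair (\<gamma> + 1) b F2 (\<lambda>t. (\<bar>f t\<bar> / max t (\<gamma> + 1)) powr p)"
      and less: "0 \<le> F1 b" "0 \<le> F2 b" "F1 b < c * F2 b"
      by (rule level_pair_near_optimal[OF p c a(2)]) blast
    have c0: "0 \<le> c" using c powr_ge_zero[of "(p - 1) / p" p] by linarith
    show ?thesis
      by (rule not_hardy[OF _ _ a f F c0 less m]) (use blowup boundary in auto)
  qed
  with hardy show ?thesis by blast
qed

end
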